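(* Let $F$ be a non-archimedean local field with ring of integers $\mathfrak o_F$ and residue cardinality $q$, let $\psi$ be an unramified additive character of $F$ and let $\eta$ be a quasi-character of $F^\times$. Assume that $\pi$ is an unramified ($\psi_U$-generic irreducible) representation of $\mathrm{SO}_4(F)$ with Satake parameter $\mathrm{diag}(a,b,b^{-1},a^{-1})\in\mathrm{SO}_4(\mathbb C)$, that $W^0\in\mathcal W(\pi,\psi_U)$ is the unramified Whittaker function with $W^0(I_4)=1$, that $\phi^0\in\mathcal S(F)$ is the characteristic function of $\mathfrak o_F$, and that $f_s^0\in I(s,\eta,\psi^{-1})$ is the function such that $f_s^0(k)=1$ for $k\in\mathrm{SL}_2(\mathfrak o_F)$. Then $$\Psi(W^0,\phi^0,f_s^0)=\frac{L(s,\pi,\wedge^2_+\times\chi\eta)}{L(2s,\eta^2)}.$$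
   Context: **Groups.** $\varpi$ is a uniformizer of $F$, $(\cdot,\cdot)_F$ the quadratic Hilbert symbol, $\chi(x)=(x,-1)_F$. $J_r$ is the $r\times r$ matrix with ones on the antidiagonal and zeros elsewhere; $\mathrm{SO}_4(F)=\{g\in\mathrm{SL}_4(F): {}^t g J_4 g=J_4\}$. $U$ is its upper triangular unipotent subgroup, consisting of $u(x,y)=\mathbf x_\alpha(x)\mathbf x_\beta(y)$, where $$\mathbf x_\alpha(x)=\begin{pmatrix}1&x&&\\&1&&\\&&1&-x\\&&&1\end{pmatrix},\qquad \mathbf x_\beta(y)=\begin{pmatrix}1&&y&\\&1&&-y\\&&1&\\&&&1\end{pmatrix}.$$ Put $\psi_U(u(x,y))=\psi(x-2y)$; $\mathcal W(\pi,\psi_U)$ is the Whittaker model of a $\psi_U$-generic $\pi$. For $h\in\mathrm{GL}_2(F)$, $\mathbf m(h)=\begin{pmatrix}h&\\&h^*\end{pmatrix}$ with $h^*=J_2\,{}^th^{-1}J_2$. "Unramified Whittaker function" means right invariant under $\mathrm{SO}_4(\mathfrak o_F)$. **$L$-functions.** $\wedge^2_+$ is the 3-dimensional constituent of $\wedge^2\mathbb C^4$ restricted to $\mathrm{SO}_4(\mathbb C)$ on which $\mathrm{diag}(a,b,b^{-1},a^{-1})$ acts with eigenvalues $ab^{-1},1,a^{-1}b$. For $\pi$ as in the claim and a character $\xi$ of $F^\times$, $$L(s,\pi,\wedge^2_+\times\xi)=\frac1{(1-\xi(\varpi)q^{-s})(1-ab^{-1}\xi(\varpi)q^{-s})(1-a^{-1}b\,\xi(\varpi)q^{-s})},\qquad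 L(s,\xi)=\frac{1}{1-\xi(\varpi)q^{-s}}.$$ **Metaplectic group and Weil representation.** In $\mathrm{SL}_2(F)$ write $t_{\mathrm{SL}_2}(a)=\mathrm{diag}(a,a^{-1})$, $\mathbf n(x)=\begin{pmatrix}1&x\\&1\end{pmatrix}$, $N_2=\{\mathbf n(x)\}$, $w_2=\begin{pmatrix}&1\\-1&\end{pmatrix}$. $\widetilde{\mathrm{SL}}_2(F)=\mathrm{SL}_2(F)\times\{\pm1\}$ is the double cover with product $(g_1,\zeta_1)(g_2,\zeta_2)=(g_1g_2,\zeta_1\zeta_2\mathbf c(g_1,g_2))$, $\mathbf c(g_1,g_2)=(\mathbf x(g_1),\mathbf x(g_2))_F(-\mathbf x(g_1)\mathbf x(g_2),\mathbf x(g_1g_2))_F$, where $\mathbf x\begin{pmatrix}a&b\\c&d\end{pmatrix}=c$ if $c\ne0$ and $=d$ if $c=0$; an element $g\in\mathrm{SL}_2(F)$ is sometimes also used to denote $(g,1)$. Let $\gamma(\psi)$ be the Weil index associated to $\psi$, $\psi_a(x)=\psi(ax)$, $\mu_\psi(a)=\gamma(\psi)/\gamma(\psi_a)$. The Weil representation $\omega_\psi$ on the Bruhat–Schwartz space $\mathcal S(F)$ is given by $\omega_\psi(w_2)\phi=\gamma(\psi)\hat\phi$ with $\hat\phi(x)=\int_F\phi(y)\psi(2xy)dy$ (self-dual measure), $\omega_\psi(\mathbf n(b))\phi(x)=\psi(bx^2)\phi(x)$, $\omega_\psi(t_{\mathrm{SL}_2}(a))\phi(x)=|a|^{1/2}\mu_\psi(a)\phi(ax)$,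 $\omega_\psi(\zeta)\phi=\zeta\phi$ for $\zeta\in\{\pm1\}$; $\omega_{\psi^{-1}}$ is the same with $\psi^{-1}$ in place of $\psi$. **Local zeta integral.** $I(s,\eta,\psi^{-1})$ is the space of smooth left $N_2$-invariant functions $f_s$ on $\widetilde{\mathrm{SL}}_2(F)$ with $f_s((t_{\mathrm{SL}_2}(a),\zeta)\tilde h)=\zeta\mu_{\psi^{-1}}(a)\eta(a)|a|^{s+1/2}f_s(\tilde h)$. For $W\in\mathcal W(\pi,\psi_U)$, $\phi\in\mathcal S(F)$, $f_s\in I(s,\eta,\psi^{-1})$, $$\Psi(W,\phi,f_s)=\int_{N_2\backslash\mathrm{SL}_2(F)}W(\mathbf m(h))\,(\omega_{\psi^{-1}}(h)\phi)(1)\,f_s(h)\,dh,$$ convergent for $\mathrm{Re}(s)\gg0$ and defining a meromorphic function of $q^{-s}$. The integrand descends from $\widetilde{\mathrm{SL}}_2(F)$ to $\mathrm{SL}_2(F)$. The measure on $N_2\backslash\mathrm{SL}_2(F)$ is $dh=|a|^{-2}\,d^\times a\,dk$ for $h=n\,t_{\mathrm{SL}_2}(a)k$, $k\in\mathrm{SL}_2(\mathfrak o_F)$, with $\mathfrak o_F^\times$ and $\mathrm{SL}_2(\mathfrak o_F)$ of volume 1.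
   Formalization: The condition f_s^0(k)=1 is imposed at (k,σ(k)), where σ is a splitting of the double cover over SL_2(o_F), since no function in I(s,η,ψ^{-1}) has value 1 at (k,1) for every k in SL_2(o_F). *)

theory Defs
  imports "HOL-Complex_Analysis.Complex_Analysis"
begin

no_notation fps_nth (infixl "$" 75)

section \<open>Non-archimedean local fields\<close>

text \<open>
  A non-archimedean local field is given together with its normalized absolute value
  \<open>nrm x = dist x 0\<close>. Non-triviality is part of the last axiom: the number of residue
  classes \<open>x + \<pp>\<close> is finite by compactness and at least \<open>2\<close>, and some
  element has absolute value equal to its inverse, which is the largest value below \<open>1\<close>.
\<close>

class nonarch_local_field = field + metric_space +
  assumes dist_add_right_cancel: "dist (x + z) (y + z) = dist x y"
    and dist_mult_zero: "dist (x * y) 0 = dist x 0 * dist y 0"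
    and dist_add_ultrametric: "dist (x + y) 0 \<le> max (dist x 0) (dist y 0)"
    and compact_unit_ball: "compact {x::'a. dist x 0 \<le> 1}"
    and dist_normalized:
      "\<exists>w::'a. dist w 0 = 1 / real (card ((\<lambda>x. {y. dist x y < 1}) ` {x::'a. dist x 0 \<le> 1}))
           \<and> (\<forall>x::'a. dist x 0 < 1 \<longrightarrow> dist x 0 \<le> dist w 0)"

definition nrm :: "'a::nonarch_local_field \<Rightarrow> real" where
  "nrm x = dist x 0"

definition integers :: "'a::nonarch_local_field set" where
  "integers = {x. nrm x \<le> 1}"

definition residue_card :: "'a::nonarch_local_field itself \<Rightarrow> nat" where
  "residue_card _ = card ((\<lambda>x. {y. nrm (x - y) < 1}) ` (integers :: 'a set))"

definition uniformizer :: "'a::nonarch_local_field \<Rightarrow> bool" where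
  "uniformizer w \<longleftrightarrow> w \<noteq> 0 \<and> nrm w < 1 \<and> (\<forall>x::'a. nrm x < 1 \<longrightarrow> nrm x \<le> nrm w)"

definition valuation :: "'a::nonarch_local_field \<Rightarrow> int" where
  "valuation x = (THE n. nrm x = real (residue_card TYPE('a)) powi (- n))"

definition hilbert_symbol :: "'a::field \<Rightarrow> 'a \<Rightarrow> int" where
  "hilbert_symbol a b =
     (if \<exists>x y z. (x, y, z) \<noteq> (0, 0, 0) \<and> a * x^2 + b * y^2 = z^2 then 1 else - 1)"

definition chi :: "'a::field \<Rightarrow> complex" where
  "chi x = of_int (hilbert_symbol x (- 1))"

definition additive_character :: "('a::nonarch_local_field \<Rightarrow> complex) \<Rightarrow> bool" where
  "additive_character \<psi> \<longleftrightarrow>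
     continuous_on UNIV \<psi> \<and> (\<forall>x. norm (\<psi> x) = 1) \<and> (\<forall>x y. \<psi> (x + y) = \<psi> x * \<psi> y)"

text \<open>Unramified: the largest fractional ideal on which \<open>\<psi>\<close> is trivial is the ring of
  integers; \<open>{x. nrm x \<le> q}\<close> is the next larger one.\<close>

definition unramified_additive_character :: "('a::nonarch_local_field \<Rightarrow> complex) \<Rightarrow> bool" where
  "unramified_additive_character \<psi> \<longleftrightarrow>
     additive_character \<psi> \<and> (\<forall>x\<in>integers. \<psi> x = 1) \<and>
     (\<exists>x. nrm x \<le> real (residue_card TYPE('a)) \<and> \<psi> x \<noteq> 1)"

definition quasi_character :: "('a::nonarch_local_field \<Rightarrow> complex) \<Rightarrow> bool" where
  "quasi_character \<eta> \<longleftrightarrow>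
     continuous_on (- {0}) \<eta> \<and> (\<forall>x. x \<noteq> 0 \<longrightarrow> \<eta> x \<noteq> 0) \<and>
     (\<forall>x y. x \<noteq> 0 \<longrightarrow> y \<noteq> 0 \<longrightarrow> \<eta> (x * y) = \<eta> x * \<eta> y)"


section \<open>The group \<open>SO\<^sub>4\<close>\<close>

definition J2 :: "'a::field^2^2" where
  "J2 = vector [vector [0, 1], vector [1, 0]]"

definition J4 :: "'a::field^4^4" where
  "J4 = vector [vector [0, 0, 0, 1], vector [0, 0, 1, 0], vector [0, 1, 0, 0], vector [1, 0, 0, 0]]"

lemma vector_4 [simp]:
  "(vector [w, x, y, z] :: 'a::zero^4) $ 1 = w" "(vector [w, x, y, z] :: 'a^4) $ 2 = x"
  "(vector [w, x, y, z] :: 'a^4) $ 3 = y" "(vector [w, x, y, z] :: 'a^4) $ 4 = z"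
  unfolding vector_def by simp_all

definition SO4 :: "('a::field^4^4) set" where
  "SO4 = {g. det g = 1 \<and> transpose g ** J4 ** g = J4}"

definition SO4_int :: "('a::nonarch_local_field^4^4) set" where
  "SO4_int = {g \<in> SO4. \<forall>i j. g $ i $ j \<in> integers}"

definition x_alpha :: "'a::field \<Rightarrow> 'a^4^4" where
  "x_alpha x =
     vector [vector [1, x, 0, 0], vector [0, 1, 0, 0], vector [0, 0, 1, - x], vector [0, 0, 0, 1]]"

definition x_beta :: "'a::field \<Rightarrow> 'a^4^4" where
  "x_beta y =
     vector [vector [1, 0, y, 0], vector [0, 1, 0, - y], vector [0, 0, 1, 0], vector [0, 0, 0, 1]]"

definition u_elt :: "'a::field \<Rightarrow> 'a \<Rightarrow> 'a^4^4" where
  "u_elt x y = x_alpha x ** x_beta y"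

definition torus4 :: "'a::field \<Rightarrow> 'a \<Rightarrow> 'a^4^4" where
  "torus4 a b = vector [vector [a, 0, 0, 0], vector [0, b, 0, 0],
                        vector [0, 0, inverse b, 0], vector [0, 0, 0, inverse a]]"

definition levi_star :: "'a::field^2^2 \<Rightarrow> 'a^2^2" where
  "levi_star h = J2 ** transpose (matrix_inv h) ** J2"

definition m_levi :: "'a::field^2^2 \<Rightarrow> 'a^4^4" where
  "m_levi h = vector [vector [h$1$1, h$1$2, 0, 0],
                      vector [h$2$1, h$2$2, 0, 0],
                      vector [0, 0, levi_star h $1$1, levi_star h $1$2],
                      vector [0, 0, levi_star h $2$1, levi_star h $2$2]]"


section \<open>Representations of \<open>SO\<^sub>4(F)\<close>\<close>

text \<open>A complex vector space is a type \<open>'v\<close> with a scalar multiplication \<open>sc\<close>; a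
  representation is a function on all matrices of which only the values on \<open>SO4\<close> matter.\<close>

definition smooth_rep ::
  "(complex \<Rightarrow> 'v::ab_group_add \<Rightarrow> 'v) \<Rightarrow> ('a::nonarch_local_field^4^4 \<Rightarrow> 'v \<Rightarrow> 'v) \<Rightarrow> bool" where
  "smooth_rep sc \<pi> \<longleftrightarrow>
     vector_space sc \<and>
     (\<forall>g\<in>SO4. Vector_Spaces.linear sc sc (\<pi> g)) \<and>
     \<pi> (mat 1) = id \<and>
     (\<forall>g\<in>SO4. \<forall>h\<in>SO4. \<pi> (g ** h) = \<pi> g \<circ> \<pi> h) \<and>
     (\<forall>v. \<exists>V. open V \<and> mat 1 \<in> V \<and> (\<forall>g\<in>SO4 \<inter> V. \<pi> g v = v))"

definition irreducible_rep ::
  "(complex \<Rightarrow> 'v::ab_group_add \<Rightarrow> 'v) \<Rightarrow> ('a::nonarch_local_field^4^4 \<Rightarrow> 'v \<Rightarrow> 'v) \<Rightarrow> bool" where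
  "irreducible_rep sc \<pi> \<longleftrightarrow>
     (\<exists>v::'v. v \<noteq> 0) \<and>
     (\<forall>S. module.subspace sc S \<longrightarrow> (\<forall>g\<in>SO4. \<forall>v\<in>S. \<pi> g v \<in> S) \<longrightarrow> S = {0} \<or> S = UNIV)"

definition unramified_rep :: "('a::nonarch_local_field^4^4 \<Rightarrow> 'v::ab_group_add \<Rightarrow> 'v) \<Rightarrow> bool" where
  "unramified_rep \<pi> \<longleftrightarrow> (\<exists>v. v \<noteq> 0 \<and> (\<forall>k\<in>SO4_int. \<pi> k v = v))"

definition whittaker_functional ::
  "(complex \<Rightarrow> 'v::ab_group_add \<Rightarrow> 'v) \<Rightarrow> ('a::nonarch_local_field \<Rightarrow> complex) \<Rightarrow>
   ('a^4^4 \<Rightarrow> 'v \<Rightarrow> 'v) \<Rightarrow> ('v \<Rightarrow> complex) \<Rightarrow> bool" where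
  "whittaker_functional sc \<psi> \<pi> l \<longleftrightarrow>
     Vector_Spaces.linear sc (*) l \<and> (\<exists>v. l v \<noteq> 0) \<and>
     (\<forall>x y v. l (\<pi> (u_elt x y) v) = \<psi> (x - 2 * y) * l v)"

definition generic_rep ::
  "(complex \<Rightarrow> 'v::ab_group_add \<Rightarrow> 'v) \<Rightarrow> ('a::nonarch_local_field \<Rightarrow> complex) \<Rightarrow>
   ('a^4^4 \<Rightarrow> 'v \<Rightarrow> 'v) \<Rightarrow> bool" where
  "generic_rep sc \<psi> \<pi> \<longleftrightarrow> (\<exists>l. whittaker_functional sc \<psi> \<pi> l)"

text \<open>For irreducible \<open>\<pi>\<close> the functional \<open>l\<close> is unique up to a scalar, so this is the
  Whittaker model.\<close>

definition whittaker_model ::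
  "(complex \<Rightarrow> 'v::ab_group_add \<Rightarrow> 'v) \<Rightarrow> ('a::nonarch_local_field \<Rightarrow> complex) \<Rightarrow>
   ('a^4^4 \<Rightarrow> 'v \<Rightarrow> 'v) \<Rightarrow> ('a^4^4 \<Rightarrow> complex) set" where
  "whittaker_model sc \<psi> \<pi> =
     {W. \<exists>l v. whittaker_functional sc \<psi> \<pi> l \<and> W = (\<lambda>g. l (\<pi> g v))}"

text \<open>
  The normalized principal series induced from the unramified characters
  \<open>t\<^sub>1 \<mapsto> a^v(t\<^sub>1)\<close>, \<open>t\<^sub>2 \<mapsto> b^v(t\<^sub>2)\<close> of the torus. The factor
  \<open>nrm t1\<close> is the square root of the modulus character: the two positive roots have values
  \<open>t\<^sub>1/t\<^sub>2\<close> and \<open>t\<^sub>1t\<^sub>2\<close>, with product \<open>t\<^sub>1\<^sup>2\<close>. Functions are extended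
  by zero to all matrices, which makes them determined by their values on \<open>SO4\<close>.
\<close>

definition principal_series ::
  "complex \<Rightarrow> complex \<Rightarrow> ('a::nonarch_local_field^4^4 \<Rightarrow> complex) set" where
  "principal_series a b =
     {\<Phi>. (\<forall>g. g \<notin> SO4 \<longrightarrow> \<Phi> g = 0) \<and>
          (\<forall>t1 t2 x y. \<forall>g\<in>SO4. t1 \<noteq> 0 \<longrightarrow> t2 \<noteq> 0 \<longrightarrow>
             \<Phi> (torus4 t1 t2 ** u_elt x y ** g) =
               a powi valuation t1 * b powi valuation t2 * of_real (nrm t1) * \<Phi> g) \<and>
          (\<exists>V. open V \<and> mat 1 \<in> V \<and> (\<forall>g\<in>SO4. \<forall>k\<in>SO4 \<inter> V. \<Phi> (g ** k) = \<Phi> g))}"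

text \<open>
  An unramified irreducible representation has Satake parameter
  \<open>diag(a,b,b\<^sup>-\<^sup>1,a\<^sup>-\<^sup>1)\<close> when it is a subquotient of the above
  principal series, i.e. the image of an equivariant linear map \<open>T\<close> defined on an
  invariant subspace \<open>N\<close>.
\<close>

definition satake_parameter ::
  "(complex \<Rightarrow> 'v::ab_group_add \<Rightarrow> 'v) \<Rightarrow> ('a::nonarch_local_field^4^4 \<Rightarrow> 'v \<Rightarrow> 'v) \<Rightarrow>
   complex^4^4 \<Rightarrow> bool" where
  "satake_parameter sc \<pi> A \<longleftrightarrow>
     (\<exists>a b N T. a \<noteq> 0 \<and> b \<noteq> 0 \<and> A = torus4 a b \<and>
        N \<subseteq> principal_series a b \<and> (\<lambda>g. 0) \<in> N \<and>
        (\<forall>c. \<forall>\<Phi>\<in>N. \<forall>\<Phi>'\<in>N. (\<lambda>g. c * \<Phi> g + \<Phi>' g) \<in> N \<and>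
             T (\<lambda>g. c * \<Phi> g + \<Phi>' g) = sc c (T \<Phi>) + T \<Phi>') \<and>
        (\<forall>h\<in>SO4. \<forall>\<Phi>\<in>N. (\<lambda>g. \<Phi> (g ** h)) \<in> N \<and> T (\<lambda>g. \<Phi> (g ** h)) = \<pi> h (T \<Phi>)) \<and>
        T ` N = UNIV)"


section \<open>\<open>L\<close>-functions\<close>

definition q_pow :: "'a::nonarch_local_field itself \<Rightarrow> complex \<Rightarrow> complex" where
  "q_pow T s = of_nat (residue_card T) powr s"

definition L_char :: "'a::nonarch_local_field \<Rightarrow> ('a \<Rightarrow> complex) \<Rightarrow> complex \<Rightarrow> complex" where
  "L_char unif \<xi> s = 1 / (1 - \<xi> unif * q_pow TYPE('a) (- s))"

definition L_wedge2_plus ::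
  "'a::nonarch_local_field \<Rightarrow> complex \<Rightarrow> complex \<Rightarrow> ('a \<Rightarrow> complex) \<Rightarrow> complex \<Rightarrow> complex" where
  "L_wedge2_plus unif a b \<xi> s =
     1 / ((1 - \<xi> unif * q_pow TYPE('a) (- s)) *
          (1 - a * inverse b * \<xi> unif * q_pow TYPE('a) (- s)) *
          (1 - inverse a * b * \<xi> unif * q_pow TYPE('a) (- s)))"


section \<open>The metaplectic group\<close>

definition SL2 :: "('a::field^2^2) set" where
  "SL2 = {g. det g = 1}"

definition SL2_int :: "('a::nonarch_local_field^2^2) set" where
  "SL2_int = {g \<in> SL2. \<forall>i j. g $ i $ j \<in> integers}"

definition t_SL2 :: "'a::field \<Rightarrow> 'a^2^2" where
  "t_SL2 a = vector [vector [a, 0], vector [0, inverse a]]"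

definition n_SL2 :: "'a::field \<Rightarrow> 'a^2^2" where
  "n_SL2 x = vector [vector [1, x], vector [0, 1]]"

definition w2 :: "'a::field^2^2" where
  "w2 = vector [vector [0, 1], vector [- 1, 0]]"

definition x_coord :: "'a::field^2^2 \<Rightarrow> 'a" where
  "x_coord g = (if g$2$1 \<noteq> 0 then g$2$1 else g$2$2)"

definition cocycle :: "'a::field^2^2 \<Rightarrow> 'a^2^2 \<Rightarrow> int" where
  "cocycle g h =
     hilbert_symbol (x_coord g) (x_coord h) *
     hilbert_symbol (- x_coord g * x_coord h) (x_coord (g ** h))"

definition Mp :: "(('a::field^2^2) \<times> int) set" where
  "Mp = SL2 \<times> {1, - 1}"

definition mp_mult :: "('a::field^2^2) \<times> int \<Rightarrow> ('a^2^2) \<times> int \<Rightarrow> ('a^2^2) \<times> int" where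
  "mp_mult g h = (fst g ** fst h, snd g * snd h * cocycle (fst g) (fst h))"

text \<open>
  \<open>\<sigma>\<close> makes \<open>k \<mapsto> (k, \<sigma> k)\<close> a group homomorphism from \<open>SL2_int\<close> to \<open>Mp\<close>; this is
  how \<open>SL2_int\<close> is regarded as a subgroup of \<open>Mp\<close>. The map \<open>k \<mapsto> (k, 1)\<close> is not
  multiplicative. In odd residue characteristic there is exactly one \<open>\<sigma>\<close>, namely
  \<open>\<sigma> k = (c,d)\<^sub>F\<close> if the lower row \<open>(c,d)\<close> of \<open>k\<close> has \<open>0 < nrm c < 1\<close>
  and \<open>\<sigma> k = 1\<close> otherwise; in residue characteristic two of a field of characteristic zero
  there is none.
\<close>

definition splitting :: "('a::nonarch_local_field^2^2 \<Rightarrow> int) \<Rightarrow> bool" where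
  "splitting \<sigma> \<longleftrightarrow>
     (\<forall>k\<in>SL2_int. \<sigma> k \<in> {1, - 1}) \<and>
     (\<forall>k\<in>SL2_int. \<forall>k'\<in>SL2_int. mp_mult (k, \<sigma> k) (k', \<sigma> k') = (k ** k', \<sigma> (k ** k')))"


section \<open>Fourier transform, Weil index and Weil representation\<close>

definition schwartz :: "('a::nonarch_local_field \<Rightarrow> complex) set" where
  "schwartz =
     {\<phi>. (\<forall>x. \<exists>V. open V \<and> x \<in> V \<and> (\<forall>y\<in>V. \<phi> y = \<phi> x)) \<and> compact (closure {x. \<phi> x \<noteq> 0})}"

definition additive_haar :: "'a::nonarch_local_field measure \<Rightarrow> bool" where
  "additive_haar M \<longleftrightarrow>
     sets M = sets borel \<and>
     (\<forall>x. \<forall>A\<in>sets borel. emeasure M ((\<lambda>y. x + y) ` A) = emeasure M A) \<and>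
     (\<forall>C. compact C \<longrightarrow> emeasure M C < \<infinity>) \<and>
     (\<forall>V. open V \<longrightarrow> V \<noteq> {} \<longrightarrow> emeasure M V > 0)"

definition fourier ::
  "'a::nonarch_local_field measure \<Rightarrow> ('a \<Rightarrow> complex) \<Rightarrow> ('a \<Rightarrow> complex) \<Rightarrow> 'a \<Rightarrow> complex" where
  "fourier M \<psi> \<phi> x = (\<integral>y. \<phi> y * \<psi> (2 * x * y) \<partial>M)"

definition self_dual_measure ::
  "('a::nonarch_local_field \<Rightarrow> complex) \<Rightarrow> 'a measure \<Rightarrow> bool" where
  "self_dual_measure \<psi> M \<longleftrightarrow>
     additive_haar M \<and> (\<forall>\<phi>\<in>schwartz. \<forall>x. fourier M \<psi> (fourier M \<psi> \<phi>) x = \<phi> (- x))"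

text \<open>
  Weil's constant attached to the character of second degree \<open>x \<mapsto> \<psi>(x\<^sup>2)\<close>, whose
  associated pairing is \<open>\<psi>(2xy)\<close>: the Fourier transform of \<open>\<psi>(x\<^sup>2)\<close>, as a
  distribution and with respect to the self-dual measure, is \<open>\<gamma>(\<psi>)\<psi>(-x\<^sup>2)\<close>.
\<close>

definition weil_index :: "('a::nonarch_local_field \<Rightarrow> complex) \<Rightarrow> complex" where
  "weil_index \<psi> =
     (THE c. \<exists>M. self_dual_measure \<psi> M \<and>
        (\<forall>\<phi>\<in>schwartz. (\<integral>x. fourier M \<psi> \<phi> x * \<psi> (x^2) \<partial>M) = c * (\<integral>x. \<phi> x * \<psi> (- (x^2)) \<partial>M)))"

definition mu_weil :: "('a::nonarch_local_field \<Rightarrow> complex) \<Rightarrow> 'a \<Rightarrow> complex" where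
  "mu_weil \<psi> a = weil_index \<psi> / weil_index (\<lambda>x. \<psi> (a * x))"

definition weil_representation ::
  "('a::nonarch_local_field \<Rightarrow> complex) \<Rightarrow>
   (('a^2^2) \<times> int \<Rightarrow> ('a \<Rightarrow> complex) \<Rightarrow> 'a \<Rightarrow> complex) \<Rightarrow> bool" where
  "weil_representation \<psi> \<omega> \<longleftrightarrow>
     (\<forall>g\<in>Mp. \<forall>\<phi>\<in>schwartz. \<omega> g \<phi> \<in> schwartz) \<and>
     (\<forall>g\<in>Mp. \<forall>c. \<forall>\<phi>\<in>schwartz. \<forall>\<phi>'\<in>schwartz.
        \<omega> g (\<lambda>x. c * \<phi> x + \<phi>' x) = (\<lambda>x. c * \<omega> g \<phi> x + \<omega> g \<phi>' x)) \<and>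
     (\<forall>g\<in>Mp. \<forall>h\<in>Mp. \<forall>\<phi>\<in>schwartz. \<omega> (mp_mult g h) \<phi> = \<omega> g (\<omega> h \<phi>)) \<and>
     (\<exists>M. self_dual_measure \<psi> M \<and>
        (\<forall>\<phi>\<in>schwartz. \<omega> (w2, 1) \<phi> = (\<lambda>x. weil_index \<psi> * fourier M \<psi> \<phi> x))) \<and>
     (\<forall>b. \<forall>\<phi>\<in>schwartz. \<omega> (n_SL2 b, 1) \<phi> = (\<lambda>x. \<psi> (b * x^2) * \<phi> x)) \<and>
     (\<forall>a. \<forall>\<phi>\<in>schwartz. a \<noteq> 0 \<longrightarrow>
        \<omega> (t_SL2 a, 1) \<phi> = (\<lambda>x. of_real (sqrt (nrm a)) * mu_weil \<psi> a * \<phi> (a * x))) \<and>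
     (\<forall>\<zeta>\<in>{1, - 1}. \<forall>\<phi>\<in>schwartz. \<omega> (mat 1, \<zeta>) \<phi> = (\<lambda>x. of_int \<zeta> * \<phi> x))"


section \<open>The local zeta integral\<close>

text \<open>
  \<open>induced_space s \<eta> \<psi>'\<close> is \<open>I(s,\<eta>,\<psi>')\<close>. The topology of \<open>Mp\<close> is not the product
  topology, but for small \<open>k\<close> the cocycle is trivial and the sets \<open>{(k,1). k \<in> V}\<close>, with
  \<open>V\<close> a neighbourhood of the identity, form a neighbourhood base at the identity of \<open>Mp\<close>.
\<close>

definition induced_space ::
  "complex \<Rightarrow> ('a::nonarch_local_field \<Rightarrow> complex) \<Rightarrow> ('a \<Rightarrow> complex) \<Rightarrow>
   (('a^2^2) \<times> int \<Rightarrow> complex) set" where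
  "induced_space s \<eta> \<psi>' =
     {f. (\<exists>V. open V \<and> mat 1 \<in> V \<and> (\<forall>g\<in>Mp. \<forall>k\<in>SL2 \<inter> V. f (mp_mult g (k, 1)) = f g)) \<and>
         (\<forall>x. \<forall>g\<in>Mp. f (mp_mult (n_SL2 x, 1) g) = f g) \<and>
         (\<forall>a. \<forall>\<zeta>\<in>{1, - 1}. \<forall>g\<in>Mp. a \<noteq> 0 \<longrightarrow>
            f (mp_mult (t_SL2 a, \<zeta>) g) =
              of_int \<zeta> * mu_weil \<psi>' a * \<eta> a * of_real (nrm a) powr (s + 1/2) * f g)}"

definition mult_haar_normalized :: "'a::nonarch_local_field measure \<Rightarrow> bool" where
  "mult_haar_normalized M \<longleftrightarrow>
     space M = - {0} \<and> sets M = sets (restrict_space borel (- {0})) \<and>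
     (\<forall>x. x \<noteq> 0 \<longrightarrow> (\<forall>A\<in>sets M. emeasure M ((\<lambda>y. x * y) ` A) = emeasure M A)) \<and>
     emeasure M {x. nrm x = 1} = 1"

definition SL2_int_haar_normalized :: "('a::nonarch_local_field^2^2) measure \<Rightarrow> bool" where
  "SL2_int_haar_normalized M \<longleftrightarrow>
     space M = SL2_int \<and> sets M = sets (restrict_space borel SL2_int) \<and>
     (\<forall>k\<in>SL2_int. \<forall>A\<in>sets M. emeasure M ((\<lambda>h. k ** h) ` A) = emeasure M A) \<and>
     emeasure M SL2_int = 1"

text \<open>
  The integrand of \<open>\<Psi>(W,\<phi>,f)\<close> at \<open>h = t_SL2 a ** k\<close>, with the density
  \<open>|a|\<^sup>-\<^sup>2\<close> of the measure on \<open>N\<^sub>2\SL\<^sub>2(F)\<close>. The product of the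
  two genuine factors does not depend on the lift of \<open>h\<close> to \<open>Mp\<close>; the lift \<open>(h,1)\<close>
  is used.
\<close>

definition zeta_integrand ::
  "(('a::nonarch_local_field^2^2) \<times> int \<Rightarrow> ('a \<Rightarrow> complex) \<Rightarrow> 'a \<Rightarrow> complex) \<Rightarrow>
   ('a^4^4 \<Rightarrow> complex) \<Rightarrow> ('a \<Rightarrow> complex) \<Rightarrow> (('a^2^2) \<times> int \<Rightarrow> complex) \<Rightarrow>
   'a \<times> ('a^2^2) \<Rightarrow> complex" where
  "zeta_integrand \<omega> W \<phi> f = (\<lambda>(a, k). let h = t_SL2 a ** k in
     W (m_levi h) * \<omega> (h, 1) \<phi> 1 * f (h, 1) * of_real (nrm a powi (- 2)))"

definition zeta_converges ::
  "'a::nonarch_local_field measure \<Rightarrow> ('a^2^2) measure \<Rightarrow>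
   (('a^2^2) \<times> int \<Rightarrow> ('a \<Rightarrow> complex) \<Rightarrow> 'a \<Rightarrow> complex) \<Rightarrow>
   ('a^4^4 \<Rightarrow> complex) \<Rightarrow> ('a \<Rightarrow> complex) \<Rightarrow> (('a^2^2) \<times> int \<Rightarrow> complex) \<Rightarrow> bool" where
  "zeta_converges da dk \<omega> W \<phi> f \<longleftrightarrow> integrable (da \<Otimes>\<^sub>M dk) (zeta_integrand \<omega> W \<phi> f)"

definition zeta_integral ::
  "'a::nonarch_local_field measure \<Rightarrow> ('a^2^2) measure \<Rightarrow>
   (('a^2^2) \<times> int \<Rightarrow> ('a \<Rightarrow> complex) \<Rightarrow> 'a \<Rightarrow> complex) \<Rightarrow>
   ('a^4^4 \<Rightarrow> complex) \<Rightarrow> ('a \<Rightarrow> complex) \<Rightarrow> (('a^2^2) \<times> int \<Rightarrow> complex) \<Rightarrow> complex" where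
  "zeta_integral da dk \<omega> W \<phi> f = (\<integral>p. zeta_integrand \<omega> W \<phi> f p \<partial>(da \<Otimes>\<^sub>M dk))"

end

theory Submission
  imports Defs
begin

text \<open>
  By the Iwasawa decomposition the integrand at \<open>h = t_SL2 a ** k\<close> depends on \<open>|a|\<close> only. Indeed
  \<open>\<phi>\<^sup>0\<close> is fixed by the split \<open>SL2_int\<close>, and the two genuine factors combine to
  \<open>\<mu>(a)\<^sup>2 \<eta>(a) |a|\<^bsup>s+1\<^esup>\<close> with \<open>\<mu>(a)\<^sup>2 = \<chi>(a)\<close>: the cocycle gives \<open>\<mu>(a) \<mu>(a\<^bsup>-1\<^esup>) = \<chi>(a)\<close>, and
  conjugation by \<open>w2\<close> gives \<open>\<mu>(\<varpi>) = \<mu>(\<varpi>\<^bsup>-1\<^esup>)\<close>. The residue characteristic is odd, because otherwise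
  the splitting would make the Hilbert symbol trivial on pairs of units, which it is not.

  With \<open>W\<^sup>0(m(t(\<varpi>\<^sup>n))) = q\<^bsup>-n\<^esup> C\<^sub>n\<close> and \<open>X = \<chi>\<eta>(\<varpi>) q\<^bsup>-s\<^esup>\<close> the integral is \<open>\<Sum>C\<^sub>n X\<^sup>n\<close>. The \<open>C\<^sub>n\<close> satisfy
  \<open>C\<^bsub>n+2\<^esub> = (\<alpha> + \<alpha>\<^bsup>-1\<^esup>) C\<^bsub>n+1\<^esub> - C\<^sub>n\<close>, \<open>\<alpha> = a/b\<close>, with \<open>C\<^sub>0 = 1\<close> and \<open>C\<^sub>1 = \<alpha> + 1 + \<alpha>\<^bsup>-1\<^esup>\<close>: this is the
  eigenvalue equation of a Hecke operator supported on the Levi \<open>SL\<^sub>2\<close>, whose eigenvalue is computed on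
  the spherical vector of the principal series. Hence the sum is
  \<open>(1 + X) / ((1 - \<alpha>X) (1 - \<alpha>\<^bsup>-1\<^esup>X))\<close>.
\<close>

section \<open>Non-archimedean local fields\<close>

text \<open>SO4 contains two commuting copies of SL2, the images of \<open>m_levi\<close> and
  \<open>m_beta\<close>. The integral sees only the first, so only \<open>a / b\<close> survives. To
  read the eigenvalue off an Iwasawa decomposition, the \<open>m_beta\<close> part of the compact
  factor must move to the right past the Hecke elements. This confines them to SL2 and explains the
  squared GL2 operator divided by the uniformizer.

  The Satake parameter presents \<pi> only as a quotient of a subspace of a principal series, so its
  fixed vector must first be lifted to a fixed function.

  The Weil representation is known through relations and no Weil index is evaluated: what is needed
  about \<mu> comes from relations of the cover acting on \<open>\<phi>0\<close>. Likewise
  \<open>2 \<noteq> 0\<close> comes from the existence of a self-dual measure, and both the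
  triviality of \<sigma> on integral unipotents and that of \<eta> on units come from a section with
  value 1 on the split group.

  The numerator \<open>1 + X\<close> goes back to one character sum that vanishes at
  \<open>n = 0\<close> and nowhere else. It equals \<open>(1 - X^2) / (1 - X)\<close>, which gives
  both the factor at \<open>2 * s\<close> and the middle factor of the L-function.\<close>

lemma nrm_zero [simp]: "nrm (0::'a::nonarch_local_field) = 0"
  by (simp add: nrm_def)

lemma nrm_nonneg [simp]: "0 \<le> nrm x"
  by (simp add: nrm_def)

lemma nrm_eq_0 [simp]: "nrm x = 0 \<longleftrightarrow> x = 0"
  by (simp add: nrm_def)

lemma nrm_pos [simp]: "0 < nrm x \<longleftrightarrow> x \<noteq> 0"
  by (simp add: nrm_def)

lemma nrm_le_0 [simp]: "nrm x \<le> 0 \<longleftrightarrow> x = 0"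
  by (simp add: nrm_def)

lemma nrm_not_neg [simp]: "\<not> nrm x < 0"
  by (simp add: nrm_def)

lemma nrm_mult: "nrm (x * y) = nrm x * nrm y"
  by (simp add: nrm_def dist_mult_zero)

lemma nrm_one [simp]: "nrm (1::'a::nonarch_local_field) = 1"
  using nrm_mult[of "1::'a" 1] by simp

lemma nrm_minus [simp]: "nrm (- x) = nrm x"
proof -
  have "nrm (-1::'a) * nrm (-1::'a) = 1"
    by (simp flip: nrm_mult)
  then have "nrm (-1::'a) = 1"
    by (metis nrm_nonneg abs_of_nonneg abs_mult_self_eq abs_square_eq_1 power2_eq_square)
  then show ?thesis
    using nrm_mult[of "-1" x] by simp
qed

lemma dist_eq_nrm: "dist x y = nrm (x - y)"
  using dist_add_right_cancel[of x "- y" y] by (simp add: nrm_def)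

lemma nrm_diff_commute: "nrm (x - y) = nrm (y - x)"
  using nrm_minus[of "x - y"] by simp

lemma nrm_add: "nrm (x + y) \<le> max (nrm x) (nrm y)"
  by (simp add: nrm_def dist_add_ultrametric)

lemma nrm_diff: "nrm (x - y) \<le> max (nrm x) (nrm y)"
  using nrm_add[of x "- y"] by simp

lemma nrm_add_le: "nrm x \<le> r \<Longrightarrow> nrm y \<le> r \<Longrightarrow> nrm (x + y) \<le> r"
  using nrm_add[of x y] by linarith

lemma nrm_diff_le: "nrm x \<le> r \<Longrightarrow> nrm y \<le> r \<Longrightarrow> nrm (x - y) \<le> r"
  using nrm_diff[of x y] by linarith

lemma nrm_add_less: "nrm x < r \<Longrightarrow> nrm y < r \<Longrightarrow> nrm (x + y) < r"
  using nrm_add[of x y] by linarith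

lemma nrm_diff_less: "nrm x < r \<Longrightarrow> nrm y < r \<Longrightarrow> nrm (x - y) < r"
  using nrm_diff[of x y] by linarith

lemma nrm_add_eq: "nrm x < nrm y \<Longrightarrow> nrm (x + y) = nrm y"
  using nrm_add[of x y] nrm_diff[of "x + y" x] by (simp add: max_def split: if_splits)

lemma nrm_inverse: "nrm (inverse x) = inverse (nrm x)"
proof (cases "x = 0")
  case False
  then have "nrm x * nrm (inverse x) = 1"
    by (simp flip: nrm_mult)
  then show ?thesis
    by (metis inverse_unique)
qed simp

lemma nrm_divide: "nrm (x / y) = nrm x / nrm y"
  by (simp add: divide_inverse nrm_mult nrm_inverse)

lemma nrm_power: "nrm (x ^ n) = nrm x ^ n"
  by (induction n) (simp_all add: nrm_mult)

lemma nrm_power_int: "nrm (x powi n) = nrm x powi n"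
  by (simp add: power_int_def nrm_power nrm_inverse)

lemma nrm_two_le: "nrm (2::'a::nonarch_local_field) \<le> 1"
  using nrm_add_le[of "1::'a" 1 1] by simp

lemma mem_integers: "x \<in> integers \<longleftrightarrow> nrm x \<le> 1"
  by (simp add: integers_def)

lemma integers_0 [simp]: "0 \<in> integers" and integers_1 [simp]: "1 \<in> integers"
  by (simp_all add: mem_integers)

lemma integers_add: "x \<in> integers \<Longrightarrow> y \<in> integers \<Longrightarrow> x + y \<in> integers"
  by (simp add: mem_integers nrm_add_le)

lemma integers_diff: "x \<in> integers \<Longrightarrow> y \<in> integers \<Longrightarrow> x - y \<in> integers"
  by (simp add: mem_integers nrm_diff_le)

lemma integers_minus [simp]: "- x \<in> integers \<longleftrightarrow> x \<in> integers"
  by (simp add: mem_integers)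

lemma integers_mult: "x \<in> integers \<Longrightarrow> y \<in> integers \<Longrightarrow> x * y \<in> integers"
  by (simp add: mem_integers nrm_mult mult_le_one)

lemma integers_inverse: "nrm u = 1 \<Longrightarrow> inverse u \<in> integers"
  by (simp add: mem_integers nrm_inverse)

lemma continuous_on_add_const: "continuous_on A (\<lambda>y::'a::nonarch_local_field. x + y)"
  unfolding continuous_on_iff by (auto simp: dist_eq_nrm)

lemma continuous_on_mult_const: "continuous_on A (\<lambda>y::'a::nonarch_local_field. x * y)"
proof (cases "x = 0")
  case False
  have *: "dist (x * y) (x * z) = nrm x * dist y z" for y z
    by (simp add: dist_eq_nrm nrm_mult flip: right_diff_distrib)
  have "\<exists>d>0. \<forall>y'\<in>A. dist y' y < d \<longrightarrow> dist (x * y') (x * y) < e" if "e > 0" for y e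
    using False that by (intro exI[of _ "e / nrm x"]) (simp add: * pos_less_divide_eq mult.commute[of "dist _ _"])
  then show ?thesis
    unfolding continuous_on_iff by blast
qed auto

lemma clopen_ball_nrm:
  fixes c :: "'a::nonarch_local_field"
  assumes "r > 0"
  shows "open {x. nrm (x - c) \<le> r}" and "closed {x. nrm (x - c) \<le> r}"
proof -
  have "\<exists>e>0. \<forall>y. dist y x < e \<longrightarrow> nrm (y - c) \<le> r" if "nrm (x - c) \<le> r" for x
  proof (intro exI[of _ r] conjI allI impI)
    fix y assume "dist y x < r"
    then show "nrm (y - c) \<le> r"
      using nrm_add_le[of "y - x" r "x - c"] that by (simp add: dist_eq_nrm)
  qed (rule assms)
  then show "open {x. nrm (x - c) \<le> r}"
    unfolding open_dist by auto
  have "{x. nrm (x - c) \<le> r} = cball c r"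
    by (auto simp: dist_eq_nrm nrm_diff_commute)
  then show "closed {x. nrm (x - c) \<le> r}"
    by simp
qed

lemma compact_integers: "compact (integers :: 'a::nonarch_local_field set)"
  using compact_unit_ball by (simp add: integers_def nrm_def)

lemma compact_nrm_ball:
  fixes c :: "'a::nonarch_local_field"
  shows "compact {x::'a. nrm x \<le> nrm c}"
proof (cases "c = 0")
  case False
  have "{x::'a. nrm x \<le> nrm c} = (\<lambda>y. c * y) ` integers"
  proof (intro equalityI subsetI)
    fix x :: 'a assume "x \<in> {x. nrm x \<le> nrm c}"
    then show "x \<in> (\<lambda>y. c * y) ` integers"
      using False by (intro image_eqI[of _ _ "x / c"]) (auto simp: mem_integers nrm_divide)
  qed (auto simp: mem_integers nrm_mult mult_left_le)
  then show ?thesis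
    by (simp add: compact_continuous_image continuous_on_mult_const compact_integers)
next
  case True
  then have "{x::'a. nrm x \<le> nrm c} = {0}"
    by auto
  then show ?thesis by simp
qed

section \<open>Uniformizer, residue field and valuation\<close>

locale uniformized =
  fixes unif :: "'a::nonarch_local_field"
  assumes unif: "uniformizer unif"
begin

definition q :: nat where "q = residue_card TYPE('a)"

lemma unif_nz [simp]: "unif \<noteq> 0"
  using unif by (simp add: uniformizer_def)

lemma nrm_unif_and_q: "nrm unif = 1 / real q \<and> q \<ge> 2"
proof -
  let ?C = "(\<lambda>x::'a. {y. nrm (x - y) < 1}) ` integers"
  have q: "q = card ?C"
    by (simp add: q_def residue_card_def)
  have "?C = (\<lambda>x. {y. dist x y < 1}) ` {x::'a. dist x 0 \<le> 1}"
    by (simp add: dist_eq_nrm integers_def)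
  with dist_normalized[where 'a = 'a]
  obtain w :: 'a where w: "nrm w = 1 / real q" and le: "\<And>x::'a. nrm x < 1 \<Longrightarrow> nrm x \<le> nrm w"
    unfolding q nrm_def by auto
  have u: "nrm unif < 1" "\<And>x::'a. nrm x < 1 \<Longrightarrow> nrm x \<le> nrm unif"
    using unif by (auto simp: uniformizer_def)
  have "0 < nrm unif"
    by simp
  also have "nrm unif \<le> nrm w"
    using le u by blast
  \<comment> \<open>\<open>card\<close> of an infinite set is 0 and \<open>1 / 0 = 0\<close>, so
    \<open>nrm w > 0\<close> excludes both; finiteness of the residue field follows.\<close>
  finally have "q \<noteq> 0"
    using w by auto
  then have fin: "finite ?C"
    using q card.infinite by metis
  have "{y. nrm (0 - y) < 1} \<in> ?C" "{y. nrm (1 - y) < 1} \<in> ?C"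
    using integers_0 integers_1 by blast+
  moreover have "{y::'a. nrm (0 - y) < 1} \<noteq> {y. nrm (1 - y) < 1}"
  proof -
    have "(1::'a) \<in> {y. nrm (1 - y) < 1}" "(1::'a) \<notin> {y. nrm (0 - y) < 1}"
      by simp_all
    then show ?thesis by blast
  qed
  ultimately have "card {{y::'a. nrm (0 - y) < 1}, {y. nrm (1 - y) < 1}} \<le> card ?C"
    using fin by (intro card_mono) auto
  then have q2: "q \<ge> 2"
    using q \<open>{y::'a. nrm (0 - y) < 1} \<noteq> {y. nrm (1 - y) < 1}\<close> by simp
  then have "nrm w < 1"
    using w by simp
  then have "nrm w \<le> nrm unif"
    using u by blast
  then show ?thesis
    using \<open>nrm unif \<le> nrm w\<close> w q2 by simp
qed

lemma q_ge_2: "q \<ge> 2" and nrm_unif: "nrm unif = 1 / real q"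
  using nrm_unif_and_q by auto

lemma q_pos [simp]: "real q > 0" and q_gt_1: "real q > 1"
  using q_ge_2 by linarith+

lemma nrm_unif_less_1: "nrm unif < 1"
  using unif by (simp add: uniformizer_def)

lemma nrm_less_1: "nrm x < 1 \<longleftrightarrow> nrm x \<le> nrm unif" for x :: 'a
  using unif nrm_unif_less_1 le_less_trans unfolding uniformizer_def by blast

lemma nrm_gt_1: "nrm x > 1 \<longleftrightarrow> nrm x \<ge> real q" for x :: 'a
proof
  assume "nrm x > 1"
  then have "nrm (inverse x) < 1"
    by (simp add: nrm_inverse inverse_less_1_iff)
  then have "nrm (inverse x) \<le> nrm unif"
    by (simp only: nrm_less_1)
  then have "inverse (nrm x) \<le> 1 / real q"
    unfolding nrm_unif nrm_inverse .
  then show "nrm x \<ge> real q"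
    using \<open>nrm x > 1\<close> inverse_le_imp_le[of "nrm x" "real q"] q_ge_2
    by (cases "x = 0") (auto simp: inverse_eq_divide)
qed (use q_gt_1 in linarith)

lemma unif_mult_integer: "nrm (unif * x) < 1 \<longleftrightarrow> x \<in> integers" for x :: 'a
proof -
  have "nrm (unif * x) < 1 \<longleftrightarrow> nrm unif * nrm x \<le> nrm unif * 1"
    unfolding nrm_less_1 by (simp add: nrm_mult)
  then show ?thesis
    using q_ge_2 by (simp add: mem_integers nrm_unif divide_le_cancel)
qed

lemma unif_dvd: "x / unif \<in> integers \<longleftrightarrow> nrm x < 1"
  using unif_mult_integer[of "x / unif"] by simp

lemma nrm_unif_powi: "nrm (unif powi n) = real q powi (- n)"
  by (simp add: nrm_power_int nrm_unif power_int_minus power_int_divide_distrib field_simps)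

lemma nrm_cases:
  assumes "x \<noteq> (0::'a)"
  obtains n where "nrm x = real q powi (- n)"
proof -
  \<comment> \<open>This rounding places the absolute value of \<open>y\<close> below in the
    interval from 1 (included) to \<open>q\<close> (excluded), where \<open>nrm_gt_1\<close> leaves
    only the value 1.\<close>
  define n where "n = \<lceil>- log (real q) (nrm x)\<rceil>"
  have q1: "1 < real q" by (rule q_gt_1)
  have pos: "nrm x > 0" using assms by simp
  define y where "y = x * unif powi (- n)"
  have ny: "nrm y = real q powr (log (real q) (nrm x) + n)"
    using pos q1 by (simp add: y_def nrm_mult nrm_unif_powi powr_add powr_real_of_int' del: powr_realpow)
  have "log (real q) (nrm x) + n \<ge> 0" "log (real q) (nrm x) + n < 1"
    unfolding n_def by linarith+
  then have "1 \<le> nrm y" "nrm y < real q powr 1"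
    unfolding ny using q1 by (intro ge_one_powr_ge_zero powr_less_mono; simp)+
  then have "nrm y = 1"
    using nrm_gt_1[of y] by simp
  then have "nrm x * real q powi n = 1"
    by (simp add: y_def nrm_mult nrm_unif_powi)
  then have "nrm x = real q powi (- n)"
    using q_ge_2 by (simp add: power_int_minus field_simps)
  then show ?thesis by (rule that)
qed

lemma unit_decomp:
  assumes "x \<noteq> (0::'a)"
  obtains n u where "x = unif powi n * u" and "nrm u = 1"
proof -
  obtain n where n: "nrm x = real q powi (- n)"
    using assms by (rule nrm_cases)
  show ?thesis
  proof (rule that)
    show "x = unif powi n * (x * unif powi (- n))"
      by (simp add: power_int_minus)
    show "nrm (x * unif powi (- n)) = 1"
      unfolding nrm_mult n nrm_unif_powi using q_gt_1 by (simp flip: power_int_add)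
  qed
qed

lemma powi_q_inject: "real q powi m = real q powi n \<longleftrightarrow> m = n"
  using q_gt_1 by (metis less_irrefl linorder_neq_iff power_int_strict_increasing)

lemma valuation_eq: "nrm x = real q powi (- n) \<Longrightarrow> valuation x = n" for x :: 'a
  unfolding valuation_def q_def[symmetric] by (rule the_equality) (auto simp: powi_q_inject)

lemma valuation_unif_powi: "valuation (unif powi n) = n"
  by (simp add: nrm_unif_powi valuation_eq)

lemma nrm_valuation: "x \<noteq> 0 \<Longrightarrow> nrm x = real q powi (- valuation x)" for x :: 'a
  by (metis nrm_cases valuation_eq)

lemma valuation_mult: "x \<noteq> 0 \<Longrightarrow> y \<noteq> 0 \<Longrightarrow> valuation (x * y) = valuation x + valuation y"
  for x y :: 'a
  using q_gt_1 by (intro valuation_eq) (simp add: nrm_mult nrm_valuation flip: power_int_add)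

lemma valuation_unit: "nrm u = 1 \<Longrightarrow> valuation u = 0" for u :: 'a
  by (rule valuation_eq) simp

lemma nrm_square_ne: "x \<noteq> 0 \<Longrightarrow> nrm (x ^ 2) \<noteq> nrm (unif * y ^ 2)" for x y :: 'a
proof
  assume x: "x \<noteq> 0" and eq: "nrm (x ^ 2) = nrm (unif * y ^ 2)"
  then have y: "y \<noteq> 0"
    by (auto simp: nrm_mult)
  have "valuation (x ^ 2) = valuation (unif * y ^ 2)"
    using eq unfolding valuation_def by simp
  moreover have "valuation unif = 1"
    using valuation_unif_powi[of 1] by simp
  ultimately have "2 * valuation x = 1 + 2 * valuation y"
    using x y by (simp add: valuation_mult power2_eq_square)
  then show False by presburger
qed

text \<open>The choice depends only on the residue class as a set, so congruent elements receive the
  same representative; \<open>rep_cong\<close> rests on this.\<close>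

definition rep :: "'a \<Rightarrow> 'a" where
  "rep x = (SOME z. z \<in> {y. nrm (x - y) < 1} \<inter> integers)"

definition reps :: "'a set" where
  "reps = rep ` integers"

lemma rep:
  assumes "x \<in> integers"
  shows "nrm (x - rep x) < 1" and "rep x \<in> integers"
proof -
  have "x \<in> {y. nrm (x - y) < 1} \<inter> integers"
    using assms by simp
  then have "rep x \<in> {y. nrm (x - y) < 1} \<inter> integers"
    unfolding rep_def by (rule someI)
  then show "nrm (x - rep x) < 1" "rep x \<in> integers"
    by auto
qed

lemma rep_in_reps: "x \<in> integers \<Longrightarrow> rep x \<in> reps"
  by (simp add: reps_def)

lemma reps_integers: "r \<in> reps \<Longrightarrow> r \<in> integers"
  unfolding reps_def using rep by blast

lemma class_eq:
  fixes x y :: 'a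
  assumes "nrm (x - y) < 1"
  shows "{z. nrm (x - z) < 1} = {z. nrm (y - z) < 1}"
proof -
  have "nrm (y - z) < 1" if "nrm (x - y) < 1" "nrm (x - z) < 1" for x y z :: 'a
    using nrm_diff_less[OF that(2,1)] by (simp add: algebra_simps)
  from this[of x y] this[of y x] show ?thesis
    using assms nrm_diff_commute[of x y] by auto
qed

lemma rep_cong: "nrm (x - y) < 1 \<Longrightarrow> rep x = rep y" for x y :: 'a
  unfolding rep_def by (simp add: class_eq)

lemma rep_reps: "r \<in> reps \<Longrightarrow> rep r = r"
  unfolding reps_def using rep rep_cong by (metis image_iff)

lemma reps_eq: "r \<in> reps \<Longrightarrow> r' \<in> reps \<Longrightarrow> nrm (r - r') < 1 \<Longrightarrow> r = r'"
  by (metis rep_cong rep_reps)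

lemma card_reps: "card reps = q" and finite_reps: "finite reps"
proof -
  let ?C = "\<lambda>x::'a. {y. nrm (x - y) < 1}"
  have "?C ` integers = ?C ` reps"
  proof (intro equalityI image_subsetI)
    fix x :: 'a assume "x \<in> integers"
    then show "?C x \<in> ?C ` reps"
      using class_eq[OF rep(1)] rep_in_reps by blast
  qed (use reps_integers in blast)
  moreover have "inj_on ?C reps"
  proof (rule inj_onI)
    fix x y assume *: "x \<in> reps" "y \<in> reps" "?C x = ?C y"
    have "y \<in> ?C x"
      unfolding *(3) by simp
    then show "x = y"
      using reps_eq * by blast
  qed
  ultimately have "card (?C ` integers) = card reps"
    by (metis card_image)
  then show c: "card reps = q"
    by (simp add: q_def residue_card_def)
  show "finite reps"
    using c q_ge_2 card.infinite by force
qed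

text \<open>Digit expansion: \<open>x = rep x + unif * y\<close>, with the net of the previous level
  applied to \<open>y\<close>. It is the compactness input for \<open>finite_orbit\<close>.\<close>

lemma finite_net:
  "\<exists>N::'a set. finite N \<and> (\<forall>x\<in>integers. \<exists>y\<in>N. nrm (x - y) \<le> nrm unif ^ m)"
proof (induction m)
  case 0
  show ?case
    by (intro exI[of _ "{0}"]) (auto simp: mem_integers)
next
  case (Suc m)
  then obtain N :: "'a set" where N: "finite N"
    "\<And>x. x \<in> integers \<Longrightarrow> \<exists>y\<in>N. nrm (x - y) \<le> nrm unif ^ m" by blast
  let ?N = "(\<lambda>(r, y). r + unif * y) ` (reps \<times> N)"
  have "\<exists>y\<in>?N. nrm (x - y) \<le> nrm unif ^ Suc m" if "x \<in> integers" for x :: 'a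
  proof -
    have r: "rep x \<in> reps" "(x - rep x) / unif \<in> integers"
      using rep rep_in_reps that unif_dvd by blast+
    then obtain y where y: "y \<in> N" "nrm ((x - rep x) / unif - y) \<le> nrm unif ^ m"
      using N(2) by blast
    have "x - (rep x + unif * y) = unif * ((x - rep x) / unif - y)"
      by (simp add: field_simps)
    then have "nrm (x - (rep x + unif * y)) = nrm unif * nrm ((x - rep x) / unif - y)"
      by (simp add: nrm_mult)
    also have "\<dots> \<le> nrm unif ^ Suc m"
      using y by (simp add: mult_left_mono)
    finally show ?thesis
      using r y by (intro bexI[of _ "rep x + unif * y"]) auto
  qed
  moreover have "finite ?N"
    using N(1) finite_reps by simp
  ultimately show ?case
    by blast
qed

end

section \<open>The Hilbert symbol\<close>

lemma hilbert_symbol_values: "hilbert_symbol a b = 1 \<or> hilbert_symbol a b = -1"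
  by (simp add: hilbert_symbol_def)

lemma hilbert_symbol_commute: "hilbert_symbol a b = hilbert_symbol b a"
proof -
  have *: "hilbert_symbol b a = 1" if "hilbert_symbol a b = 1" for a b :: 'a
  proof -
    obtain x y z where "(x, y, z) \<noteq> (0, 0, 0)" "a * x^2 + b * y^2 = z^2"
      using \<open>hilbert_symbol a b = 1\<close> by (auto simp: hilbert_symbol_def split: if_splits)
    then have "(y, x, z) \<noteq> (0, 0, 0) \<and> b * y^2 + a * x^2 = z^2"
      by (auto simp: add.commute)
    then show ?thesis
      unfolding hilbert_symbol_def by metis
  qed
  show ?thesis
    using * hilbert_symbol_values by metis
qed

lemma ternary_zeroI:
  "(x, y, z) \<noteq> (0, 0, 0) \<Longrightarrow> a * x^2 + b * y^2 = z^2 \<Longrightarrow>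
    \<exists>x y z. (x, y, z) \<noteq> (0, 0, 0) \<and> a * x^2 + b * y^2 = z^2"
  for a :: "'a::field"
  by blast

lemma hilbert_symbol_iso:
  assumes "\<And>x y z. (x, y, z) \<noteq> (0, 0, 0) \<Longrightarrow> a * x^2 + b * y^2 = z^2 \<Longrightarrow>
      \<exists>x' y' z'. (x', y', z') \<noteq> (0, 0, 0) \<and> a' * x'^2 + b' * y'^2 = z'^2"
    and "\<And>x y z. (x, y, z) \<noteq> (0, 0, 0) \<Longrightarrow> a' * x^2 + b' * y^2 = z^2 \<Longrightarrow>
      \<exists>x' y' z'. (x', y', z') \<noteq> (0, 0, 0) \<and> a * x'^2 + b * y'^2 = z'^2"
  shows "hilbert_symbol a b = hilbert_symbol a' b'"
proof -
  have "(\<exists>x y z. (x, y, z) \<noteq> (0, 0, 0) \<and> a * x^2 + b * y^2 = z^2) \<longleftrightarrow>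
      (\<exists>x y z. (x, y, z) \<noteq> (0, 0, 0) \<and> a' * x^2 + b' * y^2 = z^2)"
    by (intro iffI; elim exE conjE; erule (1) assms)
  then show ?thesis
    by (simp only: hilbert_symbol_def)
qed

lemma hilbert_symbol_mult_square:
  assumes "c \<noteq> 0"
  shows "hilbert_symbol (a * c^2) b = hilbert_symbol a b"
proof (rule hilbert_symbol_iso)
  fix x y z assume *: "(x, y, z) \<noteq> (0, 0, 0)" "a * c^2 * x^2 + b * y^2 = z^2"
  then show "\<exists>x' y' z'. (x', y', z') \<noteq> (0, 0, 0) \<and> a * x'^2 + b * y'^2 = z'^2"
    by (intro ternary_zeroI[of "c * x" y z]) (use assms * in \<open>auto simp: power_mult_distrib mult.assoc\<close>)
next
  fix x y z assume *: "(x, y, z) \<noteq> (0, 0, 0)" "a * x^2 + b * y^2 = z^2"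
  then show "\<exists>x' y' z'. (x', y', z') \<noteq> (0, 0, 0) \<and> a * c^2 * x'^2 + b * y'^2 = z'^2"
    by (intro ternary_zeroI[of "x / c" y z]) (use assms * in \<open>auto simp: power_divide mult.assoc\<close>)
qed

lemma hilbert_symbol_inverse [simp]: "hilbert_symbol (inverse a) b = hilbert_symbol a b"
  "hilbert_symbol b (inverse a) = hilbert_symbol b a"
proof -
  show "hilbert_symbol (inverse a) b = hilbert_symbol a b" for b
  proof (cases "a = 0")
    case False
    then show ?thesis
      using hilbert_symbol_mult_square[of "inverse a" a b]
      by (simp add: power2_eq_square flip: mult.assoc)
  qed simp
  then show "hilbert_symbol b (inverse a) = hilbert_symbol b a"
    by (metis hilbert_symbol_commute)
qed

lemma hilbert_symbol_square [simp]:
  assumes "c \<noteq> 0"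
  shows "hilbert_symbol (c^2) b = 1" "hilbert_symbol b (c^2) = 1"
proof -
  show "hilbert_symbol (c^2) b = 1" for b
    unfolding hilbert_symbol_def using assms
    by (intro if_P ternary_zeroI[of 1 0 c]) auto
  then show "hilbert_symbol b (c^2) = 1"
    by (metis hilbert_symbol_commute)
qed

lemma hilbert_symbol_one [simp]: "hilbert_symbol 1 b = 1" "hilbert_symbol b 1 = 1"
  using hilbert_symbol_square[of 1 b] by simp_all

lemma hilbert_symbol_self: "a \<noteq> 0 \<Longrightarrow> hilbert_symbol a a = hilbert_symbol a (-1)"
proof (rule hilbert_symbol_iso)
  fix x y z assume *: "a \<noteq> 0" "(x, y, z) \<noteq> (0, 0, 0)" "a * x^2 + a * y^2 = z^2"
  then have "a * (z / a)^2 + (-1) * x^2 = y^2"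
    by (simp add: field_simps power2_eq_square)
  then show "\<exists>x' y' z'. (x', y', z') \<noteq> (0, 0, 0) \<and> a * x'^2 + (-1) * y'^2 = z'^2"
    by (intro ternary_zeroI[of "z / a" x y]) (use * in auto)
next
  fix x y z assume *: "a \<noteq> 0" "(x, y, z) \<noteq> (0, 0, 0)" "a * x^2 + (-1) * y^2 = z^2"
  then have "a * y^2 + a * z^2 = (a * x)^2"
    by (simp add: algebra_simps power2_eq_square)
  then show "\<exists>x' y' z'. (x', y', z') \<noteq> (0, 0, 0) \<and> a * x'^2 + a * y'^2 = z'^2"
    by (intro ternary_zeroI[of y z "a * x"]) (use * in auto)
qed

lemma hilbert_symbol_neg_self [simp]: "hilbert_symbol (- a) a = 1" "hilbert_symbol a (- a) = 1"
proof -
  have *: "\<exists>x y z. (x, y, z) \<noteq> (0, 0, 0) \<and> - a * x^2 + a * y^2 = z^2"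
    by (rule exI[of _ 1], rule exI[of _ 1], rule exI[of _ 0]) simp
  show "hilbert_symbol (- a) a = 1"
    unfolding hilbert_symbol_def by (rule if_P[OF *])
  then show "hilbert_symbol a (- a) = 1"
    by (metis hilbert_symbol_commute)
qed

section \<open>A pair of units with symbol -1 when 2 is not a unit\<close>

context uniformized begin

text \<open>On the finite residue field \<open>S^2 + S\<close> takes the same value at 0 and -1. It
  is therefore not injective and misses some class \<open>d\<close>; take \<delta> to be
  \<open>- d\<close>.\<close>

lemma ex_irreducible_artin_schreier:
  assumes "nrm (2::'a) < 1"
  obtains \<delta> :: 'a where "\<delta> \<in> integers" and "\<And>S. S \<in> integers \<Longrightarrow> nrm (S^2 + S + \<delta>) = 1"
proof -
  define g where "g = (\<lambda>r::'a. rep (r^2 + r))"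
  have int: "r^2 + r \<in> integers" if "r \<in> integers" for r :: 'a
    using that by (simp add: integers_add integers_mult power2_eq_square)
  have cong: "g (rep S) = g S" if "S \<in> integers" for S
  proof -
    have "(rep S)^2 + rep S - (S^2 + S) = (rep S - S) * (rep S + S + 1)"
      by (simp add: algebra_simps power2_eq_square)
    moreover have "nrm (rep S - S) < 1"
      using rep(1)[OF that] nrm_diff_commute by metis
    moreover have "nrm (rep S + S + 1) \<le> 1"
      using rep(2)[OF that] that by (intro nrm_add_le) (auto simp: mem_integers)
    ultimately have "nrm ((rep S)^2 + rep S - (S^2 + S)) < 1"
      by (metis mult_left_le nrm_mult nrm_nonneg order.strict_trans1)
    then show ?thesis
      unfolding g_def by (rule rep_cong)
  qed
  have "g (rep 0) = g (rep (-1))"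
    using cong[of 0] cong[of "-1"] by (simp add: g_def)
  moreover have "rep 0 \<noteq> rep (-1)"
  proof
    assume eq: "rep 0 = rep (-1)"
    have "nrm ((-1 - rep (-1)) - (0 - rep 0)) < 1"
      by (rule nrm_diff_less; rule rep; simp)
    moreover have "(-1 - rep (-1)) - (0 - rep 0) = (-1::'a)"
      using eq by simp
    ultimately show False
      by simp
  qed
  ultimately have "\<not> inj_on g reps"
    using rep_in_reps integers_minus integers_0 integers_1 by (metis inj_on_def)
  moreover have "g ` reps \<subseteq> reps"
    unfolding g_def using rep_in_reps int reps_integers by blast
  ultimately have "g ` reps \<noteq> reps"
    using finite_reps by (metis eq_card_imp_inj_on)
  then obtain d where d: "d \<in> reps" "d \<notin> g ` reps"
    using \<open>g ` reps \<subseteq> reps\<close> by blast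
  show ?thesis
  proof
    show "- d \<in> integers"
      using d reps_integers by simp
    fix S :: 'a assume S: "S \<in> integers"
    show "nrm (S^2 + S + - d) = 1"
    proof (rule ccontr)
      assume "nrm (S^2 + S + - d) \<noteq> 1"
      moreover have "nrm (S^2 + S + - d) \<le> 1"
        using integers_add[OF int[OF S] \<open>- d \<in> integers\<close>] by (simp add: mem_integers)
      ultimately have "g S = rep d"
        unfolding g_def by (intro rep_cong) simp
      then show False
        using d(2) cong[OF S] rep_reps[OF d(1)] imageI[OF rep_in_reps[OF S], of g] by simp
    qed
  qed
qed

text \<open>The form is anisotropic modulo the uniformizer, so no cancellation occurs: divide by
  \<open>Y^2\<close> if \<open>Y\<close> dominates, otherwise \<open>S^2\<close> outweighs the other
  terms.\<close>

lemma nrm_artin_schreier_form: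
  fixes S Y :: 'a
  assumes \<delta>: "\<delta> \<in> integers" "\<And>S. S \<in> integers \<Longrightarrow> nrm (S^2 + S + \<delta>) = 1"
  shows "nrm (S^2 + S * Y + \<delta> * Y^2) = (max (nrm S) (nrm Y))^2"
proof (cases "nrm S \<le> nrm Y")
  case True
  show ?thesis
  proof (cases "Y = 0")
    case False
    have "S^2 + S * Y + \<delta> * Y^2 = Y^2 * ((S / Y)^2 + S / Y + \<delta>)"
      using False by (simp add: field_simps power2_eq_square)
    then show ?thesis
      using True False \<delta>(2)[of "S / Y"]
      by (simp add: nrm_mult nrm_power mem_integers nrm_divide max_def)
  qed (use True in auto)
next
  case False
  then have "nrm S * nrm Y < nrm S * nrm S"
    by (intro mult_strict_left_mono) (use nrm_nonneg[of Y] in linarith)+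
  then have "nrm (S * Y) < nrm (S^2)"
    by (simp add: nrm_mult power2_eq_square)
  moreover have "nrm (\<delta> * Y^2) < nrm (S^2)"
  proof -
    have "nrm (\<delta> * Y^2) \<le> nrm Y ^ 2"
      using \<delta>(1) by (simp add: nrm_mult mem_integers nrm_power mult_left_le_one_le)
    also have "\<dots> < nrm S ^ 2"
      using False by (intro power_strict_mono) auto
    finally show ?thesis by (simp add: nrm_power)
  qed
  ultimately have "nrm (S * Y + \<delta> * Y^2) < nrm (S^2)"
    by (rule nrm_add_less)
  then have "nrm ((S * Y + \<delta> * Y^2) + S^2) = nrm (S^2)"
    by (rule nrm_add_eq)
  then show ?thesis
    using False by (simp add: nrm_power algebra_simps max_def)
qed

text \<open>The units \<open>1 - \<varpi>\<close> and \<open>1 - 4\<delta>/\<varpi>\<close>, where \<open>S\<^sup>2 + S + \<delta>\<close> has no root modulo \<open>\<varpi>\<close>: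
  substituting \<open>z = x + y + t\<close> turns the equation into \<open>t (t + 2 (x + y)) = - \<varpi> N(x, 2y/\<varpi>)\<close> with
  the norm form \<open>N\<close> of the unramified quadratic extension, and the two sides have different
  absolute values.\<close>

lemma ex_units_hilbert_symbol_minus_1:
  assumes two: "(2::'a) \<noteq> 0" "nrm (2::'a) < 1"
  obtains u v :: 'a where "nrm u = 1" "nrm v = 1" "hilbert_symbol u v = - 1"
proof -
  obtain \<delta> :: 'a where \<delta>: "\<delta> \<in> integers" "\<And>S. S \<in> integers \<Longrightarrow> nrm (S^2 + S + \<delta>) = 1"
    using ex_irreducible_artin_schreier two(2) by blast
  \<comment> \<open>Writing 2 as \<open>h * unif\<close> turns both \<open>2 * X * Y\<close> and the
    \<delta>-term of \<open>v * Y^2\<close> into \<open>unif\<close> times terms in \<open>X\<close>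
    and \<open>h * Y\<close>; this produces the norm form.\<close>
  define h where "h = 2 / unif"
  have h: "h \<in> integers" "h * unif = 2" "h \<noteq> 0"
    using two unif_dvd by (simp_all add: h_def)
  define u where "u = 1 - unif"
  define v where "v = 1 - h * 2 * \<delta>"
  have unit: "nrm (1 - x) = 1" if "nrm x < 1" for x :: 'a
    using nrm_add_eq[of "- x" 1] that by simp
  have "nrm (h * \<delta> * 2) \<le> nrm (2::'a)"
    using integers_mult[OF h(1) \<delta>(1)] by (simp only: nrm_mult[of "h * \<delta>"] mem_integers mult_left_le_one_le nrm_nonneg)
  then have nv: "nrm (h * 2 * \<delta>) < 1"
    using two(2) by (simp add: mult_ac)
  have "\<not> (\<exists>x y z. (x, y, z) \<noteq> (0, 0, 0) \<and> u * x^2 + v * y^2 = z^2)"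
  proof
    assume "\<exists>x y z. (x, y, z) \<noteq> (0, 0, 0) \<and> u * x^2 + v * y^2 = z^2"
    then obtain X Y z where nz: "(X, Y, z) \<noteq> (0, 0, 0)" and eq: "u * X^2 + v * Y^2 = z^2"
      by blast
    define t where "t = z - X - Y"
    define M where "M = max (nrm X) (nrm (h * Y))"
    have two_eq: "(2::'a) = h * unif"
      using h by simp
    have eq': "t * (t + 2 * (X + Y)) = - (unif * (X^2 + X * (h * Y) + \<delta> * (h * Y)^2))"
    proof -
      have "z = X + Y + t" by (simp add: t_def)
      with eq have "u * X^2 + v * Y^2 = (X + Y + t)^2" by simp
      then have "X^2 - unif * X^2 + Y^2 - h * 2 * \<delta> * Y^2
          = X^2 + Y^2 + 2 * X * Y + 2 * t * (X + Y) + t^2"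
        by (simp add: u_def v_def algebra_simps power2_eq_square)
      then have "t * (t + 2 * (X + Y)) = - (unif * X^2) - 2 * X * Y - h * 2 * \<delta> * Y^2"
        by (simp add: algebra_simps power2_eq_square eq_neg_iff_add_eq_0)
      also have "\<dots> = - (unif * (X^2 + X * (h * Y) + \<delta> * (h * Y)^2))"
        unfolding two_eq by (simp add: algebra_simps power2_eq_square)
      finally show ?thesis .
    qed
    have N: "nrm (t * (t + 2 * (X + Y))) = nrm unif * M^2"
      unfolding eq' nrm_minus by (simp only: nrm_mult[of unif] nrm_artin_schreier_form[OF \<delta>] M_def)
    have M0: "M > 0"
    proof (rule ccontr)
      assume "\<not> M > 0"
      moreover have "nrm X \<le> M" "nrm (h * Y) \<le> M"
        by (simp_all add: M_def)
      ultimately have "nrm X \<le> 0" "nrm (h * Y) \<le> 0"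
        by linarith+
      then have "X = 0" "Y = 0"
        using h by auto
      then show False
        using nz eq by simp
    qed
    \<comment> \<open>An element of absolute value \<open>M\<close>, so that \<open>M^2\<close> is
      the absolute value of a square and valuations can be compared by parity.\<close>
    define m where "m = (if nrm X \<le> nrm (h * Y) then h * Y else X)"
    have m: "nrm m = M"
      by (simp add: m_def M_def)
    have "nrm (2 * X) \<le> nrm unif * M"
      using two(2) nrm_less_1[of 2] by (auto simp: nrm_mult M_def intro!: mult_mono)
    moreover have "2 * Y = unif * (h * Y)"
      by (simp add: two_eq)
    then have "nrm (2 * Y) \<le> nrm unif * M"
      by (simp only: nrm_mult[of unif]) (auto simp: M_def intro!: mult_left_mono)
    ultimately have XY: "nrm (2 * (X + Y)) \<le> nrm unif * M"
      by (simp only: distrib_left nrm_add_le)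
    \<comment> \<open>If \<open>t\<close> dominates \<open>2 * (X + Y)\<close>, the product has the
      absolute value of \<open>t^2\<close>, of even valuation, against odd on the right. Otherwise
      both factors are at most \<open>nrm unif * M\<close>, and their product is too small.\<close>
    show False
    proof (cases "nrm (2 * (X + Y)) < nrm t")
      case True
      then have "nrm (2 * (X + Y) + t) = nrm t"
        by (rule nrm_add_eq)
      then have "nrm (t^2) = nrm (unif * m^2)"
        using N by (simp add: add.commute m power2_eq_square nrm_mult)
      moreover have "t \<noteq> 0"
        using True by auto
      ultimately show False
        using nrm_square_ne by blast
    next
      case False
      then have "nrm t \<le> nrm unif * M" "nrm (t + 2 * (X + Y)) \<le> nrm unif * M"
        using XY by (auto intro: nrm_add_le)
      then have "nrm (t * (t + 2 * (X + Y))) \<le> (nrm unif * M) * (nrm unif * M)"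
        unfolding nrm_mult[of t] by (intro mult_mono) (use M0 in auto)
      also have "\<dots> = nrm unif * (nrm unif * M^2)"
        by (simp add: power2_eq_square)
      also have "\<dots> < 1 * (nrm unif * M^2)"
        using M0 nrm_unif_less_1 by (intro mult_strict_right_mono) auto
      finally show False
        using N by simp
    qed
  qed
  then have "hilbert_symbol u v = - 1"
    unfolding hilbert_symbol_def by (rule if_not_P)
  then show ?thesis
    using that unit[OF nrm_unif_less_1] unit[OF nv] unfolding u_def v_def by blast
qed

end

section \<open>Splittings of the metaplectic cover\<close>

definition mat2 :: "'a::zero \<Rightarrow> 'a \<Rightarrow> 'a \<Rightarrow> 'a \<Rightarrow> 'a^2^2" where
  "mat2 a b c d = vector [vector [a, b], vector [c, d]]"

lemma mat2_nth [simp]: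
  "mat2 a b c d $ 1 $ 1 = a" "mat2 a b c d $ 1 $ 2 = b"
  "mat2 a b c d $ 2 $ 1 = c" "mat2 a b c d $ 2 $ 2 = d"
  by (simp_all add: mat2_def)

lemma mat2_eq_iff: "g = h \<longleftrightarrow> g$1$1 = h$1$1 \<and> g$1$2 = h$1$2 \<and> g$2$1 = h$2$1 \<and> g$2$2 = h$2$2"
  for g h :: "'a::zero^2^2"
  by (auto simp: vec_eq_iff forall_2)

lemma mat2_cases: obtains a b c d where "g = mat2 a b c d"
  by (metis mat2_eq_iff mat2_nth)

lemma mat2_mult [simp]: "mat2 a b c d ** mat2 a' b' c' d' =
    mat2 (a * a' + b * c') (a * b' + b * d') (c * a' + d * c') (c * b' + d * d')"
  for a :: "'a::semiring_1"
  by (simp add: mat2_eq_iff matrix_matrix_mult_def sum_2)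

lemma det_mat2 [simp]: "det (mat2 a b c d) = a * d - b * c"
  by (simp add: det_2)

lemma mat2_one: "mat 1 = mat2 1 0 0 1"
  by (simp add: mat2_eq_iff mat_def)

lemma w2_mat2: "w2 = mat2 0 1 (-1) 0"
  and n_mat2: "n_SL2 x = mat2 1 x 0 1"
  and t_mat2: "t_SL2 a = mat2 a 0 0 (inverse a)"
  by (simp_all add: w2_def n_SL2_def t_SL2_def mat2_def)

lemma mat2_eq [simp]: "mat2 a b c d = mat2 a' b' c' d' \<longleftrightarrow> a = a' \<and> b = b' \<and> c = c' \<and> d = d'"
  by (simp add: mat2_eq_iff)

lemma x_coord_mat2 [simp]: "x_coord (mat2 a b c d) = (if c \<noteq> 0 then c else d)"
  by (simp add: x_coord_def)

lemma SL2_mat2: "mat2 a b c d \<in> SL2 \<longleftrightarrow> a * d - b * c = 1"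
  by (simp add: SL2_def)

lemma SL2_int_mat2: "mat2 a b c d \<in> SL2_int \<longleftrightarrow>
    a * d - b * c = 1 \<and> a \<in> integers \<and> b \<in> integers \<and> c \<in> integers \<and> d \<in> integers"
  by (auto simp: SL2_int_def SL2_mat2 forall_2)

lemma SL2_int_mult: "g \<in> SL2_int \<Longrightarrow> h \<in> SL2_int \<Longrightarrow> g ** h \<in> SL2_int"
proof -
  assume "g \<in> SL2_int" "h \<in> SL2_int"
  moreover obtain a b c d a' b' c' d' where "g = mat2 a b c d" "h = mat2 a' b' c' d'"
    by (metis mat2_cases)
  moreover have "det (g ** h) = det g * det h"
    by (rule det_mul)
  ultimately show ?thesis
    by (simp add: SL2_int_mat2 integers_add integers_mult)
qed

lemma SL2_mult: "g \<in> SL2 \<Longrightarrow> h \<in> SL2 \<Longrightarrow> g ** h \<in> SL2"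
  by (simp add: SL2_def det_mul)

lemma SL2_int_subset: "g \<in> SL2_int \<Longrightarrow> g \<in> SL2"
  by (simp add: SL2_int_def)

lemma cocycle_n_right: "g \<in> SL2 \<Longrightarrow> cocycle g (n_SL2 x) = 1"
  by (cases g rule: mat2_cases) (simp add: cocycle_def n_mat2)

lemma cocycle_n_left: "g \<in> SL2 \<Longrightarrow> cocycle (n_SL2 x) g = 1"
  by (cases g rule: mat2_cases) (simp add: cocycle_def n_mat2)

lemma Mp_iff: "(g, \<zeta>) \<in> Mp \<longleftrightarrow> g \<in> SL2 \<and> (\<zeta> = 1 \<or> \<zeta> = -1)"
  by (auto simp: Mp_def)

lemma cocycle_values: "cocycle g h = 1 \<or> cocycle g h = -1"
  using hilbert_symbol_values[of "x_coord g" "x_coord h"]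
    hilbert_symbol_values[of "- x_coord g * x_coord h" "x_coord (g ** h)"]
  unfolding cocycle_def by auto

text \<open>In the theorem \<open>splitting_n\<close> is supplied by the section that is 1 on the
  split group, see \<open>splitting_trivial_on_n\<close>.\<close>

locale metaplectic_splitting = uniformized unif for unif :: "'a::nonarch_local_field" +
  fixes \<sigma> :: "'a^2^2 \<Rightarrow> int"
  assumes splitting: "splitting \<sigma>"
    and splitting_n: "x \<in> integers \<Longrightarrow> \<sigma> (n_SL2 x) = 1"
begin

lemma sigma_mult: "k \<in> SL2_int \<Longrightarrow> k' \<in> SL2_int \<Longrightarrow> \<sigma> (k ** k') = \<sigma> k * \<sigma> k' * cocycle k k'"
  using splitting by (auto simp: splitting_def mp_mult_def)

lemma sigma_values: "k \<in> SL2_int \<Longrightarrow> \<sigma> k = 1 \<or> \<sigma> k = -1"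
  using splitting by (auto simp: splitting_def)

lemma sigma_one: "\<sigma> (mat 1) = 1"
  using splitting_n[of 0] by (simp add: n_mat2 mat2_one)

text \<open>A lower unipotent is an upper one conjugated by \<open>w2\<close>, and the signs of
  \<sigma> at \<open>w2\<close> and at its inverse cancel.\<close>

lemma sigma_lower:
  assumes "y \<in> integers"
  shows "\<sigma> (mat2 1 0 y 1) = 1"
proof -
  have w: "w2 \<in> SL2_int" and w': "mat2 0 (-1) 1 (0::'a) \<in> SL2_int" (is "?w' \<in> _")
    by (simp_all add: w2_mat2 SL2_int_mat2)
  have n: "n_SL2 (- y) \<in> SL2_int"
    using assms by (simp add: n_mat2 SL2_int_mat2)
  have "w2 ** ?w' = mat 1"
    by (simp add: w2_mat2 mat2_one)
  moreover have "cocycle w2 ?w' = 1"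
    by (simp add: cocycle_def w2_mat2)
  ultimately have ww: "\<sigma> w2 * \<sigma> ?w' = 1"
    using sigma_mult[OF w w'] sigma_one by simp
  have "mat2 1 0 y 1 = (w2 ** n_SL2 (- y)) ** ?w'"
    by (simp add: w2_mat2 n_mat2)
  also have "\<sigma> \<dots> = \<sigma> (w2 ** n_SL2 (- y)) * \<sigma> ?w'"
    by (subst sigma_mult[OF SL2_int_mult[OF w n] w']) (simp add: cocycle_def w2_mat2 n_mat2)
  also have "\<sigma> (w2 ** n_SL2 (- y)) = \<sigma> w2"
    using assms by (simp add: sigma_mult[OF w n] splitting_n cocycle_n_right[OF SL2_int_subset[OF w]])
  finally show ?thesis
    using ww by simp
qed

lemma sigma_antidiagonal:
  assumes "nrm (p::'a) = 1"
  shows "\<sigma> (mat2 0 (- inverse p) p 0) = 1"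
proof -
  let ?u = "- inverse p"
  have p: "p \<in> integers" "?u \<in> integers" "p \<noteq> 0"
    using assms by (auto simp: mem_integers nrm_inverse)
  have n: "n_SL2 ?u \<in> SL2_int" and l: "mat2 1 0 p 1 \<in> SL2_int"
    using p by (simp_all add: n_mat2 SL2_int_mat2)
  have "mat2 0 ?u p 0 = n_SL2 ?u ** (mat2 1 0 p 1 ** n_SL2 ?u)"
    using p by (simp add: n_mat2)
  then show ?thesis
    using n l p by (simp add: sigma_mult SL2_int_mult cocycle_n_left cocycle_n_right
        SL2_int_subset splitting_n sigma_lower)
qed

text \<open>\<open>diag(- r / p, - p / r)\<close> is a product of two antidiagonal matrices in two
  ways, with parameters \<open>(p, r)\<close> and \<open>(p / r, 1)\<close>. As \<sigma> is 1 on all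
  four factors, the two cocycles agree. They differ exactly by the symbol of \<open>p\<close> and
  \<open>r\<close>.\<close>

lemma hilbert_symbol_units:
  assumes "nrm p = 1" "nrm (r::'a) = 1"
  shows "hilbert_symbol p r = 1"
proof -
  have A: "mat2 0 (- inverse x) x 0 \<in> SL2_int" if "nrm x = 1" for x :: 'a
    using that by (cases "x = 0") (auto simp: SL2_int_mat2 mem_integers nrm_inverse)
  have H: "hilbert_symbol (- p / r) b = hilbert_symbol (- p * r) b"
    if "nrm r = 1" for p r b :: 'a
  proof -
    have "r \<noteq> 0"
      using that by auto
    then have "- p * r * (inverse r)^2 = - p / r"
      by (simp add: power2_eq_square divide_inverse)
    then show ?thesis
      using hilbert_symbol_mult_square[of "inverse r" "- p * r" b] \<open>r \<noteq> 0\<close> by simp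
  qed
  have *: "\<sigma> (mat2 (- r / p) 0 0 (- p / r)) = hilbert_symbol p r * hilbert_symbol (- p * r) (- p * r)"
    if "nrm p = 1" "nrm r = 1" for p r :: 'a
  proof -
    have nz: "p \<noteq> 0" "r \<noteq> 0"
      using that by auto
    have "mat2 (- r / p) 0 0 (- p / r) = mat2 0 (- inverse p) p 0 ** mat2 0 (- inverse r) r 0"
      by (simp add: field_simps)
    also have "\<sigma> \<dots> = hilbert_symbol p r * hilbert_symbol (- p * r) (- p / r)"
      using nz sigma_antidiagonal[OF that(1)] sigma_antidiagonal[OF that(2)]
      by (subst sigma_mult[OF A A]) (simp_all add: that cocycle_def divide_inverse mult_ac)
    also have "hilbert_symbol (- p * r) (- p / r) = hilbert_symbol (- p * r) (- p * r)"
      using H[OF that(2)] hilbert_symbol_commute by metis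
    finally show ?thesis .
  qed
  have nz: "p \<noteq> 0" "r \<noteq> 0"
    using assms by auto
  have "hilbert_symbol p r * hilbert_symbol (- p * r) (- p * r) = hilbert_symbol (- p / r) (- p / r)"
    using *[OF assms] *[of "p / r" 1] assms by (simp add: nrm_divide)
  also have "\<dots> = hilbert_symbol (- p * r) (- p * r)"
    using H[OF assms(2)] hilbert_symbol_commute by metis
  finally show ?thesis
    using hilbert_symbol_values[of "- p * r" "- p * r"] by auto
qed

lemma nrm_two:
  assumes "(2::'a) \<noteq> 0"
  shows "nrm (2::'a) = 1"
proof (rule ccontr)
  assume "nrm (2::'a) \<noteq> 1"
  then have "nrm (2::'a) < 1"
    using nrm_two_le[where 'a = 'a] by simp
  then obtain u v :: 'a where "nrm u = 1" "nrm v = 1" "hilbert_symbol u v = - 1"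
    using ex_units_hilbert_symbol_minus_1 assms by blast
  then show False
    using hilbert_symbol_units by force
qed

end

text \<open>\<open>f\<close> is genuine and left invariant under the lifts
  \<open>(n_SL2 x, 1)\<close>, hence takes the values 1 and -1 at the two lifts of
  \<open>n_SL2 x\<close>. The lift chosen by \<sigma> is the one with value 1.\<close>

lemma splitting_trivial_on_n:
  fixes f :: "('a::nonarch_local_field^2^2) \<times> int \<Rightarrow> complex"
  assumes \<sigma>: "splitting \<sigma>" and f: "f \<in> induced_space s \<eta> \<psi>'"
    and f1: "\<forall>k\<in>SL2_int. f (k, \<sigma> k) = 1" and x: "x \<in> integers"
  shows "\<sigma> (n_SL2 x) = 1"
proof -
  have one: "mat 1 \<in> (SL2_int :: ('a^2^2) set)" and n: "n_SL2 x \<in> SL2_int"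
    using x by (simp_all add: mat2_one n_mat2 SL2_int_mat2)
  have c1: "cocycle (mat 1) g = 1" if "g \<in> SL2" for g :: "'a^2^2"
    using cocycle_n_left[OF that, of 0] by (simp add: n_mat2 mat2_one)
  let ?e = "mat 1 :: 'a^2^2"
  have "mp_mult (?e, \<sigma> ?e) (?e, \<sigma> ?e) = (?e ** ?e, \<sigma> (?e ** ?e))"
    using \<sigma> one unfolding splitting_def by blast
  then have "\<sigma> ?e = \<sigma> ?e * \<sigma> ?e * cocycle ?e ?e"
    by (simp add: mp_mult_def)
  moreover have "\<sigma> (mat 1) = 1 \<or> \<sigma> (mat 1) = -1"
    using \<sigma> one by (auto simp: splitting_def)
  ultimately have \<sigma>1: "\<sigma> (mat 1) = 1"
    using c1[OF SL2_int_subset[OF one]] by auto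
  have t: "f (mp_mult (t_SL2 1, \<zeta>) g) = of_int \<zeta> * (mu_weil \<psi>' 1 * \<eta> 1) * f g"
    if "\<zeta> = 1 \<or> \<zeta> = - 1" "g \<in> Mp" for \<zeta> g
    using f that by (auto simp: induced_space_def)
  have tm: "mp_mult (t_SL2 1, \<zeta>) (g, \<epsilon>) = (g, \<zeta> * \<epsilon>)" if "g \<in> SL2" for g :: "'a^2^2" and \<zeta> \<epsilon>
    using c1[OF that] by (simp add: mp_mult_def t_mat2 mat2_one[symmetric])
  have "f (mat 1, 1) = 1"
    using f1 one \<sigma>1 by metis
  \<comment> \<open>The normalization at the identity determines this product, so
    \<open>mu_weil\<close> need not be evaluated at 1.\<close>
  then have \<mu>: "mu_weil \<psi>' 1 * \<eta> 1 = 1"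
    using t[of 1 "(mat 1, 1)"] tm[OF SL2_int_subset[OF one], of 1 1] SL2_int_subset[OF one]
    by (simp add: Mp_iff)
  have "f (mp_mult (n_SL2 x, 1) (mat 1, 1)) = f (mat 1, 1)"
    using f SL2_int_subset[OF one] by (simp add: induced_space_def Mp_iff)
  then have fn: "f (n_SL2 x, 1) = 1"
    using \<open>f (mat 1, 1) = 1\<close> cocycle_n_left[OF SL2_int_subset[OF one], of x] by (simp add: mp_mult_def)
  then have "f (n_SL2 x, -1) = -1"
    using t[of "-1" "(n_SL2 x, 1)"] tm[OF SL2_int_subset[OF n], of "-1" 1] \<mu> SL2_int_subset[OF n]
    by (simp add: Mp_iff)
  moreover have "f (n_SL2 x, \<sigma> (n_SL2 x)) = 1" "\<sigma> (n_SL2 x) = 1 \<or> \<sigma> (n_SL2 x) = -1"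
    using f1 n \<sigma> by (auto simp: splitting_def)
  ultimately show ?thesis by auto
qed

section \<open>The Weil representation on the unramified vector\<close>

lemma unramified_additive_character_inverse:
  "unramified_additive_character \<psi> \<Longrightarrow> unramified_additive_character (\<lambda>x. inverse (\<psi> x))"
  unfolding unramified_additive_character_def additive_character_def
  by (auto simp: norm_inverse intro!: continuous_on_inverse) (metis norm_zero zero_neq_one)

lemma nrm_mult_le_1: "c \<noteq> 0 \<Longrightarrow> nrm (c * x) \<le> 1 \<longleftrightarrow> nrm x \<le> nrm (inverse c)"
  unfolding nrm_mult nrm_inverse by (simp add: field_simps)

lemma indicator_ball_schwartz:
  fixes c :: "'a::nonarch_local_field"
  assumes "c \<noteq> 0"
  shows "(\<lambda>x. indicator integers (c * x) :: complex) \<in> schwartz"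
proof -
  have eq: "{x. (indicator integers (c * x) :: complex) \<noteq> 0} = {x. nrm x \<le> nrm (inverse c)}"
    by (simp add: indicator_def mem_integers nrm_mult_le_1[OF assms])
  have "closed {x::'a. nrm x \<le> nrm (inverse c)}"
    using clopen_ball_nrm(2)[of "nrm (inverse c)" 0] assms by simp
  then have "compact (closure {x. (indicator integers (c * x) :: complex) \<noteq> 0})"
    unfolding eq by (simp add: compact_nrm_ball)
  moreover have "\<exists>V. open V \<and> x \<in> V \<and>
      (\<forall>y\<in>V. indicator integers (c * y) = (indicator integers (c * x) :: complex))" for x
  proof (intro exI conjI ballI)
    show "open {y. nrm (y - x) \<le> nrm (inverse c)}"
      using clopen_ball_nrm(1)[of "nrm (inverse c)" x] assms by simp
    fix y assume "y \<in> {y. nrm (y - x) \<le> nrm (inverse c)}"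
    then have "c * (y - x) \<in> integers"
      using assms by (simp add: mem_integers nrm_mult_le_1)
    then have "c * y \<in> integers \<longleftrightarrow> c * x \<in> integers"
      using integers_add[of "c * (y - x)" "c * x"] integers_diff[of "c * y" "c * (y - x)"]
      by (auto simp: algebra_simps)
    then show "indicator integers (c * y) = (indicator integers (c * x) :: complex)"
      by (simp add: indicator_def)
  qed simp
  ultimately show ?thesis
    unfolding schwartz_def by blast
qed

lemma indicator_integers_schwartz: "(indicator integers :: 'a::nonarch_local_field \<Rightarrow> complex) \<in> schwartz"
  using indicator_ball_schwartz[of "1::'a"] by simp

text \<open>If 2 were 0, the pairing \<open>\<psi> (2 * x * y)\<close> would be constant and every
  Fourier transform a constant function; a double transform could not return the indicator of the
  integers.\<close>

lemma self_dual_two_neq_0: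
  fixes M :: "'a::nonarch_local_field measure"
  assumes "self_dual_measure \<psi> M" and unif: "uniformizer (w::'a)"
  shows "(2::'a) \<noteq> 0"
proof
  assume two: "(2::'a) = 0"
  interpret uniformized w by unfold_locales (rule unif)
  let ?\<phi> = "indicator integers :: 'a \<Rightarrow> complex"
  have dual: "fourier M \<psi> (fourier M \<psi> ?\<phi>) x = ?\<phi> (- x)" for x
    using assms(1) indicator_integers_schwartz unfolding self_dual_measure_def by blast
  have "fourier M \<psi> (fourier M \<psi> ?\<phi>) (inverse w) = fourier M \<psi> (fourier M \<psi> ?\<phi>) 0"
    unfolding fourier_def by (simp add: two)
  then have "- inverse w \<in> integers"
    unfolding dual by (simp add: indicator_def split: if_splits)
  then show False
    using nrm_unif_less_1 unif_nz by (simp add: mem_integers nrm_inverse inverse_le_1_iff)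
qed

lemma haar_integral_translate:
  fixes M :: "'a::nonarch_local_field measure" and f :: "'a \<Rightarrow> complex"
  assumes M: "additive_haar M" and f: "f \<in> borel_measurable borel"
  shows "(\<integral>y. f (c + y) \<partial>M) = (\<integral>y. f y \<partial>M)"
proof -
  have sets: "sets M = sets borel"
    using M by (simp add: additive_haar_def)
  have meas: "(\<lambda>y. c + y) \<in> measurable M M"
    unfolding measurable_cong_sets[OF sets sets]
    by (intro borel_measurable_continuous_onI continuous_on_add_const)
  have "distr M M (\<lambda>y. c + y) = M"
  proof (rule measure_eqI)
    fix A assume "A \<in> sets (distr M M ((+) c))"
    then have A: "A \<in> sets M" by simp
    have "(\<lambda>y. c + y) -` A \<inter> space M = (\<lambda>y. - c + y) ` A"
    proof (intro equalityI subsetI)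
      fix y assume "y \<in> (\<lambda>y. c + y) -` A \<inter> space M"
      then show "y \<in> (\<lambda>y. - c + y) ` A"
        by (intro image_eqI[of _ _ "c + y"]) auto
    qed (use sets_eq_imp_space_eq[OF sets] in auto)
    moreover have "emeasure M ((\<lambda>y. - c + y) ` A) = emeasure M A"
      using M A sets unfolding additive_haar_def by blast
    ultimately show "emeasure (distr M M ((+) c)) A = emeasure M A"
      by (simp only: emeasure_distr[OF meas A])
  qed simp
  then have "(\<integral>y. f y \<partial>M) = (\<integral>y. f y \<partial>(distr M M (\<lambda>y. c + y)))"
    by simp
  also have "\<dots> = (\<integral>y. f (c + y) \<partial>M)"
    using f meas by (intro integral_distr) (simp_all add: measurable_cong_sets[OF sets])
  finally show ?thesis by simp
qed

context uniformized begin

lemma unramified_nontrivial: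
  fixes z :: 'a
  assumes "unramified_additive_character \<psi>" and "z \<notin> integers"
  obtains y where "y \<in> integers" "\<psi> (z * y) \<noteq> 1"
proof -
  obtain x where x: "nrm x \<le> real q" "\<psi> x \<noteq> 1"
    using assms(1) unfolding unramified_additive_character_def q_def by blast
  have z: "nrm z \<ge> real q" "z \<noteq> 0"
    using assms(2) nrm_gt_1[of z] by (auto simp: mem_integers)
  then have "x / z \<in> integers"
    using x(1) q_pos by (simp add: mem_integers nrm_divide del: q_pos)
  then show ?thesis
    using that[of "x / z"] x z by simp
qed

text \<open>Orthogonality of characters. Since 2 is a unit,
  \<open>y \<mapsto> \<psi> (2 * x * y)\<close> is trivial on the ball exactly when
  \<open>x / c\<close> is integral. Otherwise a translation within the ball multiplies the integral
  by a value other than 1.\<close>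

lemma fourier_indicator_ball:
  fixes M :: "'a measure"
  assumes M: "additive_haar M" and \<psi>: "unramified_additive_character \<psi>"
    and two: "nrm (2::'a) = 1" and c: "c \<noteq> 0"
  shows "fourier M \<psi> (\<lambda>x. indicator integers (c * x)) x =
    of_real (measure M {y. nrm (c * y) \<le> 1}) * indicator integers (x / c)"
proof -
  let ?B = "{y. nrm (c * y) \<le> 1}"
  have ball: "?B = {x. nrm (x - 0) \<le> nrm (inverse c)}"
    using c by (simp add: nrm_mult_le_1)
  have sets: "sets M = sets borel"
    using M by (simp add: additive_haar_def)
  have B: "?B \<in> sets borel"
    unfolding ball using c by (intro borel_closed clopen_ball_nrm) simp
  have ind: "indicator integers (c * y) = (indicator ?B y :: complex)" for y
    by (simp add: indicator_def mem_integers)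
  have \<psi>1: "\<psi> z = 1" if "z \<in> integers" for z
    using \<psi> that by (simp add: unramified_additive_character_def)
  have \<psi>add: "\<psi> (y + z) = \<psi> y * \<psi> z" for y z
    using \<psi> by (simp add: unramified_additive_character_def additive_character_def)
  have two_unit: "2 * z \<in> integers \<longleftrightarrow> z \<in> integers" for z :: 'a
    by (simp add: mem_integers nrm_mult two)
  show ?thesis
  proof (cases "x / c \<in> integers")
    case True
    have "indicator integers (c * y) * \<psi> (2 * x * y) = indicator ?B y" for y
    proof (cases "y \<in> ?B")
      case y: True
      have eq: "2 * x * y = 2 * ((x / c) * (c * y))"
        using c by simp
      moreover have "2 * ((x / c) * (c * y)) \<in> integers"
        unfolding two_unit using integers_mult[OF True, of "c * y"] y by (simp add: mem_integers)
      ultimately show ?thesis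
        using \<psi>1 y unfolding eq ind by auto
    qed (simp add: ind)
    then have "fourier M \<psi> (\<lambda>x. indicator integers (c * x)) x = (\<integral>y. of_real (indicator ?B y) \<partial>M)"
      unfolding fourier_def by (intro Bochner_Integration.integral_cong) (simp_all add: indicator_def)
    then show ?thesis
      using True B sets sets_eq_imp_space_eq[OF sets] by simp
  next
    case False
    then have "2 * (x / c) \<notin> integers"
      using two_unit by blast
    then obtain z where z: "z \<in> integers" "\<psi> (2 * (x / c) * z) \<noteq> 1"
      using unramified_nontrivial[OF \<psi>] by blast
    define g where "g y = indicator integers (c * y) * \<psi> (2 * x * y)" for y
    have g: "g \<in> borel_measurable borel"
      unfolding g_def ind
    proof (rule borel_measurable_times[OF borel_measurable_indicator[OF B]],
        rule borel_measurable_continuous_onI)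
      have "continuous_on UNIV \<psi>"
        using \<psi> by (simp add: unramified_additive_character_def additive_character_def)
      then show "continuous_on UNIV (\<lambda>y. \<psi> (2 * x * y))"
        using continuous_on_compose2[OF _ continuous_on_mult_const] by blast
    qed
    have "g (z / c + y) = \<psi> (2 * (x / c) * z) * g y" for y
    proof -
      have "c * (z / c + y) \<in> integers \<longleftrightarrow> c * y \<in> integers"
        using integers_add[OF z(1), of "c * y"] integers_diff[OF _ z(1), of "z + c * y"] c
        by (auto simp: distrib_left)
      moreover have "2 * x * (z / c + y) = 2 * (x / c) * z + 2 * x * y"
        using c by (simp add: field_simps)
      ultimately show ?thesis
        by (simp add: g_def \<psi>add indicator_def)
    qed
    then have "(\<integral>y. g y \<partial>M) = \<psi> (2 * (x / c) * z) * (\<integral>y. g y \<partial>M)"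
      using haar_integral_translate[OF M g, of "z / c"] by simp
    then have "(\<integral>y. g y \<partial>M) = 0"
      using z(2) by simp
    then show ?thesis
      using False by (simp add: fourier_def g_def)
  qed
qed

text \<open>The ball is the disjoint union of the \<open>q\<close> translates of the integers by
  \<open>r / unif\<close>, with \<open>r\<close> in \<open>reps\<close>.\<close>

lemma haar_unif_ball:
  fixes M :: "'a measure"
  assumes M: "additive_haar M"
  shows "measure M {y. nrm (unif * y) \<le> 1} = real q * measure M integers"
proof -
  let ?F = "\<lambda>r. {y. nrm (y - r / unif) \<le> 1}"
  have sets: "sets M = sets borel"
    using M by (simp add: additive_haar_def)
  have F: "?F r \<in> sets borel" for r
    by (intro borel_closed clopen_ball_nrm) simp
  have "?F r = (\<lambda>y. r / unif + y) ` integers" for r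
  proof (intro equalityI subsetI)
    fix y assume "y \<in> ?F r"
    then show "y \<in> (\<lambda>y. r / unif + y) ` integers"
      by (intro image_eqI[of _ _ "y - r / unif"]) (auto simp: mem_integers)
  qed (auto simp: mem_integers)
  moreover have "(integers :: 'a set) \<in> sets borel"
    using F[of 0] by (simp add: integers_def)
  ultimately have eF: "emeasure M (?F r) = emeasure M integers" for r
    using M by (simp add: additive_haar_def)
  have in_F: "y \<in> ?F r \<longleftrightarrow> nrm (unif * y - r) < 1" for y r
  proof -
    have "unif * y - r = unif * (y - r / unif)"
      by (simp add: field_simps)
    then show ?thesis
      using unif_mult_integer[of "y - r / unif"] by (simp add: mem_integers)
  qed
  have "{y. nrm (unif * y) \<le> 1} = (\<Union>r\<in>reps. ?F r)"
  proof (intro equalityI subsetI)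
    fix y assume "y \<in> {y. nrm (unif * y) \<le> 1}"
    then have "unif * y \<in> integers"
      by (simp add: mem_integers)
    then show "y \<in> (\<Union>r\<in>reps. ?F r)"
      using rep(1) rep_in_reps in_F by blast
  next
    fix y assume "y \<in> (\<Union>r\<in>reps. ?F r)"
    then obtain r where "r \<in> reps" "nrm (unif * y - r) < 1"
      using in_F by blast
    then show "y \<in> {y. nrm (unif * y) \<le> 1}"
      using nrm_add_le[of "unif * y - r" 1 r] reps_integers[of r] by (simp add: mem_integers)
  qed
  also have "emeasure M \<dots> = (\<Sum>r\<in>reps. emeasure M (?F r))"
  proof (rule sum_emeasure[symmetric])
    show "disjoint_family_on ?F reps"
      unfolding disjoint_family_on_def
    proof (intro ballI impI)
      fix r r' assume *: "r \<in> reps" "r' \<in> reps" "r \<noteq> r'"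
      show "?F r \<inter> ?F r' = {}"
      proof (rule ccontr)
        assume "?F r \<inter> ?F r' \<noteq> {}"
        then obtain y where "y \<in> ?F r" "y \<in> ?F r'" by blast
        then have "nrm (unif * y - r) < 1" "nrm (unif * y - r') < 1"
          using in_F by blast+
        then have "nrm (r' - r) < 1"
          using nrm_diff_less[of "unif * y - r" 1 "unif * y - r'"] by simp
        then show False
          using reps_eq * by metis
      qed
    qed
  qed (use F sets finite_reps in auto)
  finally have "emeasure M {y. nrm (unif * y) \<le> 1} = of_nat q * emeasure M integers"
    by (simp only: eF sum_constant card_reps)
  then have "measure M {y. nrm (unif * y) \<le> 1} = enn2real (of_nat q) * measure M integers"
    by (simp only: measure_def enn2real_mult)
  then show ?thesis
    by (simp only: enn2real_of_nat)
qed

end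

section \<open>Action of the split compact group and of the torus on the unramified vector\<close>

lemma SL2_t: "a \<noteq> 0 \<Longrightarrow> t_SL2 a \<in> SL2"
  by (simp add: t_mat2 SL2_mat2)

lemma SL2_w2: "w2 \<in> SL2"
  by (simp add: w2_mat2 SL2_mat2)

lemma SL2_one: "mat 1 \<in> SL2"
  by (simp add: SL2_def)

text \<open>The \<psi> of this locale is the inverse of the character in the theorem.\<close>

locale weil_splitting = metaplectic_splitting unif \<sigma>
  for unif :: "'a::nonarch_local_field" and \<sigma> +
  fixes \<psi> :: "'a \<Rightarrow> complex" and \<omega> :: "('a^2^2) \<times> int \<Rightarrow> ('a \<Rightarrow> complex) \<Rightarrow> 'a \<Rightarrow> complex"
  assumes unramified: "unramified_additive_character \<psi>"
    and weil: "weil_representation \<psi> \<omega>"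
begin

abbreviation \<phi>0 :: "'a \<Rightarrow> complex" where "\<phi>0 \<equiv> indicator integers"

abbreviation \<mu> :: "'a \<Rightarrow> complex" where "\<mu> \<equiv> mu_weil \<psi>"

lemma weil_mult: "g \<in> Mp \<Longrightarrow> h \<in> Mp \<Longrightarrow> \<phi> \<in> schwartz \<Longrightarrow> \<omega> (mp_mult g h) \<phi> = \<omega> g (\<omega> h \<phi>)"
  by (rule weil[unfolded weil_representation_def, THEN conjunct2, THEN conjunct2, THEN conjunct1, rule_format])

lemma weil_n: "\<phi> \<in> schwartz \<Longrightarrow> \<omega> (n_SL2 b, 1) \<phi> = (\<lambda>x. \<psi> (b * x^2) * \<phi> x)"
  by (rule weil[unfolded weil_representation_def, THEN conjunct2, THEN conjunct2, THEN conjunct2, THEN conjunct2, THEN conjunct1, rule_format])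

lemma weil_t: "\<phi> \<in> schwartz \<Longrightarrow> a \<noteq> 0 \<Longrightarrow>
    \<omega> (t_SL2 a, 1) \<phi> = (\<lambda>x. of_real (sqrt (nrm a)) * \<mu> a * \<phi> (a * x))"
  by (rule weil[unfolded weil_representation_def, THEN conjunct2, THEN conjunct2, THEN conjunct2, THEN conjunct2, THEN conjunct2, THEN conjunct1, rule_format])

lemma weil_central: "\<phi> \<in> schwartz \<Longrightarrow> \<zeta> = 1 \<or> \<zeta> = -1 \<Longrightarrow> \<omega> (mat 1, \<zeta>) \<phi> = (\<lambda>x. of_int \<zeta> * \<phi> x)"
  by (rule weil[unfolded weil_representation_def, THEN conjunct2, THEN conjunct2, THEN conjunct2, THEN conjunct2, THEN conjunct2, THEN conjunct2, rule_format]) auto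

lemma weil_closed: "g \<in> Mp \<Longrightarrow> \<phi> \<in> schwartz \<Longrightarrow> \<omega> g \<phi> \<in> schwartz"
  by (rule weil[unfolded weil_representation_def, THEN conjunct1, rule_format])

lemma weil_scale:
  assumes "g \<in> Mp" "\<phi> \<in> schwartz"
  shows "\<omega> g (\<lambda>x. c * \<phi> x) = (\<lambda>x. c * \<omega> g \<phi> x)"
proof -
  have "\<omega> g (\<lambda>x. (c - 1) * \<phi> x + \<phi> x) = (\<lambda>x. (c - 1) * \<omega> g \<phi> x + \<omega> g \<phi> x)"
    by (intro weil[unfolded weil_representation_def, THEN conjunct2, THEN conjunct1, rule_format] assms)
  then show ?thesis
    by (simp add: algebra_simps)
qed

lemma weil_genuine:
  assumes "g \<in> SL2" "\<zeta> = 1 \<or> \<zeta> = -1" "\<phi> \<in> schwartz"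
  shows "\<omega> (g, \<zeta>) \<phi> = (\<lambda>x. of_int \<zeta> * \<omega> (g, 1) \<phi> x)"
proof -
  have "mp_mult (mat 1, \<zeta>) (g, 1) = (g, \<zeta>)"
    using cocycle_n_left[OF assms(1), of 0] by (simp add: mp_mult_def n_mat2 flip: mat2_one)
  moreover have "(g, 1) \<in> Mp" "(mat 1, \<zeta>) \<in> Mp"
    using assms SL2_one by (simp_all add: Mp_iff)
  ultimately show ?thesis
    using weil_mult[of "(mat 1, \<zeta>)" "(g, 1)" \<phi>] weil_central[OF weil_closed] assms by metis
qed

definition haar :: "'a measure" where
  "haar = (SOME M. self_dual_measure \<psi> M \<and>
     (\<forall>\<phi>\<in>schwartz. \<omega> (w2, 1) \<phi> = (\<lambda>x. weil_index \<psi> * fourier M \<psi> \<phi> x)))"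

lemma self_dual_haar: "self_dual_measure \<psi> haar"
  and weil_w2: "\<phi> \<in> schwartz \<Longrightarrow> \<omega> (w2, 1) \<phi> = (\<lambda>x. weil_index \<psi> * fourier haar \<psi> \<phi> x)"
proof -
  have "\<exists>M. self_dual_measure \<psi> M \<and>
     (\<forall>\<phi>\<in>schwartz. \<omega> (w2, 1) \<phi> = (\<lambda>x. weil_index \<psi> * fourier M \<psi> \<phi> x))"
    by (rule weil[unfolded weil_representation_def, THEN conjunct2, THEN conjunct2, THEN conjunct2, THEN conjunct1, rule_format])
  from someI_ex[OF this, folded haar_def]
  show "self_dual_measure \<psi> haar"
    and "\<phi> \<in> schwartz \<Longrightarrow> \<omega> (w2, 1) \<phi> = (\<lambda>x. weil_index \<psi> * fourier haar \<psi> \<phi> x)"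
    by blast+
qed

lemma haar: "additive_haar haar"
  using self_dual_haar by (simp add: self_dual_measure_def)

lemma nrm_2: "nrm (2::'a) = 1"
  using nrm_two self_dual_two_neq_0[OF self_dual_haar unif] by blast

text \<open>The eigenvalue of \<open>(w2, 1)\<close> on \<open>\<phi>0\<close>. Neither factor is
  evaluated; the order of \<open>w2\<close> in \<open>\<kappa>_pow4\<close> gives all the
  information used.\<close>

definition \<kappa> :: complex where
  "\<kappa> = weil_index \<psi> * of_real (measure haar integers)"

lemma weil_w2_ball:
  assumes "c \<noteq> 0"
  shows "\<omega> (w2, 1) (\<lambda>x. \<phi>0 (c * x)) =
    (\<lambda>x. weil_index \<psi> * of_real (measure haar {y. nrm (c * y) \<le> 1}) * \<phi>0 (x / c))"
  unfolding weil_w2[OF indicator_ball_schwartz[OF assms]]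
  by (simp only: fourier_indicator_ball[OF haar unramified nrm_2 assms] mult.assoc)

lemma weil_w2_\<phi>0: "\<omega> (w2, 1) \<phi>0 = (\<lambda>x. \<kappa> * \<phi>0 x)"
  using weil_w2_ball[of 1] by (simp add: \<kappa>_def integers_def)

definition scalar_on_\<phi>0 :: "'a^2^2 \<Rightarrow> complex \<Rightarrow> bool" where
  "scalar_on_\<phi>0 k z \<longleftrightarrow> k \<in> SL2_int \<and> \<omega> (k, \<sigma> k) \<phi>0 = (\<lambda>x. z * \<phi>0 x)"

lemma scalar_mult:
  assumes "scalar_on_\<phi>0 k z" "scalar_on_\<phi>0 k' z'"
  shows "scalar_on_\<phi>0 (k ** k') (z * z')"
proof -
  have k: "k \<in> SL2_int" "k' \<in> SL2_int" "k ** k' \<in> SL2_int"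
    using assms by (simp_all add: scalar_on_\<phi>0_def SL2_int_mult)
  have Mp: "(k, \<sigma> k) \<in> Mp" "(k', \<sigma> k') \<in> Mp"
    using k sigma_values by (auto simp: Mp_iff SL2_int_subset)
  have "(k ** k', \<sigma> (k ** k')) = mp_mult (k, \<sigma> k) (k', \<sigma> k')"
    using k by (simp add: mp_mult_def sigma_mult)
  then have "\<omega> (k ** k', \<sigma> (k ** k')) \<phi>0 = \<omega> (k, \<sigma> k) (\<lambda>x. z' * \<phi>0 x)"
    using weil_mult[OF Mp indicator_integers_schwartz] assms by (simp add: scalar_on_\<phi>0_def)
  also have "\<dots> = (\<lambda>x. (z * z') * \<phi>0 x)"
    using weil_scale[OF Mp(1) indicator_integers_schwartz] assms by (simp add: scalar_on_\<phi>0_def mult_ac)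
  finally show ?thesis
    using k by (simp add: scalar_on_\<phi>0_def)
qed

lemma scalar_unique: "scalar_on_\<phi>0 k z \<Longrightarrow> scalar_on_\<phi>0 k z' \<Longrightarrow> z = z'"
  unfolding scalar_on_\<phi>0_def by (metis indicator_simps(1) integers_0 mult.right_neutral)

lemma scalar_one: "scalar_on_\<phi>0 (mat 1) 1"
  using weil_central[OF indicator_integers_schwartz, of 1] sigma_one
  by (simp add: scalar_on_\<phi>0_def mat2_one SL2_int_mat2)

lemma scalar_n:
  assumes "b \<in> integers"
  shows "scalar_on_\<phi>0 (n_SL2 b) 1"
proof -
  have *: "\<psi> (b * x^2) * \<phi>0 x = 1 * \<phi>0 x" for x
  proof (cases "x \<in> integers")
    case True
    then have "b * x^2 \<in> integers"
      using assms by (simp add: integers_mult power2_eq_square)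
    then show ?thesis
      using unramified by (simp add: unramified_additive_character_def)
  qed simp
  then show ?thesis
    using assms weil_n[OF indicator_integers_schwartz, of b] splitting_n[OF assms]
    by (simp add: scalar_on_\<phi>0_def SL2_int_mat2 n_mat2 *)
qed

lemma scalar_w2: "scalar_on_\<phi>0 w2 (of_int (\<sigma> w2) * \<kappa>)"
proof -
  have w: "w2 \<in> SL2_int"
    by (simp add: w2_mat2 SL2_int_mat2)
  then show ?thesis
    using weil_genuine[OF SL2_w2 sigma_values[OF w] indicator_integers_schwartz] weil_w2_\<phi>0
    by (simp add: scalar_on_\<phi>0_def mult_ac)
qed

text \<open>The line spanned by \<open>\<phi>0\<close> carries a character of \<open>SL2_int\<close> which is trivial on \<open>n_SL2 b\<close>,
  hence on the conjugates of these elements, and \<open>w2\<close> is a product of such elements.\<close>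

lemma \<kappa>_pow4: "(of_int (\<sigma> w2) * \<kappa>) ^ 4 = 1"
  and scalar_lower: "y \<in> integers \<Longrightarrow> scalar_on_\<phi>0 (mat2 1 0 y 1) 1"
proof -
  let ?\<kappa> = "of_int (\<sigma> w2) * \<kappa>"
  have w3: "scalar_on_\<phi>0 (w2 ** (w2 ** w2)) (?\<kappa> * (?\<kappa> * ?\<kappa>))"
    by (intro scalar_mult scalar_w2)
  have "w2 ** (w2 ** (w2 ** w2)) = (mat 1 :: 'a^2^2)"
    by (simp add: w2_mat2 mat2_one)
  then have "?\<kappa> * (?\<kappa> * (?\<kappa> * ?\<kappa>)) = 1"
    using scalar_unique[OF _ scalar_one] scalar_mult[OF scalar_w2 w3] by metis
  then show k4: "?\<kappa> ^ 4 = 1"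
    by (simp add: power4_eq_xxxx mult_ac)
  assume "y \<in> integers"
  then have "scalar_on_\<phi>0 (w2 ** (n_SL2 (- y) ** (w2 ** (w2 ** w2)))) (?\<kappa> * (1 * (?\<kappa> * (?\<kappa> * ?\<kappa>))))"
    by (intro scalar_mult scalar_w2 scalar_n) simp
  moreover have "w2 ** (n_SL2 (- y) ** (w2 ** (w2 ** w2))) = mat2 1 0 y 1"
    by (simp add: w2_mat2 n_mat2)
  moreover have "?\<kappa> * (1 * (?\<kappa> * (?\<kappa> * ?\<kappa>))) = 1"
    using k4 by (simp add: power4_eq_xxxx mult_ac)
  ultimately show "scalar_on_\<phi>0 (mat2 1 0 y 1) 1"
    by simp
qed

lemma \<kappa>_nonzero: "\<kappa> \<noteq> 0"
  using \<kappa>_pow4 by auto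

lemma scalar_antidiagonal:
  assumes "nrm p = 1"
  shows "scalar_on_\<phi>0 (mat2 0 (- inverse p) p 0) 1"
proof -
  let ?u = "- inverse p"
  have p: "p \<in> integers" "?u \<in> integers" "p \<noteq> 0"
    using assms by (auto simp: mem_integers nrm_inverse)
  have "scalar_on_\<phi>0 (n_SL2 ?u ** (mat2 1 0 p 1 ** n_SL2 ?u)) (1 * (1 * 1))"
    by (intro scalar_mult scalar_n scalar_lower p)
  then show ?thesis
    using p by (simp add: n_mat2)
qed

text \<open>Bruhat decomposition over the integers. If the lower left entry is a unit,
  \<open>k\<close> is unipotent times antidiagonal times unipotent. If not, determinant 1 makes the
  upper left entry a unit, and left multiplication by antidiagonal matrices reduces to that
  case.\<close>

lemma weil_fixes_\<phi>0:
  assumes "k \<in> SL2_int"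
  shows "\<omega> (k, \<sigma> k) \<phi>0 = \<phi>0"
proof -
  have unit_case: "scalar_on_\<phi>0 (mat2 a b c d) 1" if "mat2 a b c d \<in> SL2_int" "nrm c = 1" for a b c d :: 'a
  proof -
    have abcd: "a * d - b * c = 1" "a \<in> integers" "d \<in> integers" "c \<noteq> 0"
      using that by (auto simp: SL2_int_mat2)
    have int: "a * inverse c \<in> integers" "d * inverse c \<in> integers"
      using abcd integers_inverse[OF that(2)] by (simp_all add: integers_mult)
    have "scalar_on_\<phi>0 (n_SL2 (a * inverse c) ** (mat2 0 (- inverse c) c 0 ** n_SL2 (d * inverse c))) (1 * (1 * 1))"
      using int that(2) by (intro scalar_mult scalar_n scalar_antidiagonal)
    moreover have "a * d = 1 + b * c"
      using abcd by (simp add: algebra_simps)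
    then have "n_SL2 (a * inverse c) ** (mat2 0 (- inverse c) c 0 ** n_SL2 (d * inverse c)) = mat2 a b c d"
      using abcd(4) by (simp add: n_mat2 field_simps)
    ultimately show ?thesis
      by simp
  qed
  obtain a b c d where k: "k = mat2 a b c d"
    by (rule mat2_cases)
  with assms have abcd: "a * d - b * c = 1" "a \<in> integers" "b \<in> integers" "c \<in> integers" "d \<in> integers"
    by (auto simp: SL2_int_mat2)
  have "scalar_on_\<phi>0 k 1"
  proof (cases "nrm c = 1")
    case True
    then show ?thesis
      using unit_case assms k by simp
  next
    case False
    have "nrm a = 1"
    proof (rule ccontr)
      assume "nrm a \<noteq> 1"
      then have "nrm (a * d) < 1" "nrm (b * c) < 1"
        using False abcd unfolding nrm_mult mem_integers
        by (metis le_less_trans mult_left_le nrm_nonneg order_le_less mult.commute)+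
      then have "nrm (a * d - b * c) < 1"
        by (rule nrm_diff_less)
      then show False
        using abcd by simp
    qed
    then have "scalar_on_\<phi>0 (mat2 (- c) (- d) a b) 1"
      using unit_case[of "- c" "- d" a b] abcd by (simp add: SL2_int_mat2 algebra_simps)
    then have "scalar_on_\<phi>0 (mat2 0 (- inverse 1) 1 0 ** (mat2 (-1) 0 0 (-1) ** mat2 (- c) (- d) a b)) (1 * (1 * 1))"
    proof (intro scalar_mult scalar_antidiagonal)
      have "scalar_on_\<phi>0 (mat2 0 (- inverse 1) 1 0 ** mat2 0 (- inverse 1) 1 0) (1 * 1)"
        by (intro scalar_mult scalar_antidiagonal) simp_all
      then show "scalar_on_\<phi>0 (mat2 (-1) 0 0 (-1)) 1"
        by simp
    qed simp_all
    then show ?thesis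
      by (simp add: k)
  qed
  then show ?thesis
    by (simp add: scalar_on_\<phi>0_def)
qed

lemma \<mu>_unit:
  assumes "nrm u = 1"
  shows "of_int (\<sigma> (t_SL2 u)) * \<mu> u = 1" and "\<mu> u ^ 2 = 1"
proof -
  have u: "u \<noteq> 0" "t_SL2 u \<in> SL2_int"
    using assms integers_inverse[OF assms]
    by (cases "u = 0"; simp add: t_mat2 SL2_int_mat2 mem_integers)+
  have "\<phi>0 0 = of_int (\<sigma> (t_SL2 u)) * (of_real (sqrt (nrm u)) * \<mu> u * \<phi>0 (u * 0))"
    using weil_fixes_\<phi>0[OF u(2)] weil_genuine[OF SL2_t[OF u(1)] sigma_values[OF u(2)] indicator_integers_schwartz]
      weil_t[OF indicator_integers_schwartz u(1)] by metis
  then show *: "of_int (\<sigma> (t_SL2 u)) * \<mu> u = 1"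
    using assms by simp
  moreover have "of_int (\<sigma> (t_SL2 u)) ^ 2 = (1::complex)"
    using sigma_values[OF u(2)] by auto
  ultimately show "\<mu> u ^ 2 = 1"
    by (metis mult.left_neutral one_power2 power_mult_distrib)
qed

text \<open>Evaluation at 0, which every dilation fixes, isolates the scalar by which the torus
  acts, so the group law of the cover becomes a relation between values of \<mu>.\<close>

lemma \<mu>_mult_aux:
  assumes "a \<noteq> 0" "b \<noteq> 0"
  shows "\<omega> (t_SL2 (a * b), 1) \<phi>0 0 * of_int (cocycle (t_SL2 a) (t_SL2 b)) =
    of_real (sqrt (nrm a) * sqrt (nrm b)) * (\<mu> a * \<mu> b)"
proof -
  have Mp: "(t_SL2 a, 1) \<in> Mp" "(t_SL2 b, 1) \<in> Mp"
    using assms by (simp_all add: Mp_iff SL2_t)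
  have tt: "t_SL2 a ** t_SL2 b = t_SL2 (a * b)"
    by (simp add: t_mat2)
  have "\<omega> (mp_mult (t_SL2 a, 1) (t_SL2 b, 1)) \<phi>0 0 = \<omega> (t_SL2 a, 1) (\<lambda>x. of_real (sqrt (nrm b)) * \<mu> b * \<phi>0 (b * x)) 0"
    using weil_mult[OF Mp indicator_integers_schwartz] weil_t[OF indicator_integers_schwartz assms(2)] by simp
  also have "\<dots> = of_real (sqrt (nrm b)) * \<mu> b * \<omega> (t_SL2 a, 1) (\<lambda>x. \<phi>0 (b * x)) 0"
    using weil_scale[OF Mp(1) indicator_ball_schwartz[OF assms(2)]] by simp
  also have "\<dots> = of_real (sqrt (nrm a) * sqrt (nrm b)) * (\<mu> a * \<mu> b)"
    using weil_t[OF indicator_ball_schwartz[OF assms(2)] assms(1)] by simp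
  finally have "\<omega> (t_SL2 (a * b), cocycle (t_SL2 a) (t_SL2 b)) \<phi>0 0 =
      of_real (sqrt (nrm a) * sqrt (nrm b)) * (\<mu> a * \<mu> b)"
    by (simp add: mp_mult_def tt)
  then show ?thesis
    using weil_genuine[OF SL2_t cocycle_values indicator_integers_schwartz, of "a * b" "t_SL2 a" "t_SL2 b"] assms
    by (simp add: mult.commute[of "of_int _"])
qed

text \<open>Squaring removes the sign of the cocycle.\<close>

lemma \<mu>_mult_square:
  assumes "a \<noteq> 0" "b \<noteq> 0"
  shows "\<mu> (a * b) ^ 2 = \<mu> a ^ 2 * \<mu> b ^ 2"
proof -
  let ?c = "of_int (cocycle (t_SL2 a) (t_SL2 b)) :: complex"
  have "of_real (sqrt (nrm a) * sqrt (nrm b)) * (\<mu> (a * b) * ?c) =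
      of_real (sqrt (nrm a) * sqrt (nrm b)) * (\<mu> a * \<mu> b)"
    using \<mu>_mult_aux[OF assms] weil_t[OF indicator_integers_schwartz, of "a * b"] assms
    by (simp add: nrm_mult real_sqrt_mult mult_ac)
  then have "\<mu> (a * b) * ?c = \<mu> a * \<mu> b"
    using assms by simp
  moreover have "?c^2 = 1"
    using cocycle_values[of "t_SL2 a" "t_SL2 b"] by auto
  ultimately show ?thesis
    by (metis mult.right_neutral power_mult_distrib)
qed

lemma \<mu>_inverse:
  assumes "a \<noteq> 0"
  shows "\<mu> a * \<mu> (inverse a) = chi a"
proof -
  have "cocycle (t_SL2 a) (t_SL2 (inverse a)) = hilbert_symbol a (-1)"
    using assms hilbert_symbol_self[OF assms] by (simp add: cocycle_def t_mat2)
  moreover have "t_SL2 (a * inverse a) = mat 1"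
    using assms by (simp add: t_mat2 mat2_one)
  moreover have "\<omega> (mat 1, 1) \<phi>0 0 = 1"
    using weil_central[OF indicator_integers_schwartz, of 1] by simp
  moreover have "sqrt (nrm a) * sqrt (nrm (inverse a)) = 1"
    using assms by (simp add: nrm_inverse flip: real_sqrt_mult)
  ultimately show ?thesis
    using \<mu>_mult_aux[of a "inverse a"] assms by (simp add: chi_def del: real_sqrt_inverse)
qed

text \<open>Moving \<open>w2\<close> past \<open>t_SL2 unif\<close> inverts the torus element, and
  the cocycles on the two sides coincide. Acting on \<open>\<phi>0\<close> and evaluating at 0, the
  larger ball contributes \<open>q\<close>, which turns the square root of \<open>nrm unif\<close>
  into its inverse.\<close>

lemma \<mu>_unif: "\<mu> unif = \<mu> (inverse unif)"
proof -
  let ?a = unif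
  have a: "?a \<noteq> 0" "inverse ?a \<noteq> 0" by simp_all
  have Mp: "(t_SL2 ?a, 1) \<in> Mp" "(t_SL2 (inverse ?a), 1) \<in> Mp" "(w2, 1) \<in> Mp"
    by (simp_all add: Mp_iff SL2_t SL2_w2)
  have "mp_mult (w2, 1) (t_SL2 ?a, 1) = mp_mult (t_SL2 (inverse ?a), 1) (w2, 1)"
    by (simp add: mp_mult_def cocycle_def w2_mat2 t_mat2 hilbert_symbol_commute)
  then have "\<omega> (w2, 1) (\<omega> (t_SL2 ?a, 1) \<phi>0) 0 = \<omega> (t_SL2 (inverse ?a), 1) (\<omega> (w2, 1) \<phi>0) 0"
    using weil_mult Mp indicator_integers_schwartz by metis
  moreover have "\<omega> (w2, 1) (\<omega> (t_SL2 ?a, 1) \<phi>0) 0 =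
      of_real (sqrt (nrm ?a)) * \<mu> ?a * (weil_index \<psi> * of_real (real q * measure haar integers))"
    unfolding weil_t[OF indicator_integers_schwartz a(1)]
      weil_scale[OF Mp(3) indicator_ball_schwartz[OF a(1)]] weil_w2_ball[OF a(1)]
      haar_unif_ball[OF haar] by simp
  moreover have "\<omega> (t_SL2 (inverse ?a), 1) (\<omega> (w2, 1) \<phi>0) 0 =
      \<kappa> * (of_real (sqrt (nrm (inverse ?a))) * \<mu> (inverse ?a))"
    unfolding weil_w2_\<phi>0 weil_scale[OF Mp(2) indicator_integers_schwartz]
      weil_t[OF indicator_integers_schwartz a(2)] by simp
  ultimately have "\<kappa> * (of_real (sqrt (nrm ?a) * real q) * \<mu> ?a) =
      \<kappa> * (of_real (sqrt (nrm (inverse ?a))) * \<mu> (inverse ?a))"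
    by (simp add: \<kappa>_def mult_ac)
  moreover have "sqrt (nrm ?a) * real q = sqrt (nrm (inverse ?a))"
    using q_pos by (simp add: nrm_unif nrm_inverse real_sqrt_divide real_div_sqrt del: q_pos)
  moreover have "sqrt (nrm (inverse ?a)) \<noteq> 0"
    by simp
  ultimately show ?thesis
    using \<kappa>_nonzero by simp
qed

lemma chi_unif_square: "chi unif ^ 2 = (1::complex)"
  using hilbert_symbol_values[of unif "-1"] by (auto simp: chi_def)

lemma \<mu>_square:
  assumes "nrm u = 1"
  shows "\<mu> (unif ^ n * u) ^ 2 = chi unif ^ n"
proof (induction n)
  case 0
  then show ?case
    using \<mu>_unit(2)[OF assms] by simp
next
  case (Suc n)
  have "\<mu> unif ^ 2 = chi unif"
    using \<mu>_inverse[OF unif_nz] \<mu>_unif by (simp add: power2_eq_square)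
  moreover have "unif ^ n * u \<noteq> 0"
    using assms by auto
  ultimately show ?case
    using Suc \<mu>_mult_square[of unif "unif ^ n * u"] by (simp add: mult.assoc)
qed

end

section \<open>The unramified section of the induced representation\<close>

locale metaplectic_section = weil_splitting unif \<sigma> \<psi> \<omega>
  for unif :: "'a::nonarch_local_field" and \<sigma> \<psi> \<omega> +
  fixes f :: "('a^2^2) \<times> int \<Rightarrow> complex" and s :: complex and \<eta> :: "'a \<Rightarrow> complex"
  assumes section_space: "f \<in> induced_space s \<eta> \<psi>"
    and section_one: "k \<in> SL2_int \<Longrightarrow> f (k, \<sigma> k) = 1"
begin

lemma section_t:
  assumes "a \<noteq> 0" "\<zeta> = 1 \<or> \<zeta> = -1" "g \<in> Mp"
  shows "f (mp_mult (t_SL2 a, \<zeta>) g) = of_int \<zeta> * \<mu> a * \<eta> a * of_real (nrm a) powr (s + 1/2) * f g"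
  using section_space assms unfolding induced_space_def by blast

text \<open>For a unit \<open>u\<close> the split lift of \<open>t_SL2 u\<close> acts by
  \<open>\<mu> u * \<eta> u\<close> up to sign. The section forces this to be 1, while
  \<open>\<mu>_unit\<close> already gives 1 for the part without \<eta>.\<close>

lemma eta_unit:
  assumes "nrm u = 1"
  shows "\<eta> u = 1"
proof -
  have u: "u \<noteq> 0" "t_SL2 u \<in> SL2_int"
    using assms integers_inverse[OF assms]
    by (cases "u = 0"; simp add: t_mat2 SL2_int_mat2 mem_integers)+
  have one: "mat 1 \<in> (SL2_int :: ('a^2^2) set)"
    by (simp add: mat2_one SL2_int_mat2)
  have "mp_mult (t_SL2 u, \<sigma> (t_SL2 u)) (mat 1, \<sigma> (mat 1)) = (t_SL2 u, \<sigma> (t_SL2 u))"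
    using splitting u(2) one unfolding splitting_def by (metis matrix_mul_rid)
  then have "1 = of_int (\<sigma> (t_SL2 u)) * \<mu> u * \<eta> u * of_real (nrm u) powr (s + 1/2) * 1"
    using section_t[OF u(1) sigma_values[OF u(2)], of "(mat 1, \<sigma> (mat 1))"] section_one[OF u(2)]
      section_one[OF one] u one sigma_one
    by (simp add: Mp_iff SL2_one)
  then show ?thesis
    using \<mu>_unit(1)[OF assms] assms by simp
qed

text \<open>The lift \<open>(h, 1)\<close> is a product of lifts of \<open>t_SL2 a\<close> and
  \<open>k\<close> only after a sign correction \<zeta>. It enters both genuine factors and squares
  to 1. The exponents \<open>1/2\<close> and \<open>s + 1/2\<close> add up to
  \<open>s + 1\<close>.\<close>

lemma weil_times_section:
  assumes "a \<noteq> 0" "k \<in> SL2_int"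
  shows "\<omega> (t_SL2 a ** k, 1) \<phi>0 1 * f (t_SL2 a ** k, 1) =
    \<phi>0 a * \<mu> a ^ 2 * \<eta> a * of_real (nrm a) powr (s + 1)"
proof -
  define \<zeta> where "\<zeta> = cocycle (t_SL2 a) k * \<sigma> k"
  have \<zeta>: "\<zeta> = 1 \<or> \<zeta> = -1"
    using cocycle_values[of "t_SL2 a" k] sigma_values[OF assms(2)] by (auto simp: \<zeta>_def)
  have \<zeta>2: "\<zeta> * \<zeta> = 1"
    using \<zeta> by auto
  have "\<zeta> * \<sigma> k * cocycle (t_SL2 a) k = \<zeta> * \<zeta>"
    by (simp add: \<zeta>_def)
  then have eq: "(t_SL2 a ** k, 1) = mp_mult (t_SL2 a, \<zeta>) (k, \<sigma> k)"
    using \<zeta>2 by (simp add: mp_mult_def)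
  have Mp: "(t_SL2 a, \<zeta>) \<in> Mp" "(k, \<sigma> k) \<in> Mp"
    using \<zeta> assms sigma_values by (auto simp: Mp_iff SL2_t SL2_int_subset)
  have "\<omega> (t_SL2 a ** k, 1) \<phi>0 = \<omega> (t_SL2 a, \<zeta>) \<phi>0"
    using weil_mult[OF Mp indicator_integers_schwartz] weil_fixes_\<phi>0[OF assms(2)] by (simp add: eq)
  also have "\<dots> = (\<lambda>x. of_int \<zeta> * (of_real (sqrt (nrm a)) * \<mu> a * \<phi>0 (a * x)))"
    using weil_genuine[OF SL2_t[OF assms(1)] \<zeta> indicator_integers_schwartz]
      weil_t[OF indicator_integers_schwartz assms(1)] by simp
  finally have w: "\<omega> (t_SL2 a ** k, 1) \<phi>0 1 = of_int \<zeta> * (of_real (sqrt (nrm a)) * \<mu> a * \<phi>0 a)"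
    by simp
  have f: "f (t_SL2 a ** k, 1) = of_int \<zeta> * \<mu> a * \<eta> a * of_real (nrm a) powr (s + 1/2)"
    unfolding eq using section_t[OF assms(1) \<zeta> Mp(2)] section_one[OF assms(2)] by simp
  have "of_real (sqrt (nrm a)) = (of_real (nrm a) :: complex) powr (1/2)"
    using powr_of_real[of "nrm a" "1/2"] by (simp add: powr_half_sqrt)
  then have p: "of_real (sqrt (nrm a)) * of_real (nrm a) powr (s + 1/2) = (of_real (nrm a) :: complex) powr (s + 1)"
    by (simp add: add.commute flip: powr_add)
  have "\<omega> (t_SL2 a ** k, 1) \<phi>0 1 * f (t_SL2 a ** k, 1) = of_int (\<zeta> * \<zeta>) * \<phi>0 a * \<mu> a ^ 2 * \<eta> a *
      (of_real (sqrt (nrm a)) * of_real (nrm a) powr (s + 1/2))"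
    unfolding w f by (simp add: power2_eq_square mult_ac)
  then show ?thesis
    unfolding p \<zeta>2 by simp
qed

end

section \<open>Matrices in \<open>SO\<^sub>4\<close>\<close>

lemma det_4:
  "det (A::'a::comm_ring_1^4^4) =
    A$1$1 * (A$2$2 * (A$3$3 * A$4$4 - A$3$4 * A$4$3) - A$2$3 * (A$3$2 * A$4$4 - A$3$4 * A$4$2)
      + A$2$4 * (A$3$2 * A$4$3 - A$3$3 * A$4$2))
  - A$1$2 * (A$2$1 * (A$3$3 * A$4$4 - A$3$4 * A$4$3) - A$2$3 * (A$3$1 * A$4$4 - A$3$4 * A$4$1)
      + A$2$4 * (A$3$1 * A$4$3 - A$3$3 * A$4$1))
  + A$1$3 * (A$2$1 * (A$3$2 * A$4$4 - A$3$4 * A$4$2) - A$2$2 * (A$3$1 * A$4$4 - A$3$4 * A$4$1)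
      + A$2$4 * (A$3$1 * A$4$2 - A$3$2 * A$4$1))
  - A$1$4 * (A$2$1 * (A$3$2 * A$4$3 - A$3$3 * A$4$2) - A$2$2 * (A$3$1 * A$4$3 - A$3$3 * A$4$1)
      + A$2$3 * (A$3$1 * A$4$2 - A$3$2 * A$4$1))"
proof -
  have f1234: "finite {2::4, 3, 4}" "1 \<notin> {2::4, 3, 4}" and f234: "finite {3::4, 4}" "2 \<notin> {3::4, 4}"
    and f34: "finite {4::4}" "3 \<notin> {4::4}"
    by auto
  show ?thesis
    unfolding det_def UNIV_4
    unfolding sum_over_permutations_insert[OF f1234]
    unfolding sum_over_permutations_insert[OF f234]
    unfolding sum_over_permutations_insert[OF f34]
    unfolding permutes_sing
    by (simp add: sign_swap_id permutation_swap_id permutation_compose sign_compose sign_id swap_id_eq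
        algebra_simps)
qed

lemmas mat4_simps = vec_eq_iff forall_4 matrix_matrix_mult_def sum_4 transpose_def

lemma J4_J4: "(J4 ** J4 :: 'a::field^4^4) = mat 1"
  by (simp add: J4_def mat4_simps mat_def)

lemma SO4_mult: "g \<in> SO4 \<Longrightarrow> h \<in> SO4 \<Longrightarrow> g ** h \<in> SO4"
proof -
  assume g: "g \<in> SO4" and h: "h \<in> SO4"
  have "transpose (g ** h) ** J4 ** (g ** h) = transpose h ** (transpose g ** J4 ** g) ** h"
    by (simp add: matrix_transpose_mul matrix_mul_assoc)
  then show ?thesis
    using g h by (simp add: SO4_def det_mul)
qed

lemma SO4_one [simp]: "mat 1 \<in> SO4"
  by (simp add: SO4_def)

text \<open>The inverse dictated by the form \<open>J4\<close>; the explicit formula makes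
  integrality of its entries evident.\<close>

definition SO4_inv :: "'a::field^4^4 \<Rightarrow> 'a^4^4" where
  "SO4_inv g = J4 ** transpose g ** J4"

lemma SO4_inv_left: "g \<in> SO4 \<Longrightarrow> SO4_inv g ** g = mat 1"
  by (simp add: SO4_inv_def SO4_def J4_J4 flip: matrix_mul_assoc)

lemma SO4_inv_right: "g \<in> SO4 \<Longrightarrow> g ** SO4_inv g = mat 1"
  using SO4_inv_left matrix_left_right_inverse by blast

lemma det_J4_square: "det (J4 :: 'a::field^4^4) * det (J4 :: 'a^4^4) = 1"
  by (simp flip: det_mul add: J4_J4)

lemma SO4_row_form: "g \<in> SO4 \<Longrightarrow> g ** J4 ** transpose g = J4"
proof -
  assume "g \<in> SO4"
  then have "g ** (J4 ** transpose g ** J4) ** J4 = J4"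
    using SO4_inv_right[of g] by (simp add: SO4_inv_def)
  then show ?thesis
    by (simp add: J4_J4 flip: matrix_mul_assoc)
qed

lemma SO4_inv_mem: "g \<in> SO4 \<Longrightarrow> SO4_inv g \<in> SO4"
proof -
  assume g: "g \<in> SO4"
  have "transpose (SO4_inv g) ** J4 ** SO4_inv g = (transpose J4 ** g ** transpose J4) ** J4 ** (J4 ** transpose g ** J4)"
    by (simp add: SO4_inv_def matrix_transpose_mul matrix_mul_assoc)
  also have "transpose J4 = (J4 :: 'a^4^4)"
    by (simp add: J4_def mat4_simps)
  also have "(J4 ** g ** J4) ** J4 ** (J4 ** transpose g ** J4) = J4 ** (g ** (J4 ** J4) ** J4 ** transpose g) ** J4"
    by (simp add: matrix_mul_assoc)
  also have "\<dots> = J4"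
    using SO4_row_form[OF g] by (simp add: J4_J4 matrix_mul_assoc)
  finally have "transpose (SO4_inv g) ** J4 ** SO4_inv g = J4" .
  moreover have "det (SO4_inv g) = 1"
    using g det_J4_square[where 'a = 'a] by (simp add: SO4_inv_def det_mul SO4_def)
  ultimately show ?thesis
    by (simp add: SO4_def)
qed

lemma SO4_mult_cancel: "g ** h \<in> SO4 \<Longrightarrow> h \<in> SO4 \<Longrightarrow> g \<in> SO4"
  using SO4_mult[of "g ** h" "SO4_inv h"] by (simp add: SO4_inv_mem SO4_inv_right flip: matrix_mul_assoc)

lemma SO4_int_mult: "g \<in> SO4_int \<Longrightarrow> h \<in> SO4_int \<Longrightarrow> g ** h \<in> SO4_int"
  unfolding SO4_int_def mem_Collect_eq
  by (intro conjI SO4_mult allI) (auto simp: matrix_matrix_mult_def sum_4 intro!: integers_add integers_mult)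

lemma SO4_int_inv: "g \<in> SO4_int \<Longrightarrow> SO4_inv g \<in> SO4_int"
  unfolding SO4_int_def mem_Collect_eq forall_4
  by (intro conjI SO4_inv_mem)
    (simp_all add: SO4_inv_def J4_def matrix_matrix_mult_def sum_4 transpose_def)

lemma SO4_int_subset: "g \<in> SO4_int \<Longrightarrow> g \<in> SO4"
  by (simp add: SO4_int_def)

lemma torus4_SO4: "a \<noteq> 0 \<Longrightarrow> b \<noteq> 0 \<Longrightarrow> torus4 a b \<in> SO4"
  by (simp add: SO4_def det_4 torus4_def J4_def mat4_simps field_simps)

lemma u_elt_mat: "u_elt x y = vector [vector [1, x, y, - (x * y)], vector [0, 1, 0, - y],
    vector [0, 0, 1, - x], vector [0, 0, 0, 1]]"
  by (simp add: u_elt_def x_alpha_def x_beta_def mat4_simps)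

lemma u_elt_SO4: "u_elt x y \<in> SO4"
  by (simp add: SO4_def det_4 u_elt_mat J4_def mat4_simps)

lemma matrix_inv_mat2:
  fixes a b c d :: "'a::field"
  assumes "a * d - b * c \<noteq> 0"
  defines "D \<equiv> a * d - b * c"
  shows "matrix_inv (mat2 a b c d) = mat2 (d / D) (- b / D) (- c / D) (a / D)"
proof -
  let ?A = "mat2 a b c d" and ?B = "mat2 (d / D) (- b / D) (- c / D) (a / D)"
  have D: "D \<noteq> 0"
    using assms by simp
  have AB: "?A ** ?B = mat 1" "?B ** ?A = mat 1"
    using D by (simp_all add: mat2_one field_simps) (simp_all add: D_def field_simps)
  then have "?A ** matrix_inv ?A = mat 1 \<and> matrix_inv ?A ** ?A = mat 1"
    unfolding matrix_inv_def by (intro someI_ex[where P = "\<lambda>A'. ?A ** A' = mat 1 \<and> A' ** ?A = mat 1"]) blast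
  then have "matrix_inv ?A = matrix_inv ?A ** (?A ** ?B)"
    by (simp only: AB matrix_mul_rid)
  also have "\<dots> = ?B"
    using \<open>?A ** matrix_inv ?A = mat 1 \<and> matrix_inv ?A ** ?A = mat 1\<close>
    by (simp only: matrix_mul_assoc matrix_mul_lid)
  finally show ?thesis .
qed

section \<open>The two commuting copies of SL2\<close>

lemma m_levi_mat2:
  fixes a b c d :: "'a::field"
  assumes "a * d - b * c = D" "D \<noteq> 0"
  shows "m_levi (mat2 a b c d) = vector [vector [a, b, 0, 0], vector [c, d, 0, 0],
    vector [0, 0, a / D, - b / D], vector [0, 0, - c / D, d / D]]"
proof -
  have "levi_star (mat2 a b c d) = mat2 (a / D) (- b / D) (- c / D) (d / D)"
  proof -
    have T: "transpose (mat2 p r s t) = mat2 p s r t" for p r s t :: 'a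
      by (simp add: mat2_eq_iff transpose_def)
    have J: "J2 = mat2 0 1 1 (0::'a)"
      by (simp add: J2_def mat2_def)
    show ?thesis
      using assms by (simp add: levi_star_def matrix_inv_mat2 T J)
  qed
  then show ?thesis
    by (simp add: m_levi_def)
qed

lemma m_levi_mult:
  assumes "det g \<noteq> 0" "det h \<noteq> 0"
  shows "m_levi (g ** h) = m_levi g ** m_levi h"
proof -
  obtain a b c d a' b' c' d' where gh: "g = mat2 a b c d" "h = mat2 a' b' c' d'"
    by (metis mat2_cases)
  define D D' where "D = a * d - b * c" and "D' = a' * d' - b' * c'"
  have nz: "D \<noteq> 0" "D' \<noteq> 0"
    using assms by (simp_all add: gh D_def D'_def)
  have DD: "(a * a' + b * c') * (c * b' + d * d') - (a * b' + b * d') * (c * a' + d * c') = D * D'"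
    by (simp add: D_def D'_def algebra_simps)
  show ?thesis
    unfolding gh mat2_mult m_levi_mat2[OF D_def[symmetric] nz(1)] m_levi_mat2[OF D'_def[symmetric] nz(2)]
      m_levi_mat2[OF DD no_zero_divisors[OF nz]]
    using nz by (simp add: mat4_simps add_divide_distrib diff_divide_distrib)
qed

lemma m_levi_SO4: "det h \<noteq> 0 \<Longrightarrow> m_levi h \<in> SO4"
proof (cases h rule: mat2_cases)
  case (1 a b c d)
  assume "det h \<noteq> 0"
  define D where "D = a * d - b * c"
  have D: "D \<noteq> 0"
    using \<open>det h \<noteq> 0\<close> 1 by (simp add: D_def)
  have ad: "a * d = D + b * c"
    by (simp add: D_def)
  show ?thesis
    unfolding 1 m_levi_mat2[OF D_def[symmetric] D]
    using D ad by (simp add: SO4_def det_4 J4_def mat4_simps field_simps)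
qed

lemma m_levi_n: "m_levi (n_SL2 x) = u_elt x 0"
  unfolding n_mat2 by (subst m_levi_mat2[where D = 1]) (simp_all add: u_elt_mat)

lemma m_levi_t: "c \<noteq> 0 \<Longrightarrow> m_levi (t_SL2 c) = torus4 c (inverse c)"
  unfolding t_mat2 by (subst m_levi_mat2[where D = 1]) (simp_all add: torus4_def)

text \<open>The SL2 attached to the second simple root: its upper unipotents are the
  \<open>x_beta y\<close>. Together with \<open>m_levi\<close> on SL2 it realizes the isogeny from
  SL2 x SL2 to SO4.\<close>

definition m_beta :: "'a::field^2^2 \<Rightarrow> 'a^4^4" where
  "m_beta h = vector [vector [h$1$1, 0, h$1$2, 0], vector [0, h$1$1, 0, - (h$1$2)],
                      vector [h$2$1, 0, h$2$2, 0], vector [0, - (h$2$1), 0, h$2$2]]"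

lemma m_beta_commute: "g \<in> SL2 \<Longrightarrow> m_levi g ** m_beta h = m_beta h ** m_levi g"
proof (cases g rule: mat2_cases)
  case (1 a b c d)
  assume "g \<in> SL2"
  then have "a * d - b * c = 1"
    by (simp add: 1 SL2_mat2)
  then show ?thesis
    unfolding 1 by (simp add: m_levi_mat2[where D = 1] m_beta_def mat4_simps mult.commute)
qed

lemma m_beta_mult: "m_beta (g ** h) = m_beta g ** m_beta h"
  by (simp add: m_beta_def mat4_simps sum_2)

lemma m_beta_SO4: "h \<in> SL2 \<Longrightarrow> m_beta h \<in> SO4"
proof (cases h rule: mat2_cases)
  case (1 a b c d)
  assume "h \<in> SL2"
  then have D: "a * d - b * c = 1"
    by (simp add: 1 SL2_mat2)
  have "det (m_beta (mat2 a b c d)) = (a * d - b * c) * (a * d - b * c)"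
    by (simp add: det_4 m_beta_def algebra_simps)
  moreover have "a * d = b * c + 1" "d * a = c * b + 1"
    using D by (simp_all add: algebra_simps)
  then have "transpose (m_beta (mat2 a b c d)) ** J4 ** m_beta (mat2 a b c d) = J4"
    by (simp add: J4_def m_beta_def mat4_simps mult.commute)
  ultimately show ?thesis
    by (simp add: SO4_def 1 D)
qed

lemma m_beta_SO4_int: "h \<in> SL2_int \<Longrightarrow> m_beta h \<in> SO4_int"
  using m_beta_SO4[of h] by (simp add: SO4_int_def SL2_int_def forall_4 forall_2) (simp add: m_beta_def)

definition GL2_int :: "('a::nonarch_local_field^2^2) set" where
  "GL2_int = {h. nrm (det h) = 1 \<and> (\<forall>i j. h $ i $ j \<in> integers)}"

lemma GL2_int_mat2: "mat2 a b c d \<in> GL2_int \<longleftrightarrow>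
    nrm (a * d - b * c) = 1 \<and> a \<in> integers \<and> b \<in> integers \<and> c \<in> integers \<and> d \<in> integers"
  by (auto simp: GL2_int_def forall_2)

lemma SL2_int_GL2_int: "h \<in> SL2_int \<Longrightarrow> h \<in> GL2_int"
  by (simp add: GL2_int_def SL2_int_def SL2_def)

lemma GL2_int_det: "h \<in> GL2_int \<Longrightarrow> det h \<noteq> 0"
  by (auto simp: GL2_int_def)

lemma GL2_int_one: "mat 1 \<in> GL2_int"
  by (simp add: mat2_one GL2_int_mat2)

lemma GL2_int_mult: "g \<in> GL2_int \<Longrightarrow> h \<in> GL2_int \<Longrightarrow> g ** h \<in> GL2_int"
  unfolding GL2_int_def mem_Collect_eq det_mul nrm_mult
  by (intro conjI allI) (simp_all add: matrix_matrix_mult_def sum_2 integers_add integers_mult)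

lemma GL2_int_inverse:
  assumes "k \<in> GL2_int"
  shows "\<exists>k'\<in>GL2_int. k ** k' = mat 1 \<and> k' ** k = mat 1"
proof -
  obtain a b c d where k: "k = mat2 a b c d"
    by (rule mat2_cases)
  define D where "D = a * d - b * c"
  have D: "nrm D = 1" "D \<noteq> 0"
    using assms by (auto simp: k GL2_int_mat2 D_def)
  have int: "x / D \<in> integers \<longleftrightarrow> x \<in> integers" for x
    using D by (simp add: mem_integers nrm_divide)
  have ad: "a * d = D + b * c"
    by (simp add: D_def)
  let ?k' = "mat2 (d / D) (- b / D) (- c / D) (a / D)"
  have "k ** ?k' = mat 1 \<and> ?k' ** k = mat 1"
    using D ad by (simp add: k mat2_one field_simps)
  moreover from this have "det k * det ?k' = 1"
    by (metis det_I det_mul)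
  then have "nrm (det k) * nrm (det ?k') = 1"
    by (metis nrm_mult nrm_one)
  then have "nrm (det ?k') = 1"
    using assms by (simp only: GL2_int_def mem_Collect_eq mult_1_left)
  then have "?k' \<in> GL2_int"
    using assms int[of d] int[of a] int[of "- b"] int[of "- c"] by (simp add: k GL2_int_mat2)
  ultimately show ?thesis
    by blast
qed

lemma m_levi_SO4_int: "h \<in> GL2_int \<Longrightarrow> m_levi h \<in> SO4_int"
proof (cases h rule: mat2_cases)
  case (1 a b c d)
  assume h: "h \<in> GL2_int"
  define D where "D = a * d - b * c"
  have D: "nrm D = 1" "D \<noteq> 0"
    using h by (auto simp: 1 GL2_int_mat2 D_def)
  have "x / D \<in> integers \<longleftrightarrow> x \<in> integers" for x
    using D by (simp add: mem_integers nrm_divide)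
  then show ?thesis
    using m_levi_SO4[OF GL2_int_det[OF h]] h
    unfolding 1 m_levi_mat2[OF D_def[symmetric] D(2)] by (simp add: SO4_int_def forall_4 GL2_int_mat2)
qed

text \<open>Divide by the entry of larger absolute value; the quotient is integral.\<close>

lemma ex_SL2_int_annihilates:
  fixes p r :: "'a::nonarch_local_field"
  obtains a b c d where "mat2 a b c d \<in> SL2_int" "p * a + r * c = 0"
proof (cases "nrm p \<le> nrm r")
  case True
  show ?thesis
  proof (cases "r = 0")
    case r: True
    with True have "p = 0" by simp
    then show ?thesis
      using that[of 1 0 0 1] r by (simp add: SL2_int_mat2)
  next
    case False
    then show ?thesis
      using that[of 1 0 "- p / r" 1] True by (simp add: SL2_int_mat2 mem_integers nrm_divide)
  qed
next
  case False
  then have "p \<noteq> 0"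
    by auto
  then show ?thesis
    using that[of "- r / p" "-1" 1 0] False by (simp add: SL2_int_mat2 mem_integers nrm_divide)
qed

text \<open>The form clears the first column below its top entry and leaves a middle block
  preserving a hyperbolic plane, hence diagonal or antidiagonal. Determinant 1 excludes the
  antidiagonal case, and the remaining relations express the last column through \<open>x\<close>
  and \<open>y\<close>.\<close>

lemma SO4_borel:
  fixes g :: "'a::field^4^4"
  assumes g: "g \<in> SO4" and two: "(2::'a) \<noteq> 0"
    and row: "g$4$1 = 0" "g$4$2 = 0" "g$4$3 = 0"
  obtains t1 t2 x y where "t1 \<noteq> 0" "t2 \<noteq> 0" "g = torus4 t1 t2 ** u_elt x y"
proof -
  have E: "(g ** J4 ** transpose g) $ i $ j = J4 $ i $ j" for i j
    using SO4_row_form[OF g] by simp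
  note e = E[unfolded matrix_matrix_mult_def transpose_def J4_def, simplified sum_4, simplified]
  have e14: "g$1$1 * g$4$4 = 1" using e[of 1 4] row by simp
  have e24: "g$2$1 * g$4$4 = 0" using e[of 2 4] row by simp
  have e34: "g$3$1 * g$4$4 = 0" using e[of 3 4] row by simp
  have nz: "g$4$4 \<noteq> 0" "g$1$1 \<noteq> 0"
    using e14 by auto
  have z1: "g$2$1 = 0" "g$3$1 = 0"
    using e24 e34 nz by auto
  have e22: "g$2$2 * g$2$3 = 0"
  proof -
    have "2 * (g$2$2 * g$2$3) = 0"
      using e[of 2 2] z1 by (simp add: algebra_simps)
    then show ?thesis using two by simp
  qed
  have e33: "g$3$2 * g$3$3 = 0"
  proof -
    have "2 * (g$3$2 * g$3$3) = 0"
      using e[of 3 3] z1 by (simp add: algebra_simps)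
    then show ?thesis using two by simp
  qed
  have e23: "g$2$2 * g$3$3 + g$2$3 * g$3$2 = 1"
    using e[of 2 3] z1 by (simp add: algebra_simps)
  have det: "g$2$2 * g$3$3 - g$2$3 * g$3$2 = 1"
  proof -
    have "det g = 1"
      using g by (simp add: SO4_def)
    then have "g$1$1 * g$4$4 * (g$2$2 * g$3$3 - g$2$3 * g$3$2) = 1"
      unfolding det_4 using row z1 by (simp add: algebra_simps)
    then show ?thesis
      using e14 by simp
  qed
  have "2 * (g$2$3 * g$3$2) = 0"
    using e23 det by algebra
  then have zz: "g$2$3 * g$3$2 = 0"
    using two by simp
  then have p: "g$2$2 * g$3$3 = 1"
    using e23 by (simp only: zz add_0_right)
  then have nz2: "g$2$2 \<noteq> 0" "g$3$3 \<noteq> 0"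
    by auto
  then have z2: "g$2$3 = 0" "g$3$2 = 0"
    using e22 e33 by auto
  have e12: "g$1$1 * g$2$4 + g$1$3 * g$2$2 = 0"
    using e[of 1 2] z1 z2 by (simp add: algebra_simps)
  have e13: "g$1$1 * g$3$4 + g$1$2 * g$3$3 = 0"
    using e[of 1 3] z1 z2 by (simp add: algebra_simps)
  have e11: "g$1$1 * g$1$4 + g$1$2 * g$1$3 = 0"
  proof -
    have "2 * (g$1$1 * g$1$4 + g$1$2 * g$1$3) = 0"
      using e[of 1 1] by (simp add: algebra_simps)
    then show ?thesis using two by (metis mult_eq_0_iff)
  qed
  let ?x = "g$1$2 / g$1$1" and ?y = "g$1$3 / g$1$1"
  have i: "inverse (g$1$1) = g$4$4" "inverse (g$2$2) = g$3$3"
    using e14 p by (simp_all add: inverse_unique)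
  have "g$2$4 = - (g$2$2 * ?y)" "g$1$4 = - (g$1$2 * ?y)" "g$3$4 = - (g$3$3 * ?x)"
    using e12 e13 e11 nz by (simp_all add: field_simps eq_neg_iff_add_eq_0)
  then have "g = torus4 (g$1$1) (g$2$2) ** u_elt ?x ?y"
    using nz nz2 row z1 z2 i by (simp add: torus4_def u_elt_mat mat4_simps)
  then show ?thesis
    using that nz nz2 by blast
qed

text \<open>The last row is isotropic, that is, a pure tensor for the two copies of SL2. An integral
  element of each copy therefore suffices to bring it to the form required by
  \<open>SO4_borel\<close>.\<close>

lemma SO4_iwasawa:
  fixes g :: "'a::nonarch_local_field^4^4"
  assumes g: "g \<in> SO4" and two: "(2::'a) \<noteq> 0"
  obtains t1 t2 x y k1 k2 where "t1 \<noteq> 0" "t2 \<noteq> 0" "k1 \<in> SL2_int" "k2 \<in> SL2_int"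
    "g = torus4 t1 t2 ** u_elt x y ** (m_beta k2 ** m_levi k1)"
proof -
  have E: "(g ** J4 ** transpose g) $ i $ j = J4 $ i $ j" for i j
    using SO4_row_form[OF g] by simp
  note e = E[unfolded matrix_matrix_mult_def transpose_def J4_def, simplified sum_4, simplified]
  have iso: "g$4$1 * g$4$4 + g$4$2 * g$4$3 = 0"
  proof -
    have "2 * (g$4$1 * g$4$4 + g$4$2 * g$4$3) = 0"
      using e[of 4 4] by (simp add: algebra_simps)
    then show ?thesis using two by (metis mult_eq_0_iff)
  qed
  \<comment> \<open>Two conditions on the single column \<open>(a, c)\<close>; isotropy makes them
    proportional, so it is enough to solve one that is nonzero.\<close>
  obtain a b c d where k: "mat2 a b c d \<in> SL2_int" "g$4$1 * a + g$4$2 * c = 0" "g$4$3 * a - g$4$4 * c = 0"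
  proof (cases "g$4$1 = 0 \<and> g$4$2 = 0")
    case True
    obtain a b c d where "mat2 a b c d \<in> SL2_int" "g$4$3 * a + (- g$4$4) * c = 0"
      by (rule ex_SL2_int_annihilates)
    then show ?thesis
      using that[of a b c d] True by simp
  next
    case False
    obtain a b c d where k: "mat2 a b c d \<in> SL2_int" "g$4$1 * a + g$4$2 * c = 0"
      by (rule ex_SL2_int_annihilates)
    have "g$4$1 * (g$4$3 * a - g$4$4 * c) = 0" "g$4$2 * (g$4$3 * a - g$4$4 * c) = 0"
      using k(2) iso by algebra+
    then show ?thesis
      using that[of a b c d] k False by auto
  qed
  define g1 where "g1 = g ** m_levi (mat2 a b c d)"
  have ad: "a * d - b * c = 1"
    using k by (simp add: SL2_int_mat2)
  have g1: "g1$4$1 = 0" "g1$4$3 = 0"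
    using k ad by (simp_all add: g1_def m_levi_mat2[where D = 1] matrix_matrix_mult_def sum_4)
  obtain a' b' c' d' where k': "mat2 a' b' c' d' \<in> SL2_int" "g1$4$2 * a' + (- g1$4$4) * c' = 0"
    by (rule ex_SL2_int_annihilates)
  define g2 where "g2 = g1 ** m_beta (mat2 a' b' c' d')"
  have row: "g2$4$1 = 0" "g2$4$2 = 0" "g2$4$3 = 0"
    using g1 k' by (simp_all add: g2_def m_beta_def matrix_matrix_mult_def sum_4)
  have "g2 \<in> SO4"
    unfolding g2_def g1_def using g k k'
    by (intro SO4_mult m_levi_SO4 m_beta_SO4 SL2_int_subset) (simp_all add: SL2_int_mat2)
  then obtain t1 t2 x y where t: "t1 \<noteq> 0" "t2 \<noteq> 0" "g2 = torus4 t1 t2 ** u_elt x y"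
    using SO4_borel[OF _ two row] by blast
  let ?k1 = "mat2 d (- b) (- c) a" and ?k2 = "mat2 d' (- b') (- c') a'"
  have ad': "a' * d' - b' * c' = 1"
    using k' by (simp add: SL2_int_mat2)
  have "mat2 a b c d ** ?k1 = mat 1" "mat2 a' b' c' d' ** ?k2 = mat 1"
    using ad ad' by (simp_all add: mat2_one algebra_simps)
  moreover have "m_levi (mat 1) = (mat 1 :: 'a^4^4)" "m_beta (mat 1) = (mat 1 :: 'a^4^4)"
    unfolding mat2_one by (simp_all add: m_levi_mat2[where D = 1] m_beta_def mat4_simps mat_def)
  ultimately have inv: "m_levi (mat2 a b c d) ** m_levi ?k1 = mat 1" "m_beta (mat2 a' b' c' d') ** m_beta ?k2 = mat 1"
    using ad by (simp_all add: mult.commute flip: m_levi_mult m_beta_mult)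
  have "g2 ** (m_beta ?k2 ** m_levi ?k1) = g ** (m_levi (mat2 a b c d) **
      ((m_beta (mat2 a' b' c' d') ** m_beta ?k2) ** m_levi ?k1))"
    by (simp add: g2_def g1_def matrix_mul_assoc)
  also have "\<dots> = g"
    by (simp add: inv)
  finally have "g = torus4 t1 t2 ** u_elt x y ** (m_beta ?k2 ** m_levi ?k1)"
    by (simp add: t)
  moreover have "?k1 \<in> SL2_int" "?k2 \<in> SL2_int"
    using k k' by (simp_all add: SL2_int_mat2 algebra_simps)
  ultimately show ?thesis
    using that t by blast
qed

section \<open>Cosets for the GL2 Hecke operator\<close>

context uniformized begin

text \<open>Representatives of the left cosets of \<open>GL2_int\<close> in the double coset of \<open>diag(\<varpi>,1)\<close>.\<close>

definition gam :: "'a option \<Rightarrow> 'a^2^2" where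
  "gam i = (case i of None \<Rightarrow> mat2 1 0 0 unif | Some x \<Rightarrow> mat2 unif x 0 1)"

definition gam_index :: "'a option set" where
  "gam_index = insert None (Some ` reps)"

lemma finite_gam_index: "finite gam_index"
  by (simp add: gam_index_def finite_reps)

lemma sum_gam_index: "(\<Sum>i\<in>gam_index. f i) = f None + (\<Sum>x\<in>reps. f (Some x))"
  unfolding gam_index_def using finite_reps by (subst sum.insert) (auto simp: sum.reindex)

lemma det_gam: "det (gam i) = unif"
  by (cases i) (simp_all add: gam_def)

text \<open>Reduce modulo the uniformizer, where the rank is at most 1. Either the bottom row
  vanishes, and \<open>unif\<close> can be divided out of it, or the top row is a multiple of the
  bottom row and becomes divisible after subtraction.\<close>

lemma gam_cover:
  assumes "nrm (a * d - b * c) = nrm unif" "a \<in> integers" "b \<in> integers" "c \<in> integers" "d \<in> integers"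
  shows "\<exists>i\<in>gam_index. \<exists>k\<in>GL2_int. mat2 a b c d = gam i ** k"
proof (cases "nrm c < 1 \<and> nrm d < 1")
  case True
  then have "c / unif \<in> integers" "d / unif \<in> integers"
    using unif_dvd by blast+
  moreover have "nrm (a * (d / unif) - b * (c / unif)) = 1"
  proof -
    have "a * (d / unif) - b * (c / unif) = (a * d - b * c) / unif"
      by (simp add: diff_divide_distrib)
    then show ?thesis
      using assms by (simp add: nrm_divide)
  qed
  ultimately have "mat2 a b (c / unif) (d / unif) \<in> GL2_int"
    using assms by (simp add: GL2_int_mat2)
  moreover have "mat2 a b c d = gam None ** mat2 a b (c / unif) (d / unif)"
    by (simp add: gam_def)
  ultimately show ?thesis
    unfolding gam_index_def by blast
next
  case False
  have det: "nrm (a * d - b * c) < 1"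
    using assms nrm_unif_less_1 by simp
  \<comment> \<open>The ratio of top row to bottom row, read off at a unit entry of the bottom row;
    the other column follows because the determinant is small.\<close>
  obtain z where z: "z \<in> integers" "nrm (a - z * c) < 1" "nrm (b - z * d) < 1"
  proof (cases "nrm c = 1")
    case True
    then have "c \<noteq> 0" by auto
    then have "b - a / c * d = - ((a * d - b * c) / c)"
      by (simp add: field_simps)
    then have "nrm (b - a / c * d) < 1"
      using det True by (simp add: nrm_divide)
    moreover have "a / c \<in> integers" "a - a / c * c = 0"
      using assms True \<open>c \<noteq> 0\<close> by (simp_all add: mem_integers nrm_divide)
    ultimately show ?thesis
      using that[of "a / c"] by simp
  next
    case c: False
    then have d: "nrm d = 1"
      using False assms by (auto simp: mem_integers)
    then have "d \<noteq> 0" by auto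
    then have "a - b / d * c = (a * d - b * c) / d"
      by (simp add: field_simps)
    then have "nrm (a - b / d * c) < 1"
      using det d by (simp add: nrm_divide)
    moreover have "b / d \<in> integers" "b - b / d * d = 0"
      using assms d \<open>d \<noteq> 0\<close> by (simp_all add: mem_integers nrm_divide)
    ultimately show ?thesis
      using that[of "b / d"] by simp
  qed
  have red: "(e - rep z * f) / unif \<in> integers" if "nrm (e - z * f) < 1" "f \<in> integers" for e f
  proof -
    have "nrm ((z - rep z) * f) < 1"
      using rep(1)[OF z(1)] that(2) mult_left_le[of "nrm f" "nrm (z - rep z)"]
      by (simp add: nrm_mult mem_integers)
    then have "nrm ((e - z * f) + (z - rep z) * f) < 1"
      using that(1) by (intro nrm_add_less)
    then show ?thesis
      using unif_dvd by (simp add: algebra_simps)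
  qed
  define a' b' where "a' = (a - rep z * c) / unif" and "b' = (b - rep z * d) / unif"
  have "a' \<in> integers" "b' \<in> integers"
    unfolding a'_def b'_def using z assms by (simp_all add: red)
  moreover have "nrm (a' * d - b' * c) = 1"
  proof -
    have "a' * d - b' * c = (a * d - b * c) / unif"
      by (simp add: a'_def b'_def field_simps)
    then show ?thesis
      using assms by (simp add: nrm_divide)
  qed
  ultimately have "mat2 a' b' c d \<in> GL2_int"
    using assms by (simp add: GL2_int_mat2)
  moreover have "mat2 a b c d = gam (Some (rep z)) ** mat2 a' b' c d"
    by (simp add: gam_def a'_def b'_def)
  ultimately show ?thesis
    using z(1) rep_in_reps unfolding gam_index_def by blast
qed

lemma GL2_int_bottom_row:
  assumes "mat2 a b c (d::'a) \<in> GL2_int"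
  shows "\<not> (nrm c < 1 \<and> nrm d < 1)"
proof
  assume *: "nrm c < 1 \<and> nrm d < 1"
  have "nrm x * nrm y < 1" if "nrm x \<le> 1" "nrm y < 1" for x y :: 'a
    using that mult_left_le_one_le[of "nrm y" "nrm x"] by simp
  then have "nrm (a * d) < 1" "nrm (b * c) < 1"
    using * assms by (auto simp: nrm_mult GL2_int_mat2 mem_integers)
  then have "nrm (a * d - b * c) < 1"
    by (rule nrm_diff_less)
  then show False
    using assms by (simp add: GL2_int_mat2)
qed

lemma gam_unique:
  assumes "i \<in> gam_index" "j \<in> gam_index" "k \<in> GL2_int" "k' \<in> GL2_int" "gam i ** k = gam j ** k'"
  shows "i = j"
proof -
  obtain a b c d a' b' c' d' where k: "k = mat2 a b c d" "k' = mat2 a' b' c' d'"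
    by (metis mat2_cases)
  have small: "nrm (unif * x) < 1" if "x \<in> integers" for x
    using that unif_mult_integer by blast
  show ?thesis
  proof (cases i; cases j)
    fix x y assume ij: "i = Some x" "j = Some y"
    then have xy: "x \<in> reps" "y \<in> reps"
      using assms by (auto simp: gam_index_def)
    have eq: "unif * a + x * c = unif * a' + y * c" "unif * b + x * d = unif * b' + y * d"
      using assms(5) by (auto simp: k ij gam_def)
    have int: "a' - a \<in> integers" "b' - b \<in> integers"
      using assms(3,4) by (auto simp: k GL2_int_mat2 intro: integers_diff)
    have "(x - y) * c = unif * (a' - a)" "(x - y) * d = unif * (b' - b)"
      using eq by (simp_all add: algebra_simps eq_diff_eq add.commute)
    then have lt: "nrm ((x - y) * c) < 1" "nrm ((x - y) * d) < 1"
      using int small by simp_all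
    have "nrm (x - y) < 1"
    proof (rule ccontr)
      assume "\<not> nrm (x - y) < 1"
      then have "nrm (x - y) = 1"
        using xy reps_integers integers_diff[of x y] by (auto simp: mem_integers)
      then show False
        using lt GL2_int_bottom_row[of a b c d] assms(3) by (simp add: nrm_mult k)
    qed
    then show ?thesis
      using reps_eq[OF xy] ij by simp
  next
    fix y assume ij: "i = None" "j = Some y"
    then have "c' = unif * c" "d' = unif * d"
      using assms(5) by (auto simp: k gam_def)
    moreover have "c \<in> integers" "d \<in> integers" "c' \<in> integers" "d' \<in> integers"
      using assms(3,4) by (simp_all add: k GL2_int_mat2)
    ultimately show ?thesis
      using GL2_int_bottom_row assms(3,4) small unfolding k by blast
  next
    fix x assume ij: "i = Some x" "j = None"
    then have "c = unif * c'" "d = unif * d'"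
      using assms(5) by (auto simp: k gam_def)
    moreover have "c \<in> integers" "d \<in> integers" "c' \<in> integers" "d' \<in> integers"
      using assms(3,4) by (simp_all add: k GL2_int_mat2)
    ultimately show ?thesis
      using GL2_int_bottom_row assms(3,4) small unfolding k by blast
  qed auto
qed

text \<open>Left multiplication by \<open>k0\<close> preserves the double coset, hence maps the
  cosets of the \<open>gam i\<close> to one another. Invertibility of \<open>k0\<close> makes the
  map on indices injective, and finiteness makes it bijective.\<close>

lemma gam_permutation:
  assumes "k0 \<in> GL2_int"
  obtains p where "bij_betw p gam_index gam_index"
    "\<And>i. i \<in> gam_index \<Longrightarrow> \<exists>k\<in>GL2_int. k0 ** gam i = gam (p i) ** k"
proof -
  have "\<exists>j\<in>gam_index. \<exists>k\<in>GL2_int. k0 ** gam i = gam j ** k" if i: "i \<in> gam_index" for i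
  proof -
    obtain a b c d where m: "k0 ** gam i = mat2 a b c d"
      by (rule mat2_cases)
    have "det (k0 ** gam i) = det k0 * unif"
      by (simp add: det_mul det_gam)
    then have det: "nrm (a * d - b * c) = nrm unif"
      using assms unfolding m by (simp add: nrm_mult GL2_int_def)
    have u: "unif \<in> integers"
      using nrm_unif_less_1 by (simp add: mem_integers)
    have "\<forall>r s. gam i $ r $ s \<in> integers"
      using i u reps_integers by (auto simp: gam_index_def gam_def forall_2)
    then have "\<forall>r s. (k0 ** gam i) $ r $ s \<in> integers"
      using assms by (simp add: matrix_matrix_mult_def sum_2 GL2_int_def integers_add integers_mult)
    then show ?thesis
      unfolding m using gam_cover[OF det] by (simp add: forall_2)
  qed
  then obtain p where p: "\<And>i. i \<in> gam_index \<Longrightarrow> p i \<in> gam_index"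
    "\<And>i. i \<in> gam_index \<Longrightarrow> \<exists>k\<in>GL2_int. k0 ** gam i = gam (p i) ** k"
    by metis
  have "inj_on p gam_index"
  proof (rule inj_onI)
    fix i j assume ij: "i \<in> gam_index" "j \<in> gam_index" "p i = p j"
    obtain k k' where k: "k \<in> GL2_int" "k' \<in> GL2_int"
      "k0 ** gam i = gam (p i) ** k" "k0 ** gam j = gam (p i) ** k'"
      using p(2) ij by metis
    obtain ki where ki: "ki \<in> GL2_int" "k ** ki = mat 1"
      using GL2_int_inverse[OF k(1)] by blast
    obtain k0i where k0i: "k0i ** k0 = mat 1"
      using GL2_int_inverse[OF assms] by blast
    have "k0 ** (gam i ** (ki ** k')) = gam (p i) ** (k ** ki) ** k'"
      by (simp only: matrix_mul_assoc k(3))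
    also have "\<dots> = k0 ** gam j"
      by (simp add: ki k(4))
    finally have "(k0i ** k0) ** (gam i ** (ki ** k')) = (k0i ** k0) ** gam j"
      by (simp only: flip: matrix_mul_assoc)
    then have "gam i ** (ki ** k') = gam j ** mat 1"
      by (simp add: k0i)
    then show "i = j"
      using gam_unique[OF ij(1,2) GL2_int_mult[OF ki(1) k(2)]] GL2_int_one by blast
  qed
  then have "bij_betw p gam_index gam_index"
    using p(1) finite_gam_index by (simp add: bij_betw_def endo_inj_surj image_subsetI)
  then show ?thesis
    using that p(2) by blast
qed

end

section \<open>The Hecke eigenvalue\<close>

lemma finite_vec:
  assumes "finite M"
  shows "finite {x :: 'b^'n. \<forall>i. x $ i \<in> M}"
proof (rule finite_subset)
  show "{x :: 'b^'n. \<forall>i. x $ i \<in> M} \<subseteq> vec_lambda ` (UNIV \<rightarrow>\<^sub>E M)"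
  proof
    fix x :: "'b^'n" assume "x \<in> {x. \<forall>i. x $ i \<in> M}"
    then show "x \<in> vec_lambda ` (UNIV \<rightarrow>\<^sub>E M)"
      by (intro image_eqI[of _ _ "vec_nth x"]) auto
  qed
  show "finite (vec_lambda ` (UNIV \<rightarrow>\<^sub>E M) :: ('b^'n) set)"
    using assms by (intro finite_imageI finite_PiE) auto
qed

lemma finite_image_factor:
  assumes "finite (c ` K)" and "\<And>k k'. k \<in> K \<Longrightarrow> k' \<in> K \<Longrightarrow> c k = c k' \<Longrightarrow> f k = f k'"
  shows "finite (f ` K)"
proof -
  have "f k = f (inv_into K c (c k))" if "k \<in> K" for k
    using that by (intro assms(2)) (auto simp: inv_into_into f_inv_into_f)
  then have "f ` K \<subseteq> (\<lambda>y. f (inv_into K c y)) ` (c ` K)"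
    by auto
  then show ?thesis
    using assms(1) finite_surj by blast
qed

lemma principal_series_outside: "\<Phi> \<in> principal_series a b \<Longrightarrow> g \<notin> SO4 \<Longrightarrow> \<Phi> g = 0"
  by (simp add: principal_series_def)

lemma principal_series_equivariant:
  "\<Phi> \<in> principal_series a b \<Longrightarrow> t1 \<noteq> 0 \<Longrightarrow> t2 \<noteq> 0 \<Longrightarrow> g \<in> SO4 \<Longrightarrow>
    \<Phi> (torus4 t1 t2 ** u_elt x y ** g) =
      a powi valuation t1 * b powi valuation t2 * of_real (nrm t1) * \<Phi> g"
  by (simp add: principal_series_def)

lemma principal_series_smooth:
  "\<Phi> \<in> principal_series a b \<Longrightarrow>
    \<exists>V. open V \<and> mat 1 \<in> V \<and> (\<forall>g\<in>SO4. \<forall>k\<in>SO4 \<inter> V. \<Phi> (g ** k) = \<Phi> g)"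
  unfolding principal_series_def mem_Collect_eq by (elim conjE)

section \<open>Finite orbits, and the eigenvalue on the spherical function\<close>

context uniformized begin

text \<open>Unfolds the product topology on matrices twice; the sum of the levels found for the
  single entries serves as a common level.\<close>

lemma open_contains_congruence_subgroup:
  assumes "open V" "(mat 1 :: 'a^4^4) \<in> V"
  shows "\<exists>m. \<forall>h. (\<forall>i j. nrm (h $ i $ j - (mat 1 :: 'a^4^4) $ i $ j) \<le> nrm unif ^ m) \<longrightarrow> h \<in> V"
proof -
  have "\<forall>x\<in>V. \<exists>A. (\<forall>i. open (A i) \<and> x $ i \<in> A i) \<and> (\<forall>y. (\<forall>i. y $ i \<in> A i) \<longrightarrow> y \<in> V)"
    using assms(1) by (subst (asm) open_vec_def)
  from bspec[OF this assms(2)]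
  obtain A where A: "(\<forall>i. open (A i) \<and> (mat 1 :: 'a^4^4) $ i \<in> A i) \<and> (\<forall>y. (\<forall>i. y $ i \<in> A i) \<longrightarrow> y \<in> V)"
    by (rule exE)
  have "\<forall>i. \<exists>B. (\<forall>j. open (B j) \<and> (mat 1 :: 'a^4^4) $ i $ j \<in> B j) \<and> (\<forall>y. (\<forall>j. y $ j \<in> B j) \<longrightarrow> y \<in> A i)"
  proof
    fix i
    have "open (A i)" "(mat 1 :: 'a^4^4) $ i \<in> A i"
      using A by simp_all
    then show "\<exists>B. (\<forall>j. open (B j) \<and> (mat 1 :: 'a^4^4) $ i $ j \<in> B j) \<and> (\<forall>y. (\<forall>j. y $ j \<in> B j) \<longrightarrow> y \<in> A i)"
      by (subst (asm) open_vec_def) (erule (1) bspec)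
  qed
  from choice[OF this] obtain B where
    B: "\<forall>i. (\<forall>j. open (B i j) \<and> (mat 1 :: 'a^4^4) $ i $ j \<in> B i j) \<and> (\<forall>y. (\<forall>j. y $ j \<in> B i j) \<longrightarrow> y \<in> A i)"
    by (rule exE)
  have ex: "\<exists>m. \<forall>y. nrm (y - (mat 1 :: 'a^4^4) $ i $ j) \<le> nrm unif ^ m \<longrightarrow> y \<in> B i j" for i j
  proof -
    have "open (B i j)" "(mat 1 :: 'a^4^4) $ i $ j \<in> B i j"
      using B by simp_all
    then obtain e where e: "e > 0" "\<forall>y. dist y ((mat 1 :: 'a^4^4) $ i $ j) < e \<longrightarrow> y \<in> B i j"
      unfolding open_dist by blast
    obtain m where "nrm unif ^ m < e"
      using real_arch_pow_inv[OF e(1) nrm_unif_less_1] by blast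
    then show ?thesis
      using e(2) by (intro exI[of _ m]) (simp add: dist_eq_nrm)
  qed
  define n where "n i j = (SOME m. \<forall>y. nrm (y - (mat 1 :: 'a^4^4) $ i $ j) \<le> nrm unif ^ m \<longrightarrow> y \<in> B i j)" for i j
  have n: "\<forall>y. nrm (y - (mat 1 :: 'a^4^4) $ i $ j) \<le> nrm unif ^ n i j \<longrightarrow> y \<in> B i j" for i j
    unfolding n_def by (rule someI_ex[OF ex])
  define m where "m = (\<Sum>i\<in>UNIV. \<Sum>j\<in>UNIV. n i j)"
  have le: "n i j \<le> m" for i j
  proof -
    have "n i j \<le> (\<Sum>j\<in>UNIV. n i j)"
      by (rule member_le_sum) auto
    also have "\<dots> \<le> m"
      unfolding m_def by (rule member_le_sum[of i UNIV "\<lambda>i. \<Sum>j\<in>UNIV. n i j"]) auto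
    finally show ?thesis .
  qed
  show ?thesis
  proof (intro exI allI impI)
    fix h :: "'a^4^4" assume h: "\<forall>i j. nrm (h $ i $ j - (mat 1 :: 'a^4^4) $ i $ j) \<le> nrm unif ^ m"
    have "h $ i $ j \<in> B i j" for i j
    proof -
      have "nrm unif ^ m \<le> nrm unif ^ n i j"
        using nrm_unif_less_1 by (intro power_decreasing le) auto
      then show ?thesis
        using h n[of i j] by (blast intro: order.trans)
    qed
    then show "h \<in> V"
      using A B by simp
  qed
qed

text \<open>Summation over the finite orbit of a vector of the principal series replaces the
  projection to the \<open>SO4_int\<close>-invariants.\<close>

lemma finite_orbit:
  assumes \<Phi>: "\<Phi> \<in> (principal_series a b :: ('a^4^4 \<Rightarrow> complex) set)"
  shows "finite ((\<lambda>k g. \<Phi> (g ** k)) ` SO4_int)"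
proof -
  obtain V where V: "open V" "mat 1 \<in> V" "\<And>g k. g \<in> SO4 \<Longrightarrow> k \<in> SO4 \<inter> V \<Longrightarrow> \<Phi> (g ** k) = \<Phi> g"
    using principal_series_smooth[OF \<Phi>] by blast
  from open_contains_congruence_subgroup[OF V(1,2)]
  obtain m where m: "\<forall>h. (\<forall>i j. nrm (h $ i $ j - (mat 1 :: 'a^4^4) $ i $ j) \<le> nrm unif ^ m) \<longrightarrow> h \<in> V"
    by (rule exE)
  from finite_net[of m]
  obtain N :: "'a set" where N: "finite N \<and> (\<forall>x\<in>integers. \<exists>y\<in>N. nrm (x - y) \<le> nrm unif ^ m)"
    by (rule exE)
  then have "\<forall>x\<in>integers. \<exists>y. y \<in> N \<and> nrm (x - y) \<le> nrm unif ^ m"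
    by blast
  from bchoice[OF this] obtain c where c': "\<forall>x\<in>integers. c x \<in> N \<and> nrm (x - c x) \<le> nrm unif ^ m"
    by (rule exE)
  note c = bspec[OF c']
  \<comment> \<open>Rounds all entries to the finite net. Matrices with equal rounding differ on the
    right by an element of \<open>V\<close>, which does not change \<Phi>.\<close>
  let ?c = "\<lambda>k::'a^4^4. \<chi> i j. c (k $ i $ j)"
  have "?c ` SO4_int \<subseteq> {x. \<forall>i. x $ i \<in> {y. \<forall>j. y $ j \<in> N}}"
    using c by (auto simp: SO4_int_def)
  moreover have "finite {x :: 'a^4^4. \<forall>i. x $ i \<in> {y. \<forall>j. y $ j \<in> N}}"
    by (intro finite_vec conjunct1[OF N])
  ultimately have "finite (?c ` SO4_int)"
    using finite_subset by blast
  then show ?thesis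
  proof (rule finite_image_factor)
    fix k k' assume k: "k \<in> (SO4_int :: ('a^4^4) set)" "k' \<in> (SO4_int :: ('a^4^4) set)" "?c k = ?c k'"
    let ?h = "SO4_inv k ** k'"
    have d: "nrm (k' $ i $ j - k $ i $ j) \<le> nrm unif ^ m" for i j
    proof -
      have "c (k $ i $ j) = c (k' $ i $ j)"
        using k(3) by (simp add: vec_eq_iff)
      moreover have "k $ i $ j \<in> integers" "k' $ i $ j \<in> integers"
        using k by (simp_all add: SO4_int_def)
      ultimately show ?thesis
        using nrm_diff_le[of "k' $ i $ j - c (k' $ i $ j)" "nrm unif ^ m" "k $ i $ j - c (k' $ i $ j)"]
          c[of "k $ i $ j"] c[of "k' $ i $ j"] by simp
    qed
    have "?h \<in> V"
    proof (rule m[rule_format])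
      fix i j
      have int: "SO4_inv k $ i $ r \<in> integers" for r
        using SO4_int_inv[OF k(1)] by (simp add: SO4_int_def)
      have "(mat 1 :: 'a^4^4) $ i $ j = (SO4_inv k ** k) $ i $ j"
        using SO4_inv_left[OF SO4_int_subset[OF k(1)]] by simp
      then have "?h $ i $ j - (mat 1 :: 'a^4^4) $ i $ j = (\<Sum>r\<in>UNIV. SO4_inv k $ i $ r * (k' $ r $ j - k $ r $ j))"
        by (simp add: matrix_matrix_mult_def sum_subtractf right_diff_distrib)
      moreover have "nrm (SO4_inv k $ i $ r * (k' $ r $ j - k $ r $ j)) \<le> nrm unif ^ m" for r
        using int[of r] d[of r j] mult_mono[of "nrm (SO4_inv k $ i $ r)" 1 "nrm (k' $ r $ j - k $ r $ j)" "nrm unif ^ m"]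
        by (simp add: nrm_mult mem_integers)
      ultimately show "nrm (?h $ i $ j - (mat 1 :: 'a^4^4) $ i $ j) \<le> nrm unif ^ m"
        by (simp add: sum_4 nrm_add_le)
    qed
    moreover have "?h \<in> SO4"
      using k by (intro SO4_mult SO4_inv_mem SO4_int_subset)
    ultimately have "\<Phi> (g ** k ** ?h) = \<Phi> (g ** k)" if "g \<in> SO4" for g
      using V(3) SO4_mult[OF that SO4_int_subset[OF k(1)]] by blast
    moreover have "g ** k ** ?h = g ** k'" for g
    proof -
      have "g ** k ** ?h = g ** (k ** SO4_inv k) ** k'"
        by (simp only: matrix_mul_assoc)
      then show ?thesis
        using SO4_inv_right[OF SO4_int_subset[OF k(1)]] by simp
    qed
    \<comment> \<open>The translates must agree as functions on all matrices; off \<open>SO4\<close>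
      both are 0.\<close>
    moreover have "\<Phi> (g ** k'') = 0" if "g \<notin> SO4" "k'' \<in> SO4_int" for g k''
      using principal_series_outside[OF \<Phi>] that SO4_mult_cancel[OF _ SO4_int_subset[OF that(2)]]
      by blast
    ultimately show "(\<lambda>g. \<Phi> (g ** k)) = (\<lambda>g. \<Phi> (g ** k'))"
      using k by (metis (no_types, lifting))
  qed
qed

lemma orbit_sum_invariant:
  fixes \<Phi> :: "'a^4^4 \<Rightarrow> complex"
  assumes fin: "finite ((\<lambda>k g. \<Phi> (g ** k)) ` SO4_int)" (is "finite ?O") and k0: "k0 \<in> SO4_int"
  shows "(\<Sum>\<Psi>\<in>(\<lambda>k g. \<Phi> (g ** k)) ` SO4_int. \<Psi> (g ** k0)) = (\<Sum>\<Psi>\<in>(\<lambda>k g. \<Phi> (g ** k)) ` SO4_int. \<Psi> g)"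
proof -
  let ?R = "\<lambda>\<Psi> g. \<Psi> (g ** k0)"
  have "?R ` ?O \<subseteq> ?O"
  proof (intro image_subsetI)
    fix \<Psi> assume "\<Psi> \<in> ?O"
    then obtain k where k: "k \<in> SO4_int" "\<Psi> = (\<lambda>g. \<Phi> (g ** k))"
      by blast
    then show "?R \<Psi> \<in> ?O"
      using SO4_int_mult[OF k0 k(1)] by (auto simp flip: matrix_mul_assoc)
  qed
  moreover have "inj_on ?R ?O"
  proof (rule inj_onI)
    fix \<Psi> \<Psi>' :: "'a^4^4 \<Rightarrow> complex" assume eq: "?R \<Psi> = ?R \<Psi>'"
    have "g ** SO4_inv k0 ** k0 = g" for g
      using SO4_inv_left[OF SO4_int_subset[OF k0]] by (simp flip: matrix_mul_assoc)
    then show "\<Psi> = \<Psi>'"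
      using fun_cong[OF eq] by (metis ext)
  qed
  ultimately have "bij_betw ?R ?O ?O"
    using fin by (simp add: bij_betw_def endo_inj_surj)
  from sum.reindex_bij_betw[OF this, of "\<lambda>\<Psi>. \<Psi> g"] show ?thesis .
qed

lemma gam_sum_invariant:
  fixes F :: "'a^2^2 \<Rightarrow> complex"
  assumes F: "\<And>h k. det h \<noteq> 0 \<Longrightarrow> k \<in> GL2_int \<Longrightarrow> F (h ** k) = F h"
    and h: "det h \<noteq> 0" and k: "k \<in> GL2_int"
  shows "(\<Sum>i\<in>gam_index. F (h ** k ** gam i)) = (\<Sum>i\<in>gam_index. F (h ** gam i))"
proof -
  obtain p where p: "bij_betw p gam_index gam_index"
    "\<And>i. i \<in> gam_index \<Longrightarrow> \<exists>k'\<in>GL2_int. k ** gam i = gam (p i) ** k'"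
    using gam_permutation[OF k] by blast
  have "F (h ** k ** gam i) = F (h ** gam (p i))" if "i \<in> gam_index" for i
  proof -
    obtain k' where k': "k' \<in> GL2_int" "k ** gam i = gam (p i) ** k'"
      using p(2) \<open>i \<in> gam_index\<close> by blast
    then have "h ** k ** gam i = h ** gam (p i) ** k'"
      by (metis matrix_mul_assoc)
    then show ?thesis
      using F[OF _ k'(1), of "h ** gam (p i)"] h by (simp add: det_mul det_gam)
  qed
  then have "(\<Sum>i\<in>gam_index. F (h ** k ** gam i)) = (\<Sum>i\<in>gam_index. F (h ** gam (p i)))"
    by (rule sum.cong[OF refl])
  also have "\<dots> = (\<Sum>i\<in>gam_index. F (h ** gam i))"
    using sum.reindex_bij_betw[OF p(1), of "\<lambda>i. F (h ** gam i)"] .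
  finally show ?thesis .
qed

text \<open>Summation over the pairs \<open>(i, j)\<close> is the square of the \<open>GL\<^sub>2\<close> Hecke operator, divided by the
  central element \<open>\<varpi>\<close> so that it stays in \<open>SL\<^sub>2\<close>, which commutes with \<open>m_beta\<close>.\<close>

definition hecke_rep :: "'a option \<Rightarrow> 'a option \<Rightarrow> 'a^2^2" where
  "hecke_rep i j = mat2 (inverse unif) 0 0 (inverse unif) ** (gam i ** gam j)"

lemma hecke_rep_SL2: "hecke_rep i j \<in> SL2"
  by (simp add: hecke_rep_def SL2_def det_mul det_gam field_simps)

text \<open>The inner sum is again right invariant under \<open>GL2_int\<close>, so
  \<open>gam_sum_invariant\<close> can be applied twice; the scalar matrix commutes with
  \<open>k\<close>.\<close>

lemma hecke_sum_invariant:
  fixes F :: "'a^2^2 \<Rightarrow> complex"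
  assumes F: "\<And>h k. det h \<noteq> 0 \<Longrightarrow> k \<in> GL2_int \<Longrightarrow> F (h ** k) = F h" and k: "k \<in> GL2_int"
  shows "(\<Sum>i\<in>gam_index. \<Sum>j\<in>gam_index. F (k ** hecke_rep i j)) =
    (\<Sum>i\<in>gam_index. \<Sum>j\<in>gam_index. F (hecke_rep i j))"
proof -
  let ?z = "mat2 (inverse unif) 0 0 (inverse unif)"
  define F1 where "F1 h = (\<Sum>j\<in>gam_index. F (h ** gam j))" for h
  have F1: "F1 (h ** k) = F1 h" if "det h \<noteq> 0" "k \<in> GL2_int" for h k
    unfolding F1_def by (rule gam_sum_invariant[OF F that])
  have "k ** ?z = ?z ** k"
    by (cases k rule: mat2_cases) (simp add: mult.commute)
  then have *: "k ** hecke_rep i j = ?z ** k ** gam i ** gam j" for i j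
    by (simp add: hecke_rep_def matrix_mul_assoc)
  have "(\<Sum>i\<in>gam_index. \<Sum>j\<in>gam_index. F (k ** hecke_rep i j)) = (\<Sum>i\<in>gam_index. F1 (?z ** k ** gam i))"
    by (simp only: * F1_def)
  also have "\<dots> = (\<Sum>i\<in>gam_index. F1 (?z ** gam i))"
    using F1 k by (intro gam_sum_invariant) auto
  finally show ?thesis
    by (simp add: F1_def hecke_rep_def matrix_mul_assoc)
qed

text \<open>Upper triangular forms, from which the weights of the operator appear:
  \<open>q^2\<close> terms at \<open>unif\<close>, \<open>2 * q\<close> at 1 and a single one at
  \<open>inverse unif\<close>.\<close>

lemma hecke_rep_simps:
  "hecke_rep (Some x) (Some y) = n_SL2 (x + unif * y) ** t_SL2 unif"
  "hecke_rep (Some x) None = n_SL2 x ** t_SL2 1"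
  "hecke_rep None (Some y) = n_SL2 (y / unif) ** t_SL2 1"
  "hecke_rep None None = n_SL2 0 ** t_SL2 (inverse unif)"
  by (simp_all add: hecke_rep_def gam_def n_mat2 t_mat2 field_simps)

lemma hecke_sum:
  "(\<Sum>i\<in>gam_index. \<Sum>j\<in>gam_index. f (hecke_rep i j)) =
    (\<Sum>x\<in>reps. \<Sum>y\<in>reps. f (n_SL2 (x + unif * y) ** t_SL2 unif)) + (\<Sum>x\<in>reps. f (n_SL2 x ** t_SL2 1))
    + (\<Sum>y\<in>reps. f (n_SL2 (y / unif) ** t_SL2 1)) + f (n_SL2 0 ** t_SL2 (inverse unif))"
  for f :: "'a^2^2 \<Rightarrow> complex"
  by (simp add: sum_gam_index hecke_rep_simps sum.distrib)

text \<open>After Iwasawa the Borel part factors out, \<open>m_beta k2\<close> commutes with the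
  Hecke elements and is absorbed on the right, and \<open>k1\<close> disappears by
  \<open>hecke_sum_invariant\<close>. What remains is the sum at the identity.\<close>

lemma spherical_hecke_eigen:
  fixes \<Phi> :: "'a^4^4 \<Rightarrow> complex"
  assumes \<Phi>: "\<Phi> \<in> principal_series a b" and inv: "\<And>g k. k \<in> SO4_int \<Longrightarrow> \<Phi> (g ** k) = \<Phi> g"
    and ab: "a \<noteq> 0" "b \<noteq> 0" and two: "(2::'a) \<noteq> 0"
  shows "(\<Sum>i\<in>gam_index. \<Sum>j\<in>gam_index. \<Phi> (g ** m_levi (hecke_rep i j))) =
    of_nat q * (a / b + b / a + 2) * \<Phi> g"
proof (cases "g \<in> SO4")
  case False
  then have "g ** m_levi (hecke_rep i j) \<notin> SO4" for i j
    using SO4_mult_cancel[OF _ m_levi_SO4, of g "hecke_rep i j"] hecke_rep_SL2[of i j]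
    by (auto simp: SL2_def)
  then have "\<Phi> (g ** m_levi (hecke_rep i j)) = 0" "\<Phi> g = 0" for i j
    using principal_series_outside[OF \<Phi>] False by blast+
  then show ?thesis
    by simp
next
  case True
  have equi: "\<Phi> (torus4 t1 t2 ** u_elt x y ** g) =
      a powi valuation t1 * b powi valuation t2 * of_real (nrm t1) * \<Phi> g"
    if "g \<in> SO4" "t1 \<noteq> 0" "t2 \<noteq> 0" for t1 t2 x y g
    using principal_series_equivariant[OF \<Phi>] that by blast
  obtain t1 t2 x y k1 k2 where t: "t1 \<noteq> 0" "t2 \<noteq> 0" and k: "k1 \<in> SL2_int" "k2 \<in> SL2_int"
    and g: "g = torus4 t1 t2 ** u_elt x y ** (m_beta k2 ** m_levi k1)"
    by (rule SO4_iwasawa[OF True two])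
  define \<theta> where "\<theta> = a powi valuation t1 * b powi valuation t2 * of_real (nrm t1)"
  define F where "F h = \<Phi> (m_levi h)" for h
  have F: "F (h ** k) = F h" if "det h \<noteq> 0" "k \<in> GL2_int" for h k
    by (simp add: F_def m_levi_mult that GL2_int_det inv m_levi_SO4_int)
  have mk: "m_beta k2 \<in> SO4_int" "m_levi k1 \<in> SO4_int"
    using k by (simp_all add: m_beta_SO4_int m_levi_SO4_int SL2_int_GL2_int)
  have "\<Phi> g = \<theta> * \<Phi> (m_beta k2 ** m_levi k1)"
    unfolding g \<theta>_def using t mk by (intro equi SO4_mult SO4_int_subset)
  also have "\<Phi> (m_beta k2 ** m_levi k1) = \<Phi> (mat 1)"
    using inv[OF SO4_int_mult[OF mk], of "mat 1"] by simp
  finally have \<Phi>g: "\<Phi> g = \<theta> * \<Phi> (mat 1)" .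
  have "\<Phi> (g ** m_levi (hecke_rep i j)) = \<theta> * F (k1 ** hecke_rep i j)" for i j
  proof -
    let ?h = "hecke_rep i j"
    have dets: "det k1 \<noteq> 0" "det ?h \<noteq> 0"
      using k hecke_rep_SL2[of i j] by (simp_all add: SL2_def SL2_int_def)
    have "\<Phi> (g ** m_levi ?h) = \<theta> * \<Phi> (m_beta k2 ** (m_levi k1 ** m_levi ?h))"
      using equi[OF SO4_mult[OF SO4_int_subset[OF mk(1)] SO4_mult[OF SO4_int_subset[OF mk(2)] m_levi_SO4[OF dets(2)]]] t]
      unfolding g \<theta>_def by (simp add: matrix_mul_assoc)
    also have "m_levi k1 ** m_levi ?h = m_levi (k1 ** ?h)"
      using dets by (simp add: m_levi_mult)
    also have "m_beta k2 ** m_levi (k1 ** ?h) = m_levi (k1 ** ?h) ** m_beta k2"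
      by (rule m_beta_commute[symmetric, OF SL2_mult[OF SL2_int_subset[OF k(1)] hecke_rep_SL2]])
    also have "\<Phi> \<dots> = F (k1 ** ?h)"
      unfolding F_def by (rule inv[OF mk(1)])
    finally show ?thesis .
  qed
  then have "(\<Sum>i\<in>gam_index. \<Sum>j\<in>gam_index. \<Phi> (g ** m_levi (hecke_rep i j))) =
      \<theta> * (\<Sum>i\<in>gam_index. \<Sum>j\<in>gam_index. F (k1 ** hecke_rep i j))"
    by (simp add: sum_distrib_left)
  also have "(\<Sum>i\<in>gam_index. \<Sum>j\<in>gam_index. F (k1 ** hecke_rep i j)) = (\<Sum>i\<in>gam_index. \<Sum>j\<in>gam_index. F (hecke_rep i j))"
    by (rule hecke_sum_invariant[OF F SL2_int_GL2_int[OF k(1)]])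
  also have "\<dots> = of_nat q * (a / b + b / a + 2) * \<Phi> (mat 1)"
  proof -
    have Fnt: "F (n_SL2 z ** t_SL2 c) = (a / b) powi valuation c * of_real (nrm c) * \<Phi> (mat 1)" if "c \<noteq> 0" for z c
    proof -
      have t1: "torus4 1 1 = (mat 1 :: 'a^4^4)" and u0: "u_elt 0 0 = (mat 1 :: 'a^4^4)"
        by (simp_all add: torus4_def u_elt_mat mat4_simps mat_def)
      have v: "valuation (inverse c) = - valuation c"
        using valuation_mult[of c "inverse c"] that valuation_unit[of 1] by simp
      have det: "det (n_SL2 z) \<noteq> 0" "det (t_SL2 c) \<noteq> 0"
        using that by (simp_all add: n_mat2 t_mat2)
      have "F (n_SL2 z ** t_SL2 c) = \<Phi> (torus4 1 1 ** u_elt z 0 ** torus4 c (inverse c))"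
        using that by (simp add: F_def m_levi_mult[OF det] m_levi_n m_levi_t t1)
      also have "\<dots> = \<Phi> (torus4 c (inverse c) ** u_elt 0 0 ** mat 1)"
        using that by (subst equi) (simp_all add: torus4_SO4 valuation_unit u0)
      also have "\<dots> = a powi valuation c * b powi (- valuation c) * of_real (nrm c) * \<Phi> (mat 1)"
        using that by (subst equi) (simp_all add: v)
      also have "a powi valuation c * b powi (- valuation c) = (a / b) powi valuation c"
        by (simp add: power_int_minus power_int_mult_distrib power_int_inverse divide_inverse)
      finally show ?thesis .
    qed
    have "valuation unif = 1" "valuation (inverse unif) = -1"
      using valuation_unif_powi[of 1] valuation_unif_powi[of "-1"] by (simp_all add: power_int_minus)
    moreover have "nrm (1 / unif) = real q"
      using q_ge_2 by (simp add: nrm_divide nrm_unif)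
    \<comment> \<open>Weights times values: \<open>q^2 * (a / b) / q\<close> from
      \<open>unif\<close>, \<open>2 * q\<close> from 1, and \<open>(b / a) * q\<close> from
      \<open>inverse unif\<close>.\<close>
    ultimately show ?thesis
      unfolding hecke_sum using q_ge_2
      by (simp add: Fnt valuation_unit card_reps nrm_unif power_int_minus field_simps)
  qed
  finally show ?thesis
    by (simp add: \<Phi>g)
qed

end

section \<open>Transfer of the eigenvalue to the Whittaker function\<close>

lemma smooth_rep_linear:
  assumes "smooth_rep sc \<pi>" "g \<in> SO4"
  shows "\<pi> g (x + y) = \<pi> g x + \<pi> g y" "\<pi> g (sc c x) = sc c (\<pi> g x)" "\<pi> g (x - y) = \<pi> g x - \<pi> g y"
    "\<pi> g 0 = 0"
proof -
  have "Vector_Spaces.linear sc sc (\<pi> g)"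
    using assms by (simp add: smooth_rep_def)
  then interpret module_hom sc sc "\<pi> g"
    by (simp add: Vector_Spaces.linear_def)
  show "\<pi> g (x + y) = \<pi> g x + \<pi> g y" "\<pi> g (sc c x) = sc c (\<pi> g x)" "\<pi> g (x - y) = \<pi> g x - \<pi> g y"
    "\<pi> g 0 = 0"
    by (simp_all add: add scale diff zero)
qed

lemma smooth_rep_mult: "smooth_rep sc \<pi> \<Longrightarrow> g \<in> SO4 \<Longrightarrow> h \<in> SO4 \<Longrightarrow> \<pi> (g ** h) v = \<pi> g (\<pi> h v)"
  by (simp add: smooth_rep_def)

lemma smooth_rep_one: "smooth_rep sc \<pi> \<Longrightarrow> \<pi> (mat 1) v = v"
  by (simp add: smooth_rep_def)

lemma whittaker_functional_linear:
  assumes "whittaker_functional sc \<psi> \<pi> l"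
  shows "l (x + y) = l x + l y" "l (sc c x) = c * l x" "l (x - y) = l x - l y" "l 0 = 0"
proof -
  have "Vector_Spaces.linear sc (*) l"
    using assms by (simp add: whittaker_functional_def)
  then interpret module_hom sc "(*)" l
    by (simp add: Vector_Spaces.linear_def)
  show "l (x + y) = l x + l y" "l (sc c x) = c * l x" "l (x - y) = l x - l y" "l 0 = 0"
    by (simp_all add: add scale diff zero)
qed

text \<open>The vectors with zero Whittaker function form an invariant subspace. It is proper
  because \<open>l\<close> is nonzero, hence zero by irreducibility, and it contains
  \<open>\<pi> k v - v\<close>.\<close>

lemma whittaker_function_fixed_vector:
  assumes \<pi>: "smooth_rep sc \<pi>" "irreducible_rep sc \<pi>" and l: "whittaker_functional sc \<psi> \<pi> l"
    and inv: "\<And>g. g \<in> SO4 \<Longrightarrow> l (\<pi> (g ** k) v) = l (\<pi> g v)" and k: "k \<in> SO4"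
  shows "\<pi> k v = v"
proof -
  define S where "S = {w. \<forall>g\<in>SO4. l (\<pi> g w) = 0}"
  have vs: "vector_space sc"
    using \<pi> by (simp add: smooth_rep_def)
  note lin = smooth_rep_linear[OF \<pi>(1)] whittaker_functional_linear[OF l]
  interpret vector_space sc by (rule vs)
  have "subspace S"
    by (simp add: subspace_def S_def lin)
  moreover have "\<pi> g w \<in> S" if "g \<in> SO4" "w \<in> S" for g w
    using that by (auto simp: S_def SO4_mult simp flip: smooth_rep_mult[OF \<pi>(1)])
  ultimately have "S = {0} \<or> S = UNIV"
    using \<pi>(2) unfolding irreducible_rep_def by blast
  moreover have "S \<noteq> UNIV"
  proof
    assume "S = UNIV"
    then have "l w = 0" for w
      using smooth_rep_one[OF \<pi>(1), of w] SO4_one unfolding S_def by (metis (mono_tags, lifting) UNIV_I mem_Collect_eq)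
    then show False
      using l by (auto simp: whittaker_functional_def)
  qed
  moreover have "\<pi> k v - v \<in> S"
    using inv k by (simp add: S_def lin flip: smooth_rep_mult[OF \<pi>(1)])
  ultimately show ?thesis
    by auto
qed

context uniformized begin

text \<open>The Hecke eigenvalue passes from the spherical vector of the principal series, where it is
  read off from the Iwasawa decomposition, to the spherical Whittaker function.\<close>

lemma whittaker_hecke_eigen:
  fixes \<pi> :: "'a^4^4 \<Rightarrow> 'v::ab_group_add \<Rightarrow> 'v"
  assumes \<pi>: "smooth_rep sc \<pi>" and l: "whittaker_functional sc \<psi> \<pi> l"
    and fixed: "\<And>k. k \<in> SO4_int \<Longrightarrow> \<pi> k v = v" and two: "(2::'a) \<noteq> 0"
    and satake: "satake_parameter sc \<pi> (torus4 a b)"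
    and g: "g \<in> SO4"
  shows "(\<Sum>i\<in>gam_index. \<Sum>j\<in>gam_index. l (\<pi> (g ** m_levi (hecke_rep i j)) v)) =
    of_nat q * (a / b + b / a + 2) * l (\<pi> g v)"
proof -
  have vs: "vector_space sc"
    using \<pi> by (simp add: smooth_rep_def)
  interpret vector_space sc by (rule vs)
  obtain a' b' N T where ab: "a' \<noteq> 0" "b' \<noteq> 0" "torus4 a b = torus4 a' b'"
    and N: "N \<subseteq> principal_series a' b'" "(\<lambda>g. 0) \<in> N"
    and lin: "\<forall>c. \<forall>\<Phi>\<in>N. \<forall>\<Phi>'\<in>N. (\<lambda>g. c * \<Phi> g + \<Phi>' g) \<in> N \<and>
             T (\<lambda>g. c * \<Phi> g + \<Phi>' g) = sc c (T \<Phi>) + T \<Phi>'"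
    and equi: "\<forall>h\<in>SO4. \<forall>\<Phi>\<in>N. (\<lambda>g. \<Phi> (g ** h)) \<in> N \<and> T (\<lambda>g. \<Phi> (g ** h)) = \<pi> h (T \<Phi>)"
    and surj: "T ` N = UNIV"
    using satake unfolding satake_parameter_def by (elim exE conjE) (rule that)
  have "torus4 a b $ 1 $ 1 = torus4 a' b' $ 1 $ 1" "torus4 a b $ 2 $ 2 = torus4 a' b' $ 2 $ 2"
    using ab by simp_all
  then have ab': "a' = a" "b' = b"
    by (simp_all add: torus4_def)
  have T0: "T (\<lambda>g. 0) = 0"
    using lin[rule_format, OF N(2) N(2), of 1] by simp
  have Tsum: "(\<lambda>g. \<Sum>i\<in>I. F i g) \<in> N \<and> T (\<lambda>g. \<Sum>i\<in>I. F i g) = (\<Sum>i\<in>I. T (F i))"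
    if "finite I" "\<forall>i\<in>I. F i \<in> N" for I :: "'i set" and F
    using that
  proof (induction I rule: finite_induct)
    case (insert i I)
    then have "F i \<in> N" "(\<lambda>g. \<Sum>i\<in>I. F i g) \<in> N" "T (\<lambda>g. \<Sum>i\<in>I. F i g) = (\<Sum>i\<in>I. T (F i))"
      by auto
    then show ?case
      using lin[rule_format, of "F i" "\<lambda>g. \<Sum>i\<in>I. F i g" 1] insert.hyps by simp
  qed (simp add: N T0)
  have Tscale: "T (\<lambda>g. c * \<Phi> g) = sc c (T \<Phi>)" if "\<Phi> \<in> N" for c \<Phi>
    using lin[rule_format, OF that N(2), of c] T0 by simp
  obtain \<Phi> where \<Phi>: "\<Phi> \<in> N" "T \<Phi> = v"
    using surj by (metis UNIV_I image_iff)
  \<comment> \<open>A preimage of a fixed vector need not itself be fixed. Every translate of \<Phi>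
    by \<open>SO4_int\<close> is again a preimage of \<open>v\<close>, so the orbit sum is fixed and
    maps to \<open>v\<close> times the orbit size, which is nonzero.\<close>
  define O' where "O' = (\<lambda>k g. \<Phi> (g ** k)) ` SO4_int"
  have ps: "\<Phi> \<in> principal_series a b"
    using \<Phi> N ab' by blast
  have fin: "finite O'"
    unfolding O'_def by (rule finite_orbit[OF ps])
  have O'N: "\<Psi> \<in> N \<and> T \<Psi> = v" if "\<Psi> \<in> O'" for \<Psi>
    using that equi \<Phi> fixed SO4_int_subset unfolding O'_def by auto
  have one: "mat 1 \<in> (SO4_int :: ('a^4^4) set)"
    by (simp add: SO4_int_def) (simp add: mat_def)
  then have "O' \<noteq> {}"
    unfolding O'_def by blast
  define n :: complex where "n = of_nat (card O')"
  have n: "n \<noteq> 0"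
    using fin \<open>O' \<noteq> {}\<close> by (simp add: n_def)
  define \<Phi>0 where "\<Phi>0 g = (\<Sum>\<Psi>\<in>O'. \<Psi> g)" for g
  have \<Phi>0N: "\<Phi>0 \<in> N" and T\<Phi>0: "T \<Phi>0 = (\<Sum>\<Psi>\<in>O'. v)"
    using Tsum[OF fin, of "\<lambda>\<Psi>. \<Psi>"] O'N unfolding \<Phi>0_def by auto
  have sum_const: "(\<Sum>\<Psi>\<in>O'. v) = sc n v"
    unfolding n_def using fin by (induction O' rule: finite_induct) (simp_all add: scale_left_distrib)
  have \<Phi>0_inv: "\<Phi>0 (g ** k) = \<Phi>0 g" if "k \<in> SO4_int" for g k
    unfolding \<Phi>0_def O'_def using fin that unfolding O'_def by (rule orbit_sum_invariant)
  let ?L = "of_nat q * (a / b + b / a + 2) :: complex"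
  let ?P = "gam_index \<times> gam_index"
  let ?h = "\<lambda>p. m_levi (hecke_rep (fst p) (snd p))"
  have h: "?h p \<in> SO4" for p
    using hecke_rep_SL2[of "fst p" "snd p"] by (intro m_levi_SO4) (simp add: SL2_def)
  have pairs: "(\<Sum>i\<in>gam_index. \<Sum>j\<in>gam_index. f (m_levi (hecke_rep i j))) = (\<Sum>p\<in>?P. f (?h p))"
    for f :: "'a^4^4 \<Rightarrow> complex"
    by (simp add: sum.cartesian_product case_prod_beta)
  have finP: "finite ?P"
    by (simp add: finite_gam_index)
  have "(\<lambda>g. \<Sum>p\<in>?P. \<Phi>0 (g ** ?h p)) = (\<lambda>g. ?L * \<Phi>0 g)"
  proof
    fix g
    have "\<Phi>0 \<in> principal_series a b" "a \<noteq> 0" "b \<noteq> 0"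
      using \<Phi>0N N ab ab' by auto
    then show "(\<Sum>p\<in>?P. \<Phi>0 (g ** ?h p)) = ?L * \<Phi>0 g"
      using spherical_hecke_eigen[of \<Phi>0 a b g] \<Phi>0_inv two
      unfolding pairs[of "\<lambda>h. \<Phi>0 (g ** h)"] by blast
  qed
  moreover have "T (\<lambda>g. \<Sum>p\<in>?P. \<Phi>0 (g ** ?h p)) = (\<Sum>p\<in>?P. \<pi> (?h p) (T \<Phi>0))"
    using Tsum[OF finP, of "\<lambda>p g. \<Phi>0 (g ** ?h p)"] equi h \<Phi>0N by simp
  ultimately have "(\<Sum>p\<in>?P. \<pi> (?h p) (sc n v)) = sc ?L (sc n v)"
    using Tscale[OF \<Phi>0N] T\<Phi>0 sum_const by simp
  then have "l (\<pi> g (\<Sum>p\<in>?P. \<pi> (?h p) (sc n v))) = l (\<pi> g (sc ?L (sc n v)))"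
    by simp
  moreover have "l (\<pi> g (\<Sum>p\<in>?P. \<pi> (?h p) (sc n v))) = (\<Sum>p\<in>?P. n * l (\<pi> (g ** ?h p) v))"
  proof -
    have "l (\<pi> g (\<Sum>p\<in>Q. \<pi> (?h p) (sc n v))) = (\<Sum>p\<in>Q. l (\<pi> g (\<pi> (?h p) (sc n v))))" if "finite Q" for Q
      using that by (induction Q rule: finite_induct)
        (simp_all add: smooth_rep_linear[OF \<pi> g] whittaker_functional_linear[OF l])
    then show ?thesis
      using finP by (simp add: smooth_rep_linear[OF \<pi>] whittaker_functional_linear[OF l] g h
          smooth_rep_mult[OF \<pi> g])
  qed
  ultimately have "n * (\<Sum>p\<in>?P. l (\<pi> (g ** ?h p) v)) = n * (?L * l (\<pi> g v))"
    by (simp add: smooth_rep_linear[OF \<pi> g] whittaker_functional_linear[OF l] sum_distrib_left mult_ac)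
  then show ?thesis
    unfolding pairs[of "\<lambda>h. l (\<pi> (g ** h) v)"] using n by simp
qed

text \<open>Adding \<open>y0\<close> permutes the residue classes and multiplies the sum by a value
  other than 1.\<close>

lemma sum_character_reps:
  assumes \<psi>: "unramified_additive_character \<psi>"
  shows "(\<Sum>y\<in>reps. \<psi> (y / unif)) = (0::complex)"
proof -
  have \<psi>1: "\<psi> z = 1" if "z \<in> integers" for z
    using \<psi> that by (simp add: unramified_additive_character_def)
  have \<psi>add: "\<psi> (y + z) = \<psi> y * \<psi> z" for y z
    using \<psi> by (simp add: unramified_additive_character_def additive_character_def)
  have "inverse unif \<notin> integers"
    using nrm_unif_less_1 by (simp add: mem_integers nrm_inverse inverse_le_1_iff)
  then obtain y0 where y0: "y0 \<in> integers" "\<psi> (inverse unif * y0) \<noteq> 1"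
    by (rule unramified_nontrivial[OF \<psi>])
  define p where "p y = rep (y + y0)" for y
  have pp: "nrm (y + y0 - p y) < 1" if "y \<in> reps" for y
    using rep(1)[OF integers_add[OF reps_integers[OF that] y0(1)]] by (simp add: p_def)
  have "inj_on p reps"
  proof (rule inj_onI)
    fix y y' assume y: "y \<in> reps" "y' \<in> reps" "p y = p y'"
    have "nrm ((y + y0 - p y) - (y' + y0 - p y')) < 1"
      by (rule nrm_diff_less[OF pp[OF y(1)] pp[OF y(2)]])
    then show "y = y'"
      using y by (intro reps_eq) simp_all
  qed
  moreover have "p ` reps \<subseteq> reps"
    using y0 reps_integers by (auto simp: p_def intro!: rep_in_reps integers_add)
  ultimately have "bij_betw p reps reps"
    using finite_reps by (simp add: bij_betw_def endo_inj_surj)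
  then have "(\<Sum>y\<in>reps. \<psi> (y / unif)) = (\<Sum>y\<in>reps. \<psi> (p y / unif))"
    by (rule sum.reindex_bij_betw[symmetric])
  also have "\<dots> = (\<Sum>y\<in>reps. \<psi> (inverse unif * y0) * \<psi> (y / unif))"
  proof (rule sum.cong[OF refl])
    fix y assume "y \<in> reps"
    then have "\<psi> ((y + y0 - p y) / unif) = 1"
      using pp unif_dvd by (intro \<psi>1) blast
    moreover have "inverse unif * y0 + y / unif = p y / unif + (y + y0 - p y) / unif"
      by (simp add: divide_inverse algebra_simps)
    then have "\<psi> (inverse unif * y0) * \<psi> (y / unif) = \<psi> (p y / unif) * \<psi> ((y + y0 - p y) / unif)"
      by (simp only: flip: \<psi>add)
    ultimately show "\<psi> (p y / unif) = \<psi> (inverse unif * y0) * \<psi> (y / unif)"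
      by simp
  qed
  finally have "(\<Sum>y\<in>reps. \<psi> (y / unif)) = \<psi> (inverse unif * y0) * (\<Sum>y\<in>reps. \<psi> (y / unif))"
    unfolding sum_distrib_left .
  then have "(1 - \<psi> (inverse unif * y0)) * (\<Sum>y\<in>reps. \<psi> (y / unif)) = 0"
    by (simp add: left_diff_distrib)
  then show ?thesis
    using y0 by simp
qed

text \<open>Evaluate the eigenvalue equation at \<open>t_SL2 (unif ^ n)\<close>; every Hecke element
  is upper triangular, so each term is a value of \<psi> times a torus value of \<open>W\<close>.
  For positive \<open>n\<close> all these values of \<psi> are 1. For \<open>n = 0\<close> the sum
  over \<open>y / unif\<close> vanishes and so does the term at \<open>inverse unif\<close>.\<close>

lemma whittaker_torus_recurrence:
  fixes W :: "'a^4^4 \<Rightarrow> complex" and \<psi> :: "'a \<Rightarrow> complex"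
  assumes \<psi>: "unramified_additive_character \<psi>"
    and W_left: "\<And>x g. g \<in> SO4 \<Longrightarrow> W (u_elt x 0 ** g) = \<psi> x * W g"
    and W_right: "\<And>g k. g \<in> SO4 \<Longrightarrow> k \<in> SO4_int \<Longrightarrow> W (g ** k) = W g"
    and eigen: "\<And>g. g \<in> SO4 \<Longrightarrow> (\<Sum>i\<in>gam_index. \<Sum>j\<in>gam_index. W (g ** m_levi (hecke_rep i j))) = lam * W g"
  defines "c \<equiv> \<lambda>n. W (m_levi (t_SL2 (unif ^ n)))"
  shows "of_nat q ^ 2 * c 1 + of_nat q * c 0 = lam * c 0"
    and "of_nat q ^ 2 * c (Suc (Suc n)) + 2 * of_nat q * c (Suc n) + c n = lam * c (Suc n)"
proof -
  have \<psi>1: "\<psi> z = 1" if "z \<in> integers" for z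
    using \<psi> that by (simp add: unramified_additive_character_def)
  have det: "det (n_SL2 z) \<noteq> 0" "a \<noteq> 0 \<Longrightarrow> det (t_SL2 a) \<noteq> 0" for z a :: 'a
    by (simp_all add: n_mat2 t_mat2)
  have tr: "W (m_levi (t_SL2 a) ** m_levi (n_SL2 z ** t_SL2 b)) = \<psi> (a^2 * z) * W (m_levi (t_SL2 (a * b)))"
    if "a \<noteq> 0" "b \<noteq> 0" for a b z
  proof -
    have "t_SL2 a ** (n_SL2 z ** t_SL2 b) = n_SL2 (a^2 * z) ** t_SL2 (a * b)"
      using that by (simp add: t_mat2 n_mat2 field_simps power2_eq_square)
    then have "m_levi (t_SL2 a) ** m_levi (n_SL2 z ** t_SL2 b) = m_levi (n_SL2 (a^2 * z)) ** m_levi (t_SL2 (a * b))"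
      using that det by (simp add: det_mul flip: m_levi_mult)
    then show ?thesis
      using that det by (simp add: m_levi_n W_left m_levi_SO4)
  qed
  have sum: "(\<Sum>x\<in>reps. \<Sum>y\<in>reps. \<psi> (a^2 * (x + unif * y)) * W (m_levi (t_SL2 (a * unif))))
      + (\<Sum>x\<in>reps. \<psi> (a^2 * x) * W (m_levi (t_SL2 a)))
      + (\<Sum>y\<in>reps. \<psi> (a^2 * (y / unif)) * W (m_levi (t_SL2 a)))
      + W (m_levi (t_SL2 (a * inverse unif))) = lam * W (m_levi (t_SL2 a))" if "a \<noteq> 0" for a
    using eigen[OF m_levi_SO4[OF det(2)[OF that]]] that
    unfolding hecke_sum[of "\<lambda>h. W (m_levi (t_SL2 a) ** m_levi h)"] by (simp add: tr \<psi>1)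
  have int: "unif ^ m * x \<in> integers" if "x \<in> integers" for m x
    using that nrm_unif_less_1 by (simp add: mem_integers nrm_mult nrm_power mult_le_one power_le_one)
  have ru: "x + unif * y \<in> integers" if "x \<in> reps" "y \<in> reps" for x y
    using that reps_integers int[of y 1] by (simp add: integers_add)
  \<comment> \<open>An integral unipotent is absorbed on the right, but moved to the left it acts by
    \<open>\<psi> (inverse unif ^ 2 * z)\<close>, which differs from 1 for a suitable
    \<open>z\<close>.\<close>
  have van: "W (m_levi (t_SL2 (inverse unif))) = 0"
  proof -
    have "inverse unif ^ 2 \<notin> integers"
      using power_strict_decreasing[of 0 2 "nrm unif"] nrm_unif_less_1
      by (simp add: mem_integers nrm_power nrm_inverse power_inverse inverse_le_1_iff)
    then obtain z where z: "z \<in> integers" "\<psi> (inverse unif ^ 2 * z) \<noteq> 1"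
      by (rule unramified_nontrivial[OF \<psi>])
    have "m_levi (n_SL2 z) \<in> SO4_int"
      using z by (intro m_levi_SO4_int) (simp add: GL2_int_mat2 n_mat2)
    then have "W (m_levi (t_SL2 (inverse unif)) ** m_levi (n_SL2 z)) = W (m_levi (t_SL2 (inverse unif)))"
      by (intro W_right m_levi_SO4 det) simp_all
    moreover have "t_SL2 1 = (mat 1 :: 'a^2^2)"
      by (simp add: t_mat2 mat2_one)
    ultimately have "\<psi> (inverse unif ^ 2 * z) * W (m_levi (t_SL2 (inverse unif))) = W (m_levi (t_SL2 (inverse unif)))"
      using tr[of "inverse unif" 1 z] by simp
    then show ?thesis
      using z by simp
  qed
  show "of_nat q ^ 2 * c 1 + of_nat q * c 0 = lam * c 0"
    using sum[of 1] sum_character_reps[OF \<psi>]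
    by (simp add: c_def \<psi>1 ru reps_integers card_reps van power2_eq_square mult.assoc flip: sum_distrib_right cong: sum.cong)
  have ru': "(unif ^ Suc n)^2 * (y / unif) \<in> integers" if "y \<in> reps" for y
  proof -
    have "(unif ^ Suc n)^2 * (y / unif) = unif ^ (2 * n + 1) * y"
      by (simp add: power2_eq_square power_add mult_2)
    then show ?thesis
      using int[OF reps_integers[OF that], of "2 * n + 1"] by simp
  qed
  have ru'': "(unif ^ Suc n)^2 * x \<in> integers" if "x \<in> integers" for x
    using int[OF that, of "Suc n * 2"] by (simp only: power_mult)
  have "(\<Sum>x\<in>reps. \<Sum>y\<in>reps. \<psi> ((unif ^ Suc n)^2 * (x + unif * y)) * c (Suc (Suc n))) = (\<Sum>x\<in>reps. \<Sum>y\<in>reps. c (Suc (Suc n)))"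
    by (intro sum.cong refl) (simp only: \<psi>1[OF ru''[OF ru]] mult_1_left)
  moreover have "(\<Sum>x\<in>reps. \<psi> ((unif ^ Suc n)^2 * x) * c (Suc n)) = (\<Sum>x\<in>reps. c (Suc n))"
    by (intro sum.cong refl) (simp only: \<psi>1[OF ru''[OF reps_integers]] mult_1_left)
  moreover have "(\<Sum>y\<in>reps. \<psi> ((unif ^ Suc n)^2 * (y / unif)) * c (Suc n)) = (\<Sum>y\<in>reps. c (Suc n))"
    by (intro sum.cong refl) (simp only: \<psi>1[OF ru'] mult_1_left)
  moreover have "unif ^ Suc n * unif = unif ^ Suc (Suc n)" "unif ^ Suc n * inverse unif = unif ^ n"
    by simp_all
  ultimately show "of_nat q ^ 2 * c (Suc (Suc n)) + 2 * of_nat q * c (Suc n) + c n = lam * c (Suc n)"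
    using sum[of "unif ^ Suc n"] unfolding c_def[symmetric]
    by (simp only: c_def sum_constant card_reps) (simp add: c_def algebra_simps power2_eq_square)
qed

end

section \<open>The zeta integral\<close>

text \<open>Multiplication by \<open>1 - (al + inverse al) * X + X^2\<close> telescopes the series.
  The coefficient of \<open>X\<close> that is left over is
  \<open>C 1 - (al + inverse al) * C 0 = 1\<close>.\<close>

lemma symmetric_square_series:
  fixes C :: "nat \<Rightarrow> complex" and al X :: complex
  assumes al: "al \<noteq> 0" and C0: "C 0 = 1" and C1: "C 1 = al + inverse al + 1"
    and CSS: "\<And>n. C (Suc (Suc n)) = (al + inverse al) * C (Suc n) - C n"
    and X: "norm X * (norm al + norm (inverse al) + 2) < 1"
  shows "summable (\<lambda>n. norm (X ^ n * C n))"
    and "(\<Sum>n. X ^ n * C n) = (1 + X) / ((1 - al * X) * (1 - inverse al * X))"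
    and "1 - X \<noteq> 0"
proof -
  define B where "B = norm al + norm (inverse al) + 2"
  have B: "B \<ge> 2"
    by (simp add: B_def)
  have bound: "norm (C n) \<le> B ^ n \<and> norm (C (Suc n)) \<le> B ^ Suc n" for n
  proof (induction n)
    case 0
    have "norm (C 1) \<le> norm al + norm (inverse al) + norm (1::complex)"
      unfolding C1 by (intro norm_triangle_mono order_refl)
    then show ?case
      by (simp add: C0 B_def)
  next
    case (Suc n)
    have "norm (C (Suc (Suc n))) \<le> norm (al + inverse al) * norm (C (Suc n)) + norm (C n)"
      unfolding CSS by (metis norm_mult norm_triangle_ineq4)
    also have "\<dots> \<le> (B - 2) * B ^ Suc n + B ^ n"
      using Suc norm_triangle_ineq[of al "inverse al"] B
      by (intro add_mono mult_mono) (auto simp: B_def)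
    also have "\<dots> \<le> (B - 2) * B ^ Suc n + B ^ Suc n"
      using B power_increasing[of n "Suc n" B] by simp
    also have "\<dots> \<le> B * B ^ Suc n"
      using B by (simp add: algebra_simps)
    finally show ?case
      using Suc by simp
  qed
  have XB: "norm X * B < 1"
    using X by (simp add: B_def)
  show sum: "summable (\<lambda>n. norm (X ^ n * C n))"
  proof (rule summable_comparison_test')
    show "summable (\<lambda>n. (norm X * B) ^ n)"
      using XB B by (intro summable_geometric) simp
    fix n
    show "norm (norm (X ^ n * C n)) \<le> (norm X * B) ^ n"
      using bound[of n] by (simp add: norm_mult norm_power power_mult_distrib mult_left_mono)
  qed
  have small: "norm (c * X) < 1" if "norm c \<le> B" for c
    using mult_right_mono[OF that, of "norm X"] XB by (simp add: norm_mult mult.commute)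
  have nz: "1 - c * X \<noteq> 0" if "norm c \<le> B" for c
    using small[OF that] by auto
  show "1 - X \<noteq> 0"
    using nz[of 1] B by simp
  define S where "S = (\<Sum>n. X ^ n * C n)"
  have s0: "summable (\<lambda>n. X ^ n * C n)"
    using sum by (rule summable_norm_cancel)
  have s1: "summable (\<lambda>n. X ^ Suc n * C (Suc n))"
    using s0 by (subst summable_Suc_iff)
  have S1: "(\<Sum>n. X ^ Suc n * C (Suc n)) = S - 1"
    using suminf_split_head[OF s0] by (simp add: S_def C0)
  have "S - 1 = X * C 1 + (\<Sum>n. X ^ Suc (Suc n) * C (Suc (Suc n)))"
    using suminf_split_head[OF s1] S1 by simp
  also have "(\<Sum>n. X ^ Suc (Suc n) * C (Suc (Suc n))) =
      (\<Sum>n. (al + inverse al) * X * (X ^ Suc n * C (Suc n)) - X^2 * (X ^ n * C n))"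
    by (simp add: CSS algebra_simps power2_eq_square)
  also have "\<dots> = (al + inverse al) * X * (\<Sum>n. X ^ Suc n * C (Suc n)) - X^2 * S"
    unfolding S_def
    by (subst suminf_diff[symmetric]) (intro summable_mult s0 s1 | simp only: suminf_mult s0 s1)+
  also note S1
  finally have "S * (1 - (al + inverse al) * X + X^2) = 1 + X"
    by (simp add: C1[unfolded One_nat_def] algebra_simps)
  moreover have "1 - (al + inverse al) * X + X^2 = (1 - al * X) * (1 - inverse al * X)"
    using al by (simp add: field_simps power2_eq_square)
  moreover have "1 - al * X \<noteq> 0" "1 - inverse al * X \<noteq> 0"
    by (rule nz, simp add: B_def)+
  ultimately show "(\<Sum>n. X ^ n * C n) = (1 + X) / ((1 - al * X) * (1 - inverse al * X))"
    by (simp add: S_def[symmetric] eq_divide_eq)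
qed

lemma of_real_powr_eq_exp: "x > 0 \<Longrightarrow> (of_real x :: complex) powr z = exp (z * of_real (ln x))"
  by (simp add: powr_def Ln_of_real)

section \<open>Integration over the shells of constant absolute value\<close>

context uniformized begin

lemma q_pow_eq_exp: "q_pow TYPE('a) z = exp (z * of_real (ln (real q)))"
  using of_real_powr_eq_exp[OF q_pos, of z] by (simp only: q_pow_def q_def of_real_of_nat_eq)

lemma shell_measurable:
  assumes da: "mult_haar_normalized da"
  shows "{x::'a. nrm x = nrm unif ^ n} \<in> sets da"
    and "emeasure da {x::'a. nrm x = nrm unif ^ n} = 1"
proof -
  let ?S = "\<lambda>n. {x::'a. nrm x = nrm unif ^ n}"
  have S: "?S n \<in> sets da" for n
  proof -
    have "?S n = {x. nrm (x - 0) \<le> nrm unif ^ n} - {x. nrm (x - 0) \<le> nrm unif ^ Suc n}"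
    proof (intro equalityI subsetI)
      fix x :: 'a assume "x \<in> ?S n"
      then show "x \<in> {x. nrm (x - 0) \<le> nrm unif ^ n} - {x. nrm (x - 0) \<le> nrm unif ^ Suc n}"
        using nrm_unif_less_1 by (simp add: not_le)
    next
      fix x :: 'a assume x: "x \<in> {x. nrm (x - 0) \<le> nrm unif ^ n} - {x. nrm (x - 0) \<le> nrm unif ^ Suc n}"
      then have "nrm (x / unif ^ n) \<le> 1" "\<not> nrm (x / unif ^ n) \<le> nrm unif"
        by (simp_all add: nrm_divide nrm_power divide_le_eq)
      then have "nrm (x / unif ^ n) = 1"
        using nrm_less_1[of "x / unif ^ n"] by linarith
      then show "x \<in> ?S n"
        by (simp add: nrm_divide nrm_power)
    qed
    moreover have "{x::'a. nrm (x - 0) \<le> nrm unif ^ m} \<in> sets borel" for m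
      by (intro borel_closed clopen_ball_nrm) simp
    ultimately have "?S n \<in> sets borel"
      by (simp only: sets.Diff)
    moreover have "?S n = - {0} \<inter> ?S n"
      by auto
    ultimately show ?thesis
      using da unfolding mult_haar_normalized_def sets_restrict_space by blast
  qed
  show "?S n \<in> sets da"
    by (rule S)
  have "?S n = (\<lambda>y. unif ^ n * y) ` ?S 0"
  proof (intro equalityI subsetI)
    fix x :: 'a assume "x \<in> ?S n"
    then show "x \<in> (\<lambda>y. unif ^ n * y) ` ?S 0"
      by (intro image_eqI[of _ _ "x / unif ^ n"]) (simp_all add: nrm_divide nrm_power)
  qed (auto simp: nrm_mult nrm_power)
  moreover have "emeasure da ((\<lambda>y. unif ^ n * y) ` ?S 0) = emeasure da (?S 0)"
    using da S[of 0] unfolding mult_haar_normalized_def by (metis power_not_zero unif_nz)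
  ultimately show "emeasure da (?S n) = 1"
    using da by (simp add: mult_haar_normalized_def)
qed

text \<open>By multiplicative invariance every shell times \<open>SL2_int\<close> has mass 1, so
  \<open>H\<close> is a sum of constants on disjoint sets of mass 1. Absolute summability permits
  exchanging sum and integral.\<close>

lemma integral_over_shells:
  fixes H :: "'a \<times> ('a^2^2) \<Rightarrow> complex"
  assumes da: "mult_haar_normalized da" and dk: "SL2_int_haar_normalized dk"
    and inside: "\<And>n x k. nrm x = nrm unif ^ n \<Longrightarrow> k \<in> SL2_int \<Longrightarrow> H (x, k) = G n"
    and outside: "\<And>x k. nrm x > 1 \<Longrightarrow> k \<in> SL2_int \<Longrightarrow> H (x, k) = 0"
    and G: "summable (\<lambda>n. norm (G n))"
  shows "integrable (da \<Otimes>\<^sub>M dk) H" and "(\<integral>p. H p \<partial>(da \<Otimes>\<^sub>M dk)) = (\<Sum>n. G n)"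
proof -
  let ?S = "\<lambda>n. {x::'a. nrm x = nrm unif ^ n}"
  let ?A = "\<lambda>n. ?S n \<times> (SL2_int :: ('a^2^2) set)"
  let ?M = "da \<Otimes>\<^sub>M dk"
  define f where "f n p = indicator (?A n) p *\<^sub>R G n" for n p
  have K: "space dk = SL2_int" "SL2_int \<in> sets dk" "emeasure dk SL2_int = 1"
    using dk sets.top[of dk] unfolding SL2_int_haar_normalized_def by auto
  interpret finite_measure dk
    by (rule finite_measureI) (simp add: K)
  have sp: "space ?M = (- {0}) \<times> SL2_int"
    using da K by (simp add: space_pair_measure mult_haar_normalized_def)
  have A: "?A n \<in> sets ?M" "emeasure ?M (?A n) = 1" for n
    using shell_measurable[OF da] K by (simp_all add: emeasure_pair_measure_Times)
  have mA: "measure ?M (?A n \<inter> space ?M) = 1" for n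
    using A[of n] sets.sets_into_space[OF A(1)[of n]] by (simp add: measure_def inf.absorb1)
  have int: "integrable ?M (f n)" for n
    unfolding f_def using A by (intro integrable_scaleR_left integrable_real_indicator) simp_all
  have int_f: "(\<integral>p. f n p \<partial>?M) = G n" for n
    unfolding f_def using A mA by (subst integral_scaleR_left) auto
  have int_norm: "(\<integral>p. norm (f n p) \<partial>?M) = norm (G n)" for n
    unfolding f_def using A mA by simp
  have H: "(\<lambda>n. f n p) sums H p \<and> summable (\<lambda>n. norm (f n p))" if p: "p \<in> space ?M" for p
  proof -
    obtain x k where xk: "p = (x, k)" "x \<noteq> 0" "k \<in> SL2_int"
      using p unfolding sp by auto
    show ?thesis
    proof (cases "nrm x > 1")
      case True
      have "nrm unif ^ n \<le> 1" for n
        using nrm_unif_less_1 by (intro power_le_one) auto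
      then have "f n p = 0" for n
        using True by (auto simp: f_def xk indicator_def) (metis not_less)
      then show ?thesis
        using outside[OF True xk(3)] by (simp add: xk sums_zero)
    next
      case False
      obtain u m where u: "x = unif powi m * u" "nrm u = 1"
        by (rule unit_decomp[OF xk(2)])
      have "m \<ge> 0"
      proof (rule ccontr)
        assume "\<not> m \<ge> 0"
        then have "real q powi 0 < real q powi (- m)"
          using q_gt_1 by (intro power_int_strict_increasing) auto
        then show False
          using False u by (simp add: nrm_mult nrm_unif_powi)
      qed
      then have "x = unif ^ nat m * u"
        using u by (simp add: power_int_def)
      then have nx: "nrm x = nrm unif ^ nat m"
        using u(2) by (simp only: nrm_mult nrm_power mult_1_right)
      have lt: "nrm unif ^ i < nrm unif ^ j" if "j < i" for i j
        using nrm_unif_less_1 by (intro power_strict_decreasing that) simp_all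
      have "nrm unif ^ nat m = nrm unif ^ n \<longleftrightarrow> n = nat m" for n
        using lt[of n "nat m"] lt[of "nat m" n] by (metis less_irrefl linorder_neqE_nat)
      then have "p \<in> ?A n \<longleftrightarrow> n = nat m" for n
        using xk nx by simp
      moreover have "H p = G (nat m)"
        using inside[OF nx xk(3)] xk(1) by simp
      ultimately have "f n p = (if n = nat m then H p else 0)" for n
        by (simp add: f_def)
      then show ?thesis
        using sums_single[of "nat m" "\<lambda>_. H p"] summable_finite[of "{nat m}" "\<lambda>n. norm (f n p)"] by simp
    qed
  qed
  have ae: "AE p in ?M. summable (\<lambda>n. norm (f n p))"
    using H by (intro AE_I2) blast
  have sm: "summable (\<lambda>n. \<integral>p. norm (f n p) \<partial>?M)"
    using G by (simp only: int_norm)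
  note * = integrable_suminf[OF int ae sm] integral_suminf[OF int ae sm]
  have eq: "(\<Sum>n. f n p) = H p" if "p \<in> space ?M" for p
    using H[OF that] by (simp add: sums_iff)
  show "integrable ?M H"
    using *(1) by (simp cong: Bochner_Integration.integrable_cong add: eq)
  show "(\<integral>p. H p \<partial>?M) = (\<Sum>n. G n)"
    using *(2) by (simp cong: Bochner_Integration.integral_cong add: eq int_f)
qed

end

text \<open>Identity theorem: on the connected plane the difference is zero, or nonzero, away from a
  sparse set, and the half plane excludes the second alternative.\<close>

lemma meromorphic_eq_cosparse_of_half_plane:
  assumes "f meromorphic_on UNIV" "g meromorphic_on UNIV"
    and eq: "\<And>s. Re s > c \<Longrightarrow> f s = g s"
  shows "\<forall>\<^sub>\<approx>s\<in>UNIV. f s = g s"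
proof -
  have "(\<lambda>s. f s - g s) meromorphic_on UNIV"
    by (intro meromorphic_intros assms)
  then have "(\<forall>\<^sub>\<approx>s\<in>UNIV. f s - g s = 0) \<or> (\<forall>\<^sub>\<approx>s\<in>UNIV. f s - g s \<noteq> 0)"
    by (intro meromorphic_imp_constant_or_avoid) auto
  moreover have "\<not> (\<forall>\<^sub>\<approx>s\<in>UNIV. f s - g s \<noteq> 0)"
  proof
    assume "\<forall>\<^sub>\<approx>s\<in>UNIV. f s - g s \<noteq> 0"
    then have "\<forall>\<^sub>F s in at (of_real (c + 1)). f s - g s \<noteq> 0"
      by (simp add: eventually_cosparse_open_eq)
    moreover have "\<forall>\<^sub>F s in at (of_real (c + 1)). s \<in> {s. Re s > c}"
      by (intro eventually_at_in_open' open_halfspace_Re_gt) simp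
    ultimately have "\<forall>\<^sub>F s in at (of_real (c + 1) :: complex). False"
      by eventually_elim (simp add: eq)
    then show False
      by simp
  qed
  ultimately show ?thesis
    by simp
qed

section \<open>The integrand on a shell\<close>

context metaplectic_section begin

text \<open>The factor \<open>of_nat q ^ n\<close> comes from \<open>|x|\<^bsup>s+1\<^esup> |x|\<^bsup>-2\<^esup> = (q\<^bsup>-s\<^esup> q)\<^sup>n\<close>.\<close>

lemma zeta_integrand_shell:
  assumes W: "\<And>g k. g \<in> SO4 \<Longrightarrow> k \<in> SO4_int \<Longrightarrow> W (g ** k) = W g"
    and \<eta>: "quasi_character \<eta>" and x: "nrm x = nrm unif ^ n" and k: "k \<in> SL2_int"
  shows "zeta_integrand \<omega> W \<phi>0 f (x, k) =
    (chi unif * \<eta> unif * q_pow TYPE('a) (- s)) ^ n * (of_nat q ^ n * W (m_levi (t_SL2 (unif ^ n))))"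
proof -
  have "x \<noteq> 0"
    using x by auto
  \<comment> \<open>The unit part of \<open>x\<close> is moved into the compact factor, where
    \<open>W\<close> does not see it.\<close>
  define u where "u = x / unif ^ n"
  have u: "x = unif ^ n * u" "nrm u = 1"
    using x by (simp_all add: u_def nrm_divide nrm_power)
  then have "u \<noteq> 0"
    by auto
  have tk: "t_SL2 u ** k \<in> SL2_int"
    using u(2) \<open>u \<noteq> 0\<close> k by (intro SL2_int_mult) (simp_all add: t_mat2 SL2_int_mat2 mem_integers nrm_inverse)
  have "t_SL2 x ** k = t_SL2 (unif ^ n) ** (t_SL2 u ** k)"
    by (simp add: u(1) t_mat2 matrix_mul_assoc)
  then have "m_levi (t_SL2 x ** k) = m_levi (t_SL2 (unif ^ n)) ** m_levi (t_SL2 u ** k)"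
    using GL2_int_det[OF SL2_int_GL2_int[OF tk]] by (simp add: m_levi_mult t_mat2)
  then have W': "W (m_levi (t_SL2 x ** k)) = W (m_levi (t_SL2 (unif ^ n)))"
    using tk by (simp add: W m_levi_SO4 m_levi_SO4_int SL2_int_GL2_int t_mat2)
  have \<eta>_mult: "\<eta> (y * z) = \<eta> y * \<eta> z" if "y \<noteq> 0" "z \<noteq> 0" for y z
    using \<eta> that by (simp add: quasi_character_def)
  have "\<eta> (unif ^ n) = \<eta> unif ^ n"
    by (induction n) (simp_all add: \<eta>_mult eta_unit)
  then have \<eta>x: "\<eta> x = \<eta> unif ^ n"
    using \<open>u \<noteq> 0\<close> u by (simp add: \<eta>_mult eta_unit)
  have \<mu>x: "\<mu> x ^ 2 = chi unif ^ n"
    unfolding u(1) by (rule \<mu>_square[OF u(2)])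
  have \<phi>x: "\<phi>0 x = 1"
    using x nrm_unif_less_1 by (simp add: indicator_def mem_integers power_le_one)
  have lnx: "ln (nrm x) = - (of_nat n * ln (real q))"
    unfolding x using q_ge_2 by (simp add: nrm_unif ln_realpow ln_div)
  have "of_real (nrm x) powr (s + 1) = exp ((s + 1) * of_real (ln (nrm x)))"
    using \<open>x \<noteq> 0\<close> by (intro of_real_powr_eq_exp) simp
  also have "\<dots> = exp (of_nat n * (- s * of_real (ln (real q)))) * exp (of_real (ln (nrm x)))"
    by (simp add: lnx algebra_simps flip: exp_add)
  also have "\<dots> = q_pow TYPE('a) (- s) ^ n * of_real (nrm x)"
    using \<open>x \<noteq> 0\<close> by (simp only: exp_of_nat_mult q_pow_eq_exp) (simp add: exp_of_real)
  finally have px: "of_real (nrm x) powr (s + 1) = q_pow TYPE('a) (- s) ^ n * of_real (nrm x)" .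
  have d: "of_real (nrm x) * of_real (nrm x powi (- 2)) = (of_nat q ^ n :: complex)"
  proof -
    have "nrm x * nrm x powi (- 2) = inverse (nrm x)"
      using \<open>x \<noteq> 0\<close> by (simp add: power_int_minus power2_eq_square)
    also have "\<dots> = real q ^ n"
      unfolding x by (simp add: nrm_unif power_one_over)
    finally show ?thesis
      by (metis of_real_mult of_real_of_nat_eq of_real_power)
  qed
  have "zeta_integrand \<omega> W \<phi>0 f (x, k) = W (m_levi (t_SL2 x ** k)) *
      (\<omega> (t_SL2 x ** k, 1) \<phi>0 1 * f (t_SL2 x ** k, 1)) * of_real (nrm x powi (- 2))"
    by (simp only: zeta_integrand_def Let_def split mult.assoc)
  also have "\<dots> = (chi unif * \<eta> unif * q_pow TYPE('a) (- s)) ^ n *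
      (of_real (nrm x) * of_real (nrm x powi (- 2))) * W (m_levi (t_SL2 (unif ^ n)))"
    unfolding W' weil_times_section[OF \<open>x \<noteq> 0\<close> k] \<eta>x \<mu>x \<phi>x px
    by (simp only: power_mult_distrib mult_ac mult_1_left)
  finally show ?thesis
    by (simp only: d mult.assoc)
qed

lemma zeta_integrand_outside:
  assumes "nrm x > 1" "k \<in> SL2_int"
  shows "zeta_integrand \<omega> W \<phi>0 f (x, k) = 0"
proof -
  have "x \<noteq> 0" "\<phi>0 x = 0"
    using assms by (auto simp: indicator_def mem_integers)
  then show ?thesis
    using weil_times_section[OF \<open>x \<noteq> 0\<close> assms(2)] by (simp add: zeta_integrand_def Let_def)
qed

end

lemma meromorphic_on_q_pow:
  assumes "uniformizer (w :: 'a::nonarch_local_field)" and "g analytic_on UNIV"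
  shows "(\<lambda>s. q_pow TYPE('a) (g s)) meromorphic_on UNIV"
proof -
  interpret uniformized w by unfold_locales (rule assms)
  have "(\<lambda>s. q_pow TYPE('a) (g s)) = (\<lambda>s. exp (g s * of_real (ln (real q))))"
    by (simp only: q_pow_eq_exp)
  moreover have "(\<lambda>s. exp (g s * of_real (ln (real q)))) meromorphic_on UNIV"
    by (intro analytic_on_imp_meromorphic_on analytic_intros assms)
  ultimately show ?thesis
    by simp
qed

text \<open>Continuation is expressed through an arbitrary meromorphic \<open>Z\<close> agreeing
  with the integral far to the right. Equality is claimed off a sparse set because values at poles
  are a matter of convention.\<close>

theorem proposition2p5:
  fixes \<psi> \<eta> \<phi>0 :: "'a::nonarch_local_field \<Rightarrow> complex"
    and unif :: 'a
    and sc :: "complex \<Rightarrow> 'v::ab_group_add \<Rightarrow> 'v"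
    and \<pi> :: "'a^4^4 \<Rightarrow> 'v \<Rightarrow> 'v"
    and a b :: complex
    and W0 :: "'a^4^4 \<Rightarrow> complex"
    and f0 :: "complex \<Rightarrow> ('a^2^2) \<times> int \<Rightarrow> complex"
    and \<omega> :: "('a^2^2) \<times> int \<Rightarrow> ('a \<Rightarrow> complex) \<Rightarrow> 'a \<Rightarrow> complex"
    and \<sigma> :: "'a^2^2 \<Rightarrow> int"
    and da :: "'a measure"
    and dk :: "('a^2^2) measure"
  assumes "uniformizer unif"
    and "unramified_additive_character \<psi>"
    and "quasi_character \<eta>"
    and "smooth_rep sc \<pi>" and "irreducible_rep sc \<pi>"
    and "generic_rep sc \<psi> \<pi>" and "unramified_rep \<pi>"
    and "a \<noteq> 0" and "b \<noteq> 0" and "satake_parameter sc \<pi> (torus4 a b)"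
    and "W0 \<in> whittaker_model sc \<psi> \<pi>"
    and "\<forall>g\<in>SO4. \<forall>k\<in>SO4_int. W0 (g ** k) = W0 g"
    and "W0 (mat 1) = 1"
    and "\<phi>0 = indicator integers"
    and "weil_representation (\<lambda>x. inverse (\<psi> x)) \<omega>"
    and "splitting \<sigma>"
    and "\<forall>s. f0 s \<in> induced_space s \<eta> (\<lambda>x. inverse (\<psi> x))"
    and "\<forall>s. \<forall>k\<in>SL2_int. f0 s (k, \<sigma> k) = 1"
    and "mult_haar_normalized da"
    and "SL2_int_haar_normalized dk"
  shows "(\<exists>c. \<forall>s. Re s > c \<longrightarrow>
            zeta_converges da dk \<omega> W0 \<phi>0 (f0 s) \<and>
            zeta_integral da dk \<omega> W0 \<phi>0 (f0 s) =
              L_wedge2_plus unif a b (\<lambda>x. chi x * \<eta> x) s / L_char unif (\<lambda>x. \<eta> x ^ 2) (2 * s)) \<and>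
         (\<forall>Z. Z meromorphic_on UNIV \<longrightarrow>
            (\<exists>c. \<forall>s. Re s > c \<longrightarrow> Z s = zeta_integral da dk \<omega> W0 \<phi>0 (f0 s)) \<longrightarrow>
            (\<forall>\<^sub>\<approx>s\<in>UNIV. Z s =
              L_wedge2_plus unif a b (\<lambda>x. chi x * \<eta> x) s / L_char unif (\<lambda>x. \<eta> x ^ 2) (2 * s)))"
proof -
  note \<psi> = assms(2) and \<pi> = assms(4,5) and ab = assms(8,9)
  interpret weil_splitting unif \<sigma> "\<lambda>x. inverse (\<psi> x)" \<omega>
  proof unfold_locales
    fix x :: 'a assume "x \<in> integers"
    then show "\<sigma> (n_SL2 x) = 1"
      using splitting_trivial_on_n[OF assms(16) assms(17)[rule_format] assms(18)[rule_format, of _ 0, THEN ballI]]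
      by blast
  qed (use assms unramified_additive_character_inverse in blast)+
  have sect: "metaplectic_section unif \<sigma> (\<lambda>x. inverse (\<psi> x)) \<omega> (f0 s) s \<eta>" for s
    using assms(17,18) by unfold_locales blast+
  have two: "(2::'a) \<noteq> 0"
    using nrm_2 by auto
  obtain l v where l: "whittaker_functional sc \<psi> \<pi> l" and W0: "W0 = (\<lambda>g. l (\<pi> g v))"
    using assms(11) by (auto simp: whittaker_model_def)
  have inv: "W0 (g ** k) = W0 g" if "g \<in> SO4" "k \<in> SO4_int" for g k
    using assms(12) that by blast
  have fixed: "\<pi> k v = v" if "k \<in> SO4_int" for k
    using inv[OF _ that] SO4_int_subset[OF that]
    by (intro whittaker_function_fixed_vector[OF \<pi> l]) (simp_all add: W0)
  define al where "al = a / b"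
  have al: "al \<noteq> 0" "inverse al = b / a"
    using ab by (simp_all add: al_def)
  define lam where "lam = of_nat q * (al + inverse al + 2)"
  have eigen: "(\<Sum>i\<in>gam_index. \<Sum>j\<in>gam_index. W0 (g ** m_levi (hecke_rep i j))) = lam * W0 g"
    if "g \<in> SO4" for g
    using whittaker_hecke_eigen[OF \<pi>(1) l fixed two assms(10) that] unfolding W0 lam_def al by (simp add: al_def)
  have left: "W0 (u_elt x 0 ** g) = \<psi> x * W0 g" if "g \<in> SO4" for x g
    using l that smooth_rep_mult[OF \<pi>(1) u_elt_SO4 that] unfolding W0 whittaker_functional_def
    by (metis diff_zero mult_zero_right)
  \<comment> \<open>The power of \<open>q\<close> compensates the decay of \<open>W0\<close> on the
    torus, so the recurrence loses all its powers of \<open>q\<close>.\<close>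
  define C where "C n = of_nat q ^ n * W0 (m_levi (t_SL2 (unif ^ n)))" for n
  note rec = whittaker_torus_recurrence[OF \<psi> left inv eigen]
  have t1: "m_levi (t_SL2 1) = (mat 1 :: 'a^4^4)"
    by (simp add: m_levi_t torus4_def mat4_simps mat_def)
  have q0: "(of_nat q :: complex) \<noteq> 0"
    using q_ge_2 by simp
  have C0: "C 0 = 1"
    using assms(13) by (simp add: C_def t1)
  have C1: "C 1 = al + inverse al + 1"
  proof -
    have "of_nat q * (C 1 + 1) = of_nat q * (al + inverse al + 2)"
      using rec(1) assms(13) by (simp add: C_def t1 lam_def power2_eq_square algebra_simps)
    then show ?thesis
      using q0 by (simp add: eq_diff_eq[symmetric])
  qed
  have CSS: "C (Suc (Suc n)) = (al + inverse al) * C (Suc n) - C n" for n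
    using arg_cong[OF rec(2)[of n], of "\<lambda>z. of_nat q ^ n * z"]
    by (simp add: C_def lam_def power2_eq_square algebra_simps)
  define X where "X s = chi unif * \<eta> unif * q_pow TYPE('a) (- s)" for s
  define R where "R s = L_wedge2_plus unif a b (\<lambda>x. chi x * \<eta> x) s / L_char unif (\<lambda>x. \<eta> x ^ 2) (2 * s)" for s
  define B where "B = norm al + norm (inverse al) + 2"
  \<comment> \<open>With this constant, \<open>Re s > log (real q) K\<close> says exactly that
    \<open>norm (X s) * B < 1\<close>, the convergence condition of the series.\<close>
  define K where "K = norm (\<eta> unif) * B"
  have "\<eta> unif \<noteq> 0"
    using assms(3) by (simp add: quasi_character_def)
  then have K: "K > 0"
    by (simp add: K_def B_def add_nonneg_pos)
  have key: "zeta_converges da dk \<omega> W0 \<phi>0 (f0 s) \<and> zeta_integral da dk \<omega> W0 \<phi>0 (f0 s) = R s"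
    if s: "Re s > log (real q) K" for s
  proof -
    interpret S: metaplectic_section unif \<sigma> "\<lambda>x. inverse (\<psi> x)" \<omega> "f0 s" s \<eta>
      by (rule sect)
    have chi1: "norm (chi unif :: complex) = 1"
      using chi_unif_square by (metis norm_one norm_power power_eq_1_iff norm_ge_zero zero_neq_numeral)
    have "K < real q powr Re s"
      using s K q_gt_1 by (simp add: log_less_iff)
    moreover have "norm (X s) * B * real q powr Re s = K"
    proof -
      have "norm (X s) = norm (\<eta> unif) * exp (- (Re s * ln (real q)))"
        by (simp add: X_def q_pow_eq_exp norm_mult chi1)
      moreover have "real q powr Re s = exp (Re s * ln (real q))"
        using q_ge_2 by (simp add: powr_def)
      ultimately show ?thesis
        by (simp add: K_def exp_minus)
    qed
    ultimately have "norm (X s) * B * real q powr Re s < 1 * real q powr Re s"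
      by simp
    then have XB: "norm (X s) * (norm al + norm (inverse al) + 2) < 1"
      unfolding B_def[symmetric] by (simp only: mult_less_cancel_right) auto
    note series = symmetric_square_series[OF al(1) C0 C1 CSS XB]
    have shell: "zeta_integrand \<omega> W0 \<phi>0 (f0 s) (x, k) = X s ^ n * C n"
      if "nrm x = nrm unif ^ n" "k \<in> SL2_int" for n x k
      using S.zeta_integrand_shell[OF inv assms(3) that] by (simp add: X_def C_def assms(14))
    have outside: "zeta_integrand \<omega> W0 \<phi>0 (f0 s) (x, k) = 0" if "nrm x > 1" "k \<in> SL2_int" for x k
      using S.zeta_integrand_outside[OF that] by (simp add: assms(14))
    note int = integral_over_shells[where H = "zeta_integrand \<omega> W0 \<phi>0 (f0 s)" and G = "\<lambda>n. X s ^ n * C n",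
        OF assms(19,20) shell outside series(1)]
    have "zeta_integral da dk \<omega> W0 \<phi>0 (f0 s) = (1 + X s) / ((1 - al * X s) * (1 - inverse al * X s))"
      unfolding zeta_integral_def using int(2) series(2) by (rule trans)
    also have "\<dots> = R s"
    proof -
      \<comment> \<open>As \<open>chi unif\<close> squares to 1, the factor at \<open>2 * s\<close>
        is \<open>1 - X s ^ 2\<close>. Its divisor \<open>1 - X s\<close> cancels the middle factor
        of the L-function and is nonzero in this half plane.\<close>
      have "q_pow TYPE('a) (- (2 * s)) = q_pow TYPE('a) (- s) ^ 2"
        unfolding q_pow_eq_exp by (simp add: power2_eq_square mult.assoc flip: exp_add)
      then have "\<eta> unif ^ 2 * q_pow TYPE('a) (- (2 * s)) = X s ^ 2"
        by (simp add: X_def power_mult_distrib chi_unif_square)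
      then have "R s = (1 - X s ^ 2) / ((1 - X s) * (1 - al * X s) * (1 - inverse al * X s))"
        using ab by (simp add: R_def L_wedge2_plus_def L_char_def X_def al_def divide_inverse mult_ac)
      also have "1 - X s ^ 2 = (1 - X s) * (1 + X s)"
        by (simp add: power2_eq_square algebra_simps)
      finally show ?thesis
        using series(3) by simp
    qed
    finally show ?thesis
      using int(1) by (simp add: zeta_converges_def)
  qed
  have "R meromorphic_on UNIV"
    unfolding R_def L_wedge2_plus_def L_char_def
    by (intro meromorphic_intros meromorphic_on_q_pow[OF assms(1)] analytic_intros)
  then have "\<forall>\<^sub>\<approx>s\<in>UNIV. Z s = R s"
    if "Z meromorphic_on UNIV" "\<forall>s. Re s > c \<longrightarrow> Z s = zeta_integral da dk \<omega> W0 \<phi>0 (f0 s)" for Z c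
    using that key by (intro meromorphic_eq_cosparse_of_half_plane[of Z R "max c (log (real q) K)"]) auto
  then show ?thesis
    using key unfolding R_def by blast
qed

end
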